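(* Let $\mu$ be a finite measure on $(E,\mathcal E)$. (1) For any $k\in\mathbb Z_+$ and $A\in\mathcal E^{(k)}$ there exists a sequence $(A_n)_{n\in\mathbb Z_+}$ with $A_n\in\mathcal F_k$ for all $n$ such that $\mu^k(A_n\,\Delta\, A)\to 0$ as $n\to\infty$. In addition, for any $\gamma\in(0,\alpha)$, the $L^\gamma$ limit of $M_\alpha^{(k)}(A_n)$ as $n\to\infty$ exists and does not depend on the choice of the approximating sequence $(A_n)_{n\in\mathbb Z_+}$. Denote this a.s. unique limit by $M_\alpha^{(k)}(A)$. (2) The following equality of finite-dimensional distributions holds: $$\bigl(M_\alpha^{(k)}(A)\bigr)_{A\in\mathcal E^{(k)},\,k\in\mathbb Z_+}\ \overset{d}{=}\ \Biggl(\ \bigvee_{\boldsymbol j\in\mathcal D_k}\Bigl\{\prod_{r=1}^k\Gamma_{j_r}^{-1/\alpha}\,\psi(T_{j_r})^{1/\alpha}\Bigr\}\mathbf 1_{\{(T_{j_1},\dots,T_{j_k})\in A\}}\Biggr)_{A\in\mathcal E^{(k)},\,k\in\mathbb Z_+}.$$ (3) For any $\gamma\in(0,\alpha)$ and $r>\alpha$ there is a constant $c>0$ depending only on $(r,\gamma)$ (with $\alpha$, $k$ and $\mu$ fixed) such that $$\bigl\|M_\alpha^{(k)}(A)\bigr\|_\gamma\le c\,\bigl(\mu^k(A)\bigr)^{1/r}\qquad\text{for all }A\in\mathcal E^{(k)} .$$ (4) $M_\alpha^{(k)}$ is $\sigma$-maxitive: for any sets $B_j\in\mathcal E^{(k)}$,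 $j\in\mathbb Z_+$, $$M_\alpha^{(k)}\Bigl(\bigcup_{i=1}^\infty B_i\Bigr)=\bigvee_{i=1}^\infty M_\alpha^{(k)}(B_i)\quad\text{a.s.}$$
   Context: $\mathbb Z_+=\{1,2,\dots\}$, $\alpha\in(0,\infty)$, and $\bigvee$ denotes supremum. $(E,\mathcal E)$ is a Borel space: there is a measurable bijection, with measurable inverse, from $E$ onto a Borel subset of $[0,1]$. The measure $\mu$ is nonzero. An (independently scattered) $\alpha$-Fréchet random sup measure $M_\alpha=(M_\alpha(A))_{A\in\mathcal E}$ with control measure $\mu$ is a family of $[0,\infty]$-valued random variables on one probability space such that: (i) $M_\alpha(A_1),\dots,M_\alpha(A_n)$ are independent for disjoint $A_1,\dots,A_n\in\mathcal E$; (ii) $\mathbb P(M_\alpha(A)\le x)=\exp\{-\mu(A)x^{-\alpha}\}$ for $x\in(0,\infty)$; (iii) $M_\alpha(\bigcup_{j\ge1}A_j)=\bigvee_{j\ge1}M_\alpha(A_j)$ a.s. for any $A_j\in\mathcal E$, $j\in\mathbb Z_+$. Fix such an $M_\alpha$. $\mu^k$ is the $k$-fold product measure on $(E^k,\mathcal E^k)$. $D^{(k)}=\{(x_1,\dots,x_k)\in E^k: x_i=x_j\text{ for some }i\ne j\}$, $E^{(k)}=E^k\setminus D^{(k)}$, and $\mathcal E^{(k)}=\{A\cap E^{(k)}:A\in\mathcal E^k\}$. $\mathcal C_k$ is the collection of off-diagonal rectangles $A_1\times\cdots\times A_k$ with $A_1,\dots,A_k\in\mathcal E$ pairwise disjoint,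 and $\mathcal F_k$ is the collection of finite unions of members of $\mathcal C_k$. On $\mathcal C_k$ set $M_\alpha^{(k)}(A_1\times\cdots\times A_k)=M_\alpha(A_1)\cdots M_\alpha(A_k)$, and on $\mathcal F_k$ set $M_\alpha^{(k)}(\bigcup_{i=1}^mB_i)=\bigvee_{i=1}^mM_\alpha^{(k)}(B_i)$ for $B_i\in\mathcal C_k$ (a.s. independent of the choice of the $B_i$). $\mathcal D_k=\{\boldsymbol j\in\mathbb Z_+^k: j_1,\dots,j_k\text{ all distinct}\}$. $m$ is a probability measure on $(E,\mathcal E)$ equivalent to $\mu$ with $\psi=d\mu/dm\in(0,\infty)$ $m$-a.e.; $(\Gamma_i)_{i\in\mathbb Z_+}$ are the arrival times of a standard (unit rate) Poisson process on $[0,\infty)$; $(T_i)_{i\in\mathbb Z_+}$ are i.i.d. with law $m$, independent of $(\Gamma_i)$. $\|X\|_\gamma=(\mathbb E|X|^\gamma)^{1/\gamma}$, which is a quasi-norm when $0<\gamma<1$. *)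

theory Defs
  imports "HOL-Probability.Probability"
begin

text \<open>
  Conventions. A measure space \<open>(E, \<E>, \<mu>)\<close> is one value \<open>mu\<close> of type \<open>'a measure\<close>. A point of
  \<open>E\<^sup>k\<close> is a function on the index set \<open>{..<k}\<close> (coordinates are numbered from 0), so \<open>\<mu>\<^sup>k\<close> is
  \<open>\<Pi>\<^sub>M i\<in>{..<k}. mu\<close>. Sequences indexed by the positive integers are functions on \<open>nat\<close>, the
  argument 0 giving the first term.
\<close>

definition borel_iso_space :: "'a measure \<Rightarrow> bool" where
  "borel_iso_space mu \<longleftrightarrow>
    (\<exists>B f. B \<in> sets (borel :: real measure) \<and> B \<subseteq> {0..1} \<and> bij_betw f (space mu) B \<and>
       f \<in> measurable mu (restrict_space borel B) \<and>
       the_inv_into (space mu) f \<in> measurable (restrict_space borel B) mu)"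

text \<open>The case distinction in the marginal law only encodes \<open>exp (-\<infinity>) = 0\<close>.\<close>

definition frechet_sup_measure ::
    "'w measure \<Rightarrow> 'a measure \<Rightarrow> real \<Rightarrow> ('a set \<Rightarrow> 'w \<Rightarrow> ennreal) \<Rightarrow> bool" where
  "frechet_sup_measure P mu \<alpha> M \<longleftrightarrow>
    prob_space P \<and>
    (\<forall>A \<in> sets mu. M A \<in> borel_measurable P) \<and>
    (\<forall>n A. (\<forall>i<n. A i \<in> sets mu) \<and> disjoint_family_on A {..<n} \<longrightarrow>
       prob_space.indep_vars P (\<lambda>_. borel) (\<lambda>i. M (A i)) {..<n::nat}) \<and>
    (\<forall>A \<in> sets mu. \<forall>x>0.
       measure P {\<omega> \<in> space P. M A \<omega> \<le> ennreal x} =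
         (if emeasure mu A = \<infinity> then 0 else exp (- (measure mu A * x powr (- \<alpha>))))) \<and>
    (\<forall>A :: nat \<Rightarrow> 'a set. (\<forall>j. A j \<in> sets mu) \<longrightarrow>
       (AE \<omega> in P. M (\<Union>j. A j) \<omega> = (SUP j. M (A j) \<omega>)))"

abbreviation prod_measure :: "'a measure \<Rightarrow> nat \<Rightarrow> (nat \<Rightarrow> 'a) measure" where
  "prod_measure mu k \<equiv> PiM {..<k} (\<lambda>_. mu)"

definition diagonal :: "'a measure \<Rightarrow> nat \<Rightarrow> (nat \<Rightarrow> 'a) set" where
  "diagonal mu k = {x \<in> space (prod_measure mu k). \<exists>i<k. \<exists>j<k. i \<noteq> j \<and> x i = x j}"

definition offdiag_space :: "'a measure \<Rightarrow> nat \<Rightarrow> (nat \<Rightarrow> 'a) set" where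
  "offdiag_space mu k = space (prod_measure mu k) - diagonal mu k"

definition offdiag_sets :: "'a measure \<Rightarrow> nat \<Rightarrow> (nat \<Rightarrow> 'a) set set" where
  "offdiag_sets mu k = {A \<inter> offdiag_space mu k | A. A \<in> sets (prod_measure mu k)}"

definition disjoint_sides :: "'a measure \<Rightarrow> nat \<Rightarrow> (nat \<Rightarrow> 'a set) \<Rightarrow> bool" where
  "disjoint_sides mu k A \<longleftrightarrow> (\<forall>i<k. A i \<in> sets mu) \<and> disjoint_family_on A {..<k}"

definition offdiag_rects :: "'a measure \<Rightarrow> nat \<Rightarrow> (nat \<Rightarrow> 'a) set set" where
  "offdiag_rects mu k = {Pi\<^sub>E {..<k} A | A. disjoint_sides mu k A}"

definition offdiag_unions :: "'a measure \<Rightarrow> nat \<Rightarrow> (nat \<Rightarrow> 'a) set set" where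
  "offdiag_unions mu k = {\<Union> \<B> | \<B>. finite \<B> \<and> \<B> \<subseteq> offdiag_rects mu k}"

text \<open>
  \<open>M\<^sub>\<alpha>\<^sup>(\<^sup>k\<^sup>)\<close> is determined only almost surely, since a set has several representations as
  a rectangle (when it is empty) or as a finite union of rectangles. Therefore its values are
  given by relations: \<open>rect_value mu M k B X\<close> and \<open>union_value mu M k U X\<close> say that \<open>X\<close> is the
  random variable obtained from some representation of \<open>B\<close>, respectively \<open>U\<close>.
\<close>

definition rect_value ::
    "'a measure \<Rightarrow> ('a set \<Rightarrow> 'w \<Rightarrow> ennreal) \<Rightarrow> nat \<Rightarrow> (nat \<Rightarrow> 'a) set \<Rightarrow> ('w \<Rightarrow> ennreal) \<Rightarrow> bool" where
  "rect_value mu M k B X \<longleftrightarrow>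
    (\<exists>A. disjoint_sides mu k A \<and> B = Pi\<^sub>E {..<k} A \<and> X = (\<lambda>\<omega>. \<Prod>i<k. M (A i) \<omega>))"

definition union_value ::
    "'a measure \<Rightarrow> ('a set \<Rightarrow> 'w \<Rightarrow> ennreal) \<Rightarrow> nat \<Rightarrow> (nat \<Rightarrow> 'a) set \<Rightarrow> ('w \<Rightarrow> ennreal) \<Rightarrow> bool" where
  "union_value mu M k U X \<longleftrightarrow>
    (\<exists>(n::nat) B Y. U = (\<Union>i<n. B i) \<and> (\<forall>i<n. rect_value mu M k (B i) (Y i)) \<and>
       X = (\<lambda>\<omega>. SUP i\<in>{..<n}. Y i \<omega>))"

definition approx_seq ::
    "'a measure \<Rightarrow> nat \<Rightarrow> (nat \<Rightarrow> (nat \<Rightarrow> 'a) set) \<Rightarrow> (nat \<Rightarrow> 'a) set \<Rightarrow> bool" where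
  "approx_seq mu k An A \<longleftrightarrow>
    (\<forall>n. An n \<in> offdiag_unions mu k) \<and>
    (\<lambda>n. emeasure (prod_measure mu k) (sym_diff (An n) A)) \<longlonglongrightarrow> 0"

text \<open>Powers with exponent \<open>p > 0\<close> on \<open>[0, \<infinity>]\<close>.\<close>

definition epowr :: "ennreal \<Rightarrow> real \<Rightarrow> ennreal" where
  "epowr x p = (if x = \<infinity> then \<infinity> else ennreal (enn2real x powr p))"

definition Lnorm :: "'w measure \<Rightarrow> real \<Rightarrow> ('w \<Rightarrow> ennreal) \<Rightarrow> ennreal" where
  "Lnorm P \<gamma> X = epowr (\<integral>\<^sup>+ \<omega>. epowr (X \<omega>) \<gamma> \<partial>P) (1 / \<gamma>)"

text \<open>Subtraction on \<open>ennreal\<close> is truncated at 0, so the sum of the two differences is \<open>\<bar>x - y\<bar>\<close>.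
  Since \<open>\<infinity> - \<infinity> = \<infinity>\<close> there, \<open>edist_abs \<infinity> \<infinity> = \<infinity>\<close>; this is immaterial for elements of
  \<open>L\<^sup>\<gamma>\<close>, which are finite almost surely.\<close>

definition edist_abs :: "ennreal \<Rightarrow> ennreal \<Rightarrow> ennreal" where
  "edist_abs x y = (x - y) + (y - x)"

definition in_L :: "'w measure \<Rightarrow> real \<Rightarrow> ('w \<Rightarrow> ennreal) \<Rightarrow> bool" where
  "in_L P \<gamma> X \<longleftrightarrow> X \<in> borel_measurable P \<and> Lnorm P \<gamma> X < \<infinity>"

definition L_limit ::
    "'w measure \<Rightarrow> real \<Rightarrow> (nat \<Rightarrow> 'w \<Rightarrow> ennreal) \<Rightarrow> ('w \<Rightarrow> ennreal) \<Rightarrow> bool" where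
  "L_limit P \<gamma> Xn X \<longleftrightarrow>
    (\<forall>n. in_L P \<gamma> (Xn n)) \<and> in_L P \<gamma> X \<and>
    (\<lambda>n. Lnorm P \<gamma> (\<lambda>\<omega>. edist_abs (Xn n \<omega>) (X \<omega>))) \<longlonglongrightarrow> 0"

text \<open>\<open>X\<close> is a version of \<open>M\<^sub>\<alpha>\<^sup>(\<^sup>k\<^sup>)(A)\<close>: an \<open>L\<^sup>\<gamma>\<close> limit, for some \<open>\<gamma> \<in> (0, \<alpha>)\<close>, along some
  approximating sequence.\<close>

definition offdiag_version ::
    "'w measure \<Rightarrow> 'a measure \<Rightarrow> real \<Rightarrow> ('a set \<Rightarrow> 'w \<Rightarrow> ennreal) \<Rightarrow> nat \<Rightarrow>
     (nat \<Rightarrow> 'a) set \<Rightarrow> ('w \<Rightarrow> ennreal) \<Rightarrow> bool" where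
  "offdiag_version P mu \<alpha> M k A X \<longleftrightarrow>
    (\<exists>\<gamma> An Xn. 0 < \<gamma> \<and> \<gamma> < \<alpha> \<and> approx_seq mu k An A \<and>
       (\<forall>n. union_value mu M k (An n) (Xn n)) \<and> L_limit P \<gamma> Xn X)"

definition offdiag_family ::
    "'w measure \<Rightarrow> 'a measure \<Rightarrow> real \<Rightarrow> ('a set \<Rightarrow> 'w \<Rightarrow> ennreal) \<Rightarrow>
     (nat \<Rightarrow> (nat \<Rightarrow> 'a) set \<Rightarrow> 'w \<Rightarrow> ennreal) \<Rightarrow> bool" where
  "offdiag_family P mu \<alpha> M Mk \<longleftrightarrow>
    (\<forall>k\<ge>1. \<forall>A \<in> offdiag_sets mu k. offdiag_version P mu \<alpha> M k A (Mk k A))"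

text \<open>Arrival times of a unit rate Poisson process: the inter-arrival times are i.i.d. standard
  exponential.\<close>

definition poisson_arrivals :: "'v measure \<Rightarrow> (nat \<Rightarrow> 'v \<Rightarrow> real) \<Rightarrow> bool" where
  "poisson_arrivals Q \<Gamma> \<longleftrightarrow>
    (\<exists>\<tau>. prob_space.indep_vars Q (\<lambda>_. borel) \<tau> (UNIV :: nat set) \<and>
       (\<forall>i. distributed Q lborel (\<tau> i) (exponential_density 1)) \<and>
       (\<forall>i. \<forall>\<omega>\<in>space Q. \<Gamma> i \<omega> = (\<Sum>l\<le>i. \<tau> l \<omega>)))"

text \<open>The independence of \<open>(\<Gamma>\<^sub>i)\<close> and \<open>(T\<^sub>i)\<close> is that of the \<open>\<sigma>\<close>-algebras they generate;
  \<open>prob_space.indep_var\<close> would need both sequences to have the same type.\<close>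

definition series_setup ::
    "'a measure \<Rightarrow> 'a measure \<Rightarrow> ('a \<Rightarrow> ennreal) \<Rightarrow> 'v measure \<Rightarrow>
     (nat \<Rightarrow> 'v \<Rightarrow> real) \<Rightarrow> (nat \<Rightarrow> 'v \<Rightarrow> 'a) \<Rightarrow> bool" where
  "series_setup mu m \<psi> Q \<Gamma> T \<longleftrightarrow>
    prob_space m \<and> sets m = sets mu \<and>
    absolutely_continuous m mu \<and> absolutely_continuous mu m \<and>
    \<psi> \<in> borel_measurable m \<and> mu = density m \<psi> \<and> (AE x in m. 0 < \<psi> x \<and> \<psi> x < \<infinity>) \<and>
    prob_space Q \<and> poisson_arrivals Q \<Gamma> \<and>
    prob_space.indep_vars Q (\<lambda>_. m) T (UNIV :: nat set) \<and> (\<forall>i. distr Q m (T i) = m) \<and>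
    prob_space.indep_set Q
      (sets (vimage_algebra (space Q) (\<lambda>\<omega> i. \<Gamma> i \<omega>) (PiM UNIV (\<lambda>_. borel))))
      (sets (vimage_algebra (space Q) (\<lambda>\<omega> i. T i \<omega>) (PiM UNIV (\<lambda>_. m))))"

definition distinct_indices :: "nat \<Rightarrow> (nat \<Rightarrow> nat) set" where
  "distinct_indices k = {j \<in> {..<k} \<rightarrow>\<^sub>E UNIV. inj_on j {..<k}}"

definition series_rep ::
    "real \<Rightarrow> ('a \<Rightarrow> ennreal) \<Rightarrow> (nat \<Rightarrow> 'v \<Rightarrow> real) \<Rightarrow> (nat \<Rightarrow> 'v \<Rightarrow> 'a) \<Rightarrow>
     nat \<Rightarrow> (nat \<Rightarrow> 'a) set \<Rightarrow> 'v \<Rightarrow> ennreal" where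
  "series_rep \<alpha> \<psi> \<Gamma> T k A \<omega> =
    (SUP j \<in> distinct_indices k.
       (\<Prod>r<k. ennreal (\<Gamma> (j r) \<omega> powr (- 1 / \<alpha>)) * epowr (\<psi> (T (j r) \<omega>)) (1 / \<alpha>)) *
       indicator A (\<lambda>r\<in>{..<k}. T (j r) \<omega>))"

text \<open>Equality of the finite-dimensional distributions of two processes with index set \<open>I\<close>.\<close>

definition fdd_equal ::
    "'i set \<Rightarrow> 'w measure \<Rightarrow> ('i \<Rightarrow> 'w \<Rightarrow> ennreal) \<Rightarrow> 'v measure \<Rightarrow> ('i \<Rightarrow> 'v \<Rightarrow> ennreal) \<Rightarrow> bool" where
  "fdd_equal I P X Q Y \<longleftrightarrow>
    (\<forall>i\<in>I. X i \<in> borel_measurable P \<and> Y i \<in> borel_measurable Q) \<and>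
    (\<forall>J. finite J \<and> J \<subseteq> I \<longrightarrow>
       distr P (PiM J (\<lambda>_. borel)) (\<lambda>\<omega>. \<lambda>i\<in>J. X i \<omega>) =
       distr Q (PiM J (\<lambda>_. borel)) (\<lambda>\<omega>. \<lambda>i\<in>J. Y i \<omega>))"

end

theory Submission
  imports Defs
begin

text \<open>
  The idea is to realise the sup measure on a space on which its extension to \<open>E\<^sup>(\<^sup>k\<^sup>)\<close> is given
  by a formula, and to carry the extension back by equality of laws.

  The formula is the series. For a marked Poisson process \<open>(\<Gamma>\<^sub>i, T\<^sub>i)\<close> put
  \<open>N(A) = sup\<^sub>i \<Gamma>\<^sub>i\<^sup>-\<^sup>1\<^sup>/\<^sup>\<alpha> \<psi>(T\<^sub>i)\<^sup>1\<^sup>/\<^sup>\<alpha> 1\<^sub>A(T\<^sub>i)\<close>. For disjoint \<open>A\<^sub>1, \<dots>, A\<^sub>n\<close> the event that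
  \<open>N(A\<^sub>i) \<le> x\<^sub>i\<close> for all \<open>i\<close> says that no point \<open>(\<Gamma>\<^sub>j, T\<^sub>j)\<close> lies below the graph of a function
  \<open>g\<close> with \<open>\<integral>g dm = \<Sum>\<^sub>i \<mu>(A\<^sub>i) x\<^sub>i\<^sup>-\<^sup>\<alpha>\<close>, and this has probability \<open>exp (- \<integral>g dm)\<close>
  (\<open>void_probability\<close>). Hence \<open>N\<close> is a Frechet sup measure (\<open>frechet_series_measure\<close>). On a
  rectangle with disjoint sides a product of suprema over points is a supremum over tuples of points,
  and these points are automatically distinct (\<open>series_rep_rect\<close>). So the series over distinct
  tuples extends the products of values of \<open>N\<close> to all measurable sets, and it is \<open>\<sigma>\<close>-maxitive in
  every sample point.

  The joint law of \<open>(M(A))\<^sub>A\<close> is the same for all Frechet sup measures \<open>M\<close> with given \<open>\<mu>\<close> and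
  \<open>\<alpha>\<close>: finitely many sets are unions of disjoint atoms, on which the values are independent with
  known laws (\<open>frechet_law\<close>). Therefore every property of countably many values may be checked on
  the series. To bring the extension into this form, cover \<open>A\<close> by countable unions
  \<open>G\<^sub>1, G\<^sub>2, \<dots>\<close> of off-diagonal rectangles with \<open>\<mu>\<^sup>k(G\<^sub>n - A) \<rightarrow> 0\<close>
  (\<open>offdiag_outer_approx\<close>). The series \<open>S\<close> satisfies \<open>S(A) = inf\<^sub>n S(G\<^sub>n)\<close> almost surely, because
  \<open>S(G\<^sub>n) = max (S(A)) (S(G\<^sub>n - A))\<close> and the last term is small in \<open>L\<^sup>\<gamma>\<close>. The right-hand side is
  a functional of countably many values on \<open>\<E>\<close> (\<open>offdiag_rep_outer_value\<close>), and the same functional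
  evaluated at \<open>M\<close> is the extension of \<open>M\<close>. Existence and uniqueness of the \<open>L\<^sup>\<gamma>\<close> limits follow
  from \<open>|S(A\<^sub>n) - S(A)| \<le> S(A\<^sub>n \<Delta> A)\<close> and the moment bound; the equality of finite-dimensional
  distributions, the moment bound and \<open>\<sigma>\<close>-maxitivity are read off from the series.

  What remains is the moment bound for one series, the one with constant \<open>\<psi>\<close>
  (\<open>canonical_series_moment\<close>). Let \<open>p = \<gamma>/\<alpha> < 1 < q = r/\<alpha>\<close>, \<open>s = p/q\<close> and
  \<open>f(u) = min (u\<^sup>-\<^sup>p) (u\<^sup>-\<^sup>q)\<close>, which is integrable on \<open>(0, \<infinity>)\<close>. Splitting a product
  \<open>\<Prod>\<^sub>r \<Gamma>\<^sub>j\<^sub>r\<^sup>-\<^sup>p\<close> according to \<open>\<Gamma>\<^sub>j\<^sub>r \<le> 1\<close> or not, and using \<open>y\<^sup>s \<le> t\<^sup>s + t\<^sup>s\<^sup>-\<^sup>1 y\<close> for the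
  large arrival times, bounds the supremum of \<open>\<Prod>\<^sub>r \<Gamma>\<^sub>j\<^sub>r\<^sup>-\<^sup>p\<close> over all tuples with
  \<open>(T\<^sub>j\<^sub>1, \<dots>, T\<^sub>j\<^sub>k) \<in> A\<close> by
  \<open>t\<^sup>s Z + t\<^sup>s\<^sup>-\<^sup>1 \<Sum>\<^sub>j \<Prod>\<^sub>r f(\<Gamma>\<^sub>j\<^sub>r) 1\<^sub>A(T\<^sub>j\<^sub>1, \<dots>, T\<^sub>j\<^sub>k)\<close> with \<open>Z = \<Prod>\<^sub>i (1 + f(\<Gamma>\<^sub>i))\<close>. Here
  \<open>E Z \<le> exp (\<integral>f)\<close>, the sum over distinct tuples of \<open>\<Prod>\<^sub>r f(\<Gamma>\<^sub>j\<^sub>r)\<close> is at most \<open>k\<^sup>k Z\<close>, and the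
  indicator contributes an independent factor \<open>m\<^sup>k(A)\<close>. The choice \<open>t = m\<^sup>k(A)\<close> gives a
  multiple of \<open>m\<^sup>k(A)\<^sup>s\<close>.
\<close>

section \<open>Powers, norms and distances in the extended half-line\<close>

lemma epowr_ennreal: "0 \<le> a \<Longrightarrow> epowr (ennreal a) p = ennreal (a powr p)"
  by (simp add: epowr_def)

lemma epowr_0[simp]: "epowr 0 p = 0"
  by (simp add: epowr_def)

lemma epowr_mono: "0 \<le> p \<Longrightarrow> x \<le> y \<Longrightarrow> epowr x p \<le> epowr y p"
  by (auto simp: epowr_def less_top intro!: ennreal_leI powr_mono2 enn2real_mono)

lemma epowr_inverse: "0 < p \<Longrightarrow> epowr (epowr x p) (1 / p) = x"
  by (cases x) (auto simp: epowr_def powr_powr)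

lemma epowr_inverse': "0 < p \<Longrightarrow> epowr (epowr x (1 / p)) p = x"
  using epowr_inverse[of "1 / p" x] by simp

lemma epowr_eq_0_iff[simp]: "epowr x p = 0 \<longleftrightarrow> x = 0"
  by (cases x) (auto simp: epowr_def)

lemma epowr_less_top_iff: "epowr x p < \<infinity> \<longleftrightarrow> x < \<infinity>"
  by (simp add: epowr_def less_top)

lemma measurable_epowr[measurable]: "(\<lambda>x. epowr x p) \<in> borel_measurable borel"
  unfolding epowr_def by measurable

text \<open>
  This replaces the triangle inequality, which fails for exponents below 1; the constant comes from
  \<open>x + y \<le> 2 max x y\<close>.
\<close>

lemma epowr_add_le:
  assumes "0 < p" shows "epowr (x + y) p \<le> ennreal (2 powr p) * (epowr x p + epowr y p)"
proof -
  have *: "epowr (2 * z) p = ennreal (2 powr p) * epowr z p" for z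
  proof (cases z)
    case (real r)
    then have "2 * z = ennreal (2 * r)" by (simp add: ennreal_mult)
    then have "epowr (2 * z) p = ennreal ((2 * r) powr p)"
      using real by (metis epowr_ennreal mult_nonneg_nonneg zero_le_numeral)
    also have "\<dots> = ennreal (2 powr p) * epowr z p"
      using real by (simp add: epowr_ennreal powr_mult ennreal_mult)
    finally show ?thesis .
  qed (simp add: epowr_def ennreal_mult_top)
  have "epowr (x + y) p \<le> epowr (2 * max x y) p"
    using assms by (intro epowr_mono) (auto simp: mult_2 intro!: add_mono)
  also have "\<dots> \<le> ennreal (2 powr p) * (epowr x p + epowr y p)"
    unfolding * by (intro mult_left_mono) (auto simp: max_def)
  finally show ?thesis .
qed

lemma tendsto_epowr_0:
  assumes p: "0 < p" and X: "(X \<longlongrightarrow> 0) F"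
  shows "((\<lambda>n. epowr (X n) p) \<longlongrightarrow> 0) F"
proof (rule order_tendstoI)
  fix a :: ennreal assume "0 < a"
  then have "0 < epowr a (1 / p)" by (simp add: zero_less_iff_neq_zero)
  then have "\<forall>\<^sub>F n in F. X n < epowr a (1 / p)" using order_tendstoD(2)[OF X] by simp
  then show "\<forall>\<^sub>F n in F. epowr (X n) p < a"
  proof eventually_elim
    case (elim n)
    show ?case
    proof (rule ccontr)
      assume "\<not> epowr (X n) p < a"
      then have "epowr a (1 / p) \<le> epowr (epowr (X n) p) (1 / p)"
        using p by (intro epowr_mono) auto
      then show False using elim epowr_inverse[OF p, of "X n"] by auto
    qed
  qed
qed simp

lemma Lnorm_tendsto_0_iff:
  assumes "0 < \<gamma>"
  shows "(\<lambda>n. Lnorm P \<gamma> (X n)) \<longlonglongrightarrow> 0 \<longleftrightarrow> (\<lambda>n. \<integral>\<^sup>+\<omega>. epowr (X n \<omega>) \<gamma> \<partial>P) \<longlonglongrightarrow> 0"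
proof
  assume "(\<lambda>n. Lnorm P \<gamma> (X n)) \<longlonglongrightarrow> 0"
  from tendsto_epowr_0[OF assms this] show "(\<lambda>n. \<integral>\<^sup>+\<omega>. epowr (X n \<omega>) \<gamma> \<partial>P) \<longlonglongrightarrow> 0"
    by (simp add: Lnorm_def epowr_inverse' assms)
next
  assume "(\<lambda>n. \<integral>\<^sup>+\<omega>. epowr (X n \<omega>) \<gamma> \<partial>P) \<longlonglongrightarrow> 0"
  from tendsto_epowr_0[OF _ this, of "1 / \<gamma>"] assms show "(\<lambda>n. Lnorm P \<gamma> (X n)) \<longlonglongrightarrow> 0"
    by (simp add: Lnorm_def)
qed

lemma Lnorm_mono_AE:
  assumes "0 < \<gamma>" "AE \<omega> in P. X \<omega> \<le> Y \<omega>"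
  shows "Lnorm P \<gamma> X \<le> Lnorm P \<gamma> Y"
  unfolding Lnorm_def using assms
  by (intro epowr_mono nn_integral_mono_AE) (auto elim!: eventually_mono intro: epowr_mono)

lemma Lnorm_cong_AE:
  assumes "AE \<omega> in P. X \<omega> = Y \<omega>"
  shows "Lnorm P \<gamma> X = Lnorm P \<gamma> Y"
  unfolding Lnorm_def using assms
  by (intro arg_cong2[where f=epowr] nn_integral_cong_AE) (auto elim!: eventually_mono)

text \<open>
  Infinite values cause no exception, since \<open>\<infinity> - \<infinity> = \<infinity>\<close> makes the right-hand side infinite
  when it has to be.
\<close>

lemma edist_abs_triangle: "edist_abs x y \<le> edist_abs z x + edist_abs z y"
proof -
  have *: "x - y \<le> (x - z) + (z - y)" for x y z :: ennreal
    by (cases x; cases y; cases z)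
       (auto simp: ennreal_minus ennreal_leI max_def ennreal_neg ennreal_plus_if not_le)
  show ?thesis
    using add_mono[OF *[of x y z] *[of y x z]] by (simp add: edist_abs_def ac_simps)
qed

lemma edist_abs_eq_0: "edist_abs x y = 0 \<Longrightarrow> x = y"
  by (cases x; cases y) (auto simp: edist_abs_def ennreal_minus ennreal_eq_0_iff)

lemma measurable_edist_abs[measurable]:
  "f \<in> borel_measurable N \<Longrightarrow> g \<in> borel_measurable N \<Longrightarrow> (\<lambda>x. edist_abs (f x) (g x)) \<in> borel_measurable N"
  unfolding edist_abs_def by (intro borel_measurable_add borel_measurable_minus_ennreal)

text \<open>
  The hypotheses are what maxitivity yields when two sets differ by a set of value \<open>z\<close>.
\<close>

lemma edist_abs_le:
  assumes "x \<le> max y z" "y \<le> max x z" "x \<noteq> \<infinity>" "y \<noteq> \<infinity>"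
  shows "edist_abs x y \<le> z"
proof (cases "x \<le> y")
  case True
  then have "x - y = 0" using assms by (simp add: diff_eq_0_iff_ennreal top.not_eq_extremum)
  moreover have "y - x \<le> z"
    using assms True by (cases "y = x") (auto simp: max_def split: if_splits intro: order_trans[OF diff_le_self_ennreal])
  ultimately show ?thesis by (simp add: edist_abs_def)
next
  case False
  then have "y - x = 0" using assms by (simp add: diff_eq_0_iff_ennreal top.not_eq_extremum)
  moreover have "x - y \<le> z"
    using assms False by (auto simp: max_def split: if_splits intro: order_trans[OF diff_le_self_ennreal])
  ultimately show ?thesis by (simp add: edist_abs_def)
qed

lemma L_limit_unique:
  assumes \<gamma>: "0 < \<gamma>" and X: "L_limit P \<gamma> Xn X" and Y: "L_limit P \<gamma> Xn Y"
  shows "AE \<omega> in P. Y \<omega> = X \<omega>"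
proof -
  have [measurable]: "X \<in> borel_measurable P" "Y \<in> borel_measurable P" "Xn n \<in> borel_measurable P" for n
    using X Y by (auto simp: L_limit_def in_L_def)
  define I where "I Z n = (\<integral>\<^sup>+\<omega>. epowr (edist_abs (Xn n \<omega>) (Z \<omega>)) \<gamma> \<partial>P)" for Z n
  have I: "I X \<longlonglongrightarrow> 0" "I Y \<longlonglongrightarrow> 0"
    using X Y by (auto simp: L_limit_def Lnorm_tendsto_0_iff[OF \<gamma>] I_def[abs_def])
  have "(\<integral>\<^sup>+\<omega>. epowr (edist_abs (Y \<omega>) (X \<omega>)) \<gamma> \<partial>P) \<le> ennreal (2 powr \<gamma>) * (I Y n + I X n)" for n
  proof -
    have "(\<integral>\<^sup>+\<omega>. epowr (edist_abs (Y \<omega>) (X \<omega>)) \<gamma> \<partial>P)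
      \<le> (\<integral>\<^sup>+\<omega>. ennreal (2 powr \<gamma>) * (epowr (edist_abs (Xn n \<omega>) (Y \<omega>)) \<gamma> + epowr (edist_abs (Xn n \<omega>) (X \<omega>)) \<gamma>) \<partial>P)"
      using \<gamma> by (intro nn_integral_mono order_trans[OF epowr_mono[OF _ edist_abs_triangle] epowr_add_le]) auto
    also have "\<dots> = ennreal (2 powr \<gamma>) * (I Y n + I X n)"
      unfolding I_def by (subst nn_integral_cmult) (auto simp: nn_integral_add)
    finally show ?thesis .
  qed
  moreover have "(\<lambda>n. ennreal (2 powr \<gamma>) * (I Y n + I X n)) \<longlonglongrightarrow> ennreal (2 powr \<gamma>) * (0 + 0)"
    by (intro ennreal_tendsto_cmult tendsto_add I) auto
  ultimately have "(\<integral>\<^sup>+\<omega>. epowr (edist_abs (Y \<omega>) (X \<omega>)) \<gamma> \<partial>P) \<le> ennreal (2 powr \<gamma>) * (0 + 0)"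
    by (intro LIMSEQ_le_const) auto
  then have "(\<integral>\<^sup>+\<omega>. epowr (edist_abs (Y \<omega>) (X \<omega>)) \<gamma> \<partial>P) = 0" by simp
  then have "AE \<omega> in P. epowr (edist_abs (Y \<omega>) (X \<omega>)) \<gamma> = 0"
    by (subst (asm) nn_integral_0_iff_AE) auto
  then show ?thesis
    by eventually_elim (simp add: edist_abs_eq_0)
qed

section \<open>Outer approximation by off-diagonal rectangles\<close>

text \<open>
  The sets that can be approximated from outside together with their complements form a
  \<open>\<sigma>\<close>-algebra. For a countable union the errors are made summable. For the complement of a
  countable union one first passes to a finite intersection, which costs little by continuity from
  above, and finite intersections of countable unions from \<open>\<B>\<close> are again of this kind.
\<close>

lemma outer_approx_countable_union:
  assumes N: "finite_measure N" and gen: "sets N = sigma_sets (space N) \<B>"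
    and Int: "\<And>A B. A \<in> \<B> \<Longrightarrow> B \<in> \<B> \<Longrightarrow> A \<inter> B \<in> \<B>" and top: "space N \<in> \<B>"
    and compl: "\<And>B. B \<in> \<B> \<Longrightarrow> \<exists>\<G>. countable \<G> \<and> \<G> \<subseteq> \<B> \<and> space N - B = \<Union>\<G>"
    and A: "A \<in> sets N" and e: "0 < e"
  shows "\<exists>\<G>. countable \<G> \<and> \<G> \<subseteq> \<B> \<and> A \<subseteq> \<Union>\<G> \<and> measure N (\<Union>\<G> - A) < e"
proof -
  interpret finite_measure N by fact
  define cu where "cu G \<longleftrightarrow> (\<exists>\<G>. countable \<G> \<and> \<G> \<subseteq> \<B> \<and> G = \<Union>\<G>)" for G
  define outer where "outer A \<longleftrightarrow> (\<forall>e>0. \<exists>G. cu G \<and> A \<subseteq> G \<and> measure N (G - A) < e)" for A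
  have cuI: "cu B" if "B \<in> \<B>" for B
    unfolding cu_def by (intro exI[of _ "{B}"]) (use that in auto)
  have sets_cu: "G \<in> sets N" if G: "cu G" for G
  proof -
    from G obtain \<G> where \<G>: "countable \<G>" "\<G> \<subseteq> \<B>" "G = \<Union>\<G>" unfolding cu_def by blast
    have "\<B> \<subseteq> sets N" unfolding gen by (auto intro: sigma_sets.Basic)
    then show ?thesis unfolding \<G>(3) using \<G>(1,2) by (intro sets.countable_Union) auto
  qed
  have cu_UN: "cu (\<Union>i::nat. G i)" if G: "\<And>i. cu (G i)" for G
  proof -
    have "\<forall>i. \<exists>\<G>. countable \<G> \<and> \<G> \<subseteq> \<B> \<and> G i = \<Union>\<G>" using G unfolding cu_def by blast
    then obtain \<G> where "\<And>i. countable (\<G> i) \<and> \<G> i \<subseteq> \<B> \<and> G i = \<Union>(\<G> i)" by metis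
    then show ?thesis unfolding cu_def by (intro exI[of _ "\<Union>i. \<G> i"]) auto
  qed
  have cu_Int: "cu (G \<inter> H)" if G: "cu G" and H: "cu H" for G H
  proof -
    from G obtain \<G> where \<G>: "countable \<G>" "\<G> \<subseteq> \<B>" "G = \<Union>\<G>" unfolding cu_def by blast
    from H obtain \<H> where \<H>: "countable \<H>" "\<H> \<subseteq> \<B>" "H = \<Union>\<H>" unfolding cu_def by blast
    show ?thesis unfolding cu_def
    proof (intro exI conjI)
      show "countable ((\<lambda>(A, B). A \<inter> B) ` (\<G> \<times> \<H>))" using \<G> \<H> by auto
      show "(\<lambda>(A, B). A \<inter> B) ` (\<G> \<times> \<H>) \<subseteq> \<B>" using \<G> \<H> Int by auto
      show "G \<inter> H = \<Union>((\<lambda>(A, B). A \<inter> B) ` (\<G> \<times> \<H>))" unfolding \<G>(3) \<H>(3) by auto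
    qed
  qed
  have cu_INT: "cu (\<Inter>i\<le>n. G i)" if G: "\<And>i. cu (G i)" for G and n :: nat
  proof (induction n)
    case (Suc n)
    have "(\<Inter>i\<le>Suc n. G i) = (\<Inter>i\<le>n. G i) \<inter> G (Suc n)" by (auto simp: atMost_Suc)
    then show ?case using cu_Int[OF Suc G] by simp
  qed (simp add: G)
  have exact: "outer G" if G: "cu G" for G
    unfolding outer_def using G by (intro allI impI exI[of _ G]) auto
  have "outer A \<and> outer (space N - A)"
    using A unfolding gen
  proof (induction rule: sigma_sets.induct)
    case (Basic B)
    then have "cu (space N - B)" using compl unfolding cu_def by blast
    then show ?case using Basic exact cuI by blast
  next
    case Empty
    have "cu {}" unfolding cu_def by (intro exI[of _ "{}"]) auto
    then show ?case using cuI[OF top] by (simp add: exact)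
  next
    case (Compl A)
    then have "A \<subseteq> space N" unfolding gen[symmetric] by (intro sets.sets_into_space)
    then have "space N - (space N - A) = A" by auto
    then show ?case using Compl by simp
  next
    case (Union A)
    have A[measurable]: "A i \<in> sets N" for i using Union(1) unfolding gen by simp
    show ?case
    proof
      show "outer (\<Union>i. A i)" unfolding outer_def
      proof (intro allI impI)
        fix e :: real assume e: "0 < e"
        have "\<exists>G. cu G \<and> A i \<subseteq> G \<and> measure N (G - A i) < (e / 2) * (1 / 2) ^ Suc i" for i
        proof -
          have "0 < (e / 2) * (1 / 2) ^ Suc i" using e by simp
          then show ?thesis using Union(2)[of i] unfolding outer_def by blast
        qed
        then obtain G where G: "\<And>i. cu (G i)" "\<And>i. A i \<subseteq> G i" "\<And>i. measure N (G i - A i) < (e / 2) * (1 / 2) ^ Suc i"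
          by metis
        note [measurable] = sets_cu[OF G(1)]
        have sums: "(\<lambda>i. (e / 2) * (1 / 2) ^ Suc i) sums ((e / 2) * 1)"
          by (intro sums_mult power_half_series)
        have summ: "summable (\<lambda>i. measure N (G i - A i))"
          by (rule summable_comparison_test_ev[OF _ sums_summable[OF sums]])
             (use G(3) in \<open>auto intro!: always_eventually less_imp_le\<close>)
        have "measure N ((\<Union>i. G i) - (\<Union>i. A i)) \<le> measure N (\<Union>i. G i - A i)"
          by (intro finite_measure_mono) auto
        also have "\<dots> \<le> (\<Sum>i. measure N (G i - A i))"
          using summ by (intro finite_measure_subadditive_countably) auto
        also have "\<dots> \<le> (\<Sum>i. (e / 2) * (1 / 2) ^ Suc i)"
          by (intro suminf_le summ sums_summable[OF sums] less_imp_le G)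
        also have "\<dots> < e" using sums e by (simp add: sums_unique[symmetric])
        finally show "\<exists>G. cu G \<and> (\<Union>i. A i) \<subseteq> G \<and> measure N (G - (\<Union>i. A i)) < e"
          using G(2) by (intro exI[of _ "\<Union>i. G i"] conjI cu_UN G(1)) auto
      qed
      show "outer (space N - (\<Union>i. A i))" unfolding outer_def
      proof (intro allI impI)
        fix e :: real assume e: "0 < e"
        define D where "D n = (\<Inter>i\<le>n. space N - A i) - (space N - (\<Union>i. A i))" for n
        have [measurable]: "D n \<in> sets N" for n unfolding D_def by measurable
        have "(\<lambda>n. measure N (D n)) \<longlonglongrightarrow> measure N (\<Inter>n. D n)"
          by (rule finite_Lim_measure_decseq) (auto simp: D_def decseq_def)
        moreover have "(\<Inter>n. D n) = {}" unfolding D_def by auto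
        ultimately have "(\<lambda>n. measure N (D n)) \<longlonglongrightarrow> 0" by simp
        then have "\<forall>\<^sub>F n in sequentially. measure N (D n) < e / 2"
          using e by (intro order_tendstoD) auto
        then obtain n where n: "measure N (D n) < e / 2" unfolding eventually_sequentially by auto
        have "\<exists>G. cu G \<and> space N - A i \<subseteq> G \<and> measure N (G - (space N - A i)) < e / (2 * real (Suc n))" for i
        proof -
          have "0 < e / (2 * real (Suc n))" using e by simp
          then show ?thesis using Union(2)[of i] unfolding outer_def by blast
        qed
        then obtain G where G: "\<And>i. cu (G i)" "\<And>i. space N - A i \<subseteq> G i"
            "\<And>i. measure N (G i - (space N - A i)) < e / (2 * real (Suc n))"
          by metis
        note [measurable] = sets_cu[OF G(1)]
        have "measure N ((\<Inter>i\<le>n. G i) - (space N - (\<Union>i. A i))) \<le> measure N (D n \<union> (\<Union>i\<le>n. G i - (space N - A i)))"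
          by (intro finite_measure_mono) (auto simp: D_def)
        also have "\<dots> \<le> measure N (D n) + measure N (\<Union>i\<le>n. G i - (space N - A i))"
          by (intro measure_Un_le) auto
        also have "measure N (\<Union>i\<le>n. G i - (space N - A i)) \<le> (\<Sum>i\<le>n. measure N (G i - (space N - A i)))"
          by (intro finite_measure_subadditive_finite) auto
        also have "\<dots> \<le> (\<Sum>i\<le>n. e / (2 * real (Suc n)))"
          by (intro sum_mono less_imp_le G)
        also have "\<dots> = e / 2" by (simp add: field_simps)
        finally have "measure N ((\<Inter>i\<le>n. G i) - (space N - (\<Union>i. A i))) < e" using n by simp
        then show "\<exists>G. cu G \<and> space N - (\<Union>i. A i) \<subseteq> G \<and> measure N (G - (space N - (\<Union>i. A i))) < e"
          using G(2) by (intro exI[of _ "\<Inter>i\<le>n. G i"] conjI cu_INT G(1)) auto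
      qed
    qed
  qed
  then show ?thesis using e unfolding outer_def cu_def by blast
qed

lemma finite_measure_prod_measure:
  assumes "finite_measure mu" shows "finite_measure (prod_measure mu k)"
proof -
  interpret finite_measure mu by fact
  interpret product_sigma_finite "\<lambda>_. mu" by unfold_locales
  show ?thesis
    by standard (simp add: space_PiM emeasure_PiM emeasure_eq_measure ennreal_power)
qed

text \<open>
  The complement of a box is the union of the boxes in which one side is replaced by its complement
  and the other sides are the whole space.
\<close>

lemma outer_box_approx:
  assumes mu: "finite_measure mu" and A: "A \<in> sets (prod_measure mu k)" and e: "0 < e"
  shows "\<exists>\<G>. countable \<G> \<and> \<G> \<subseteq> {Pi\<^sub>E {..<k} B | B. \<forall>r<k. B r \<in> sets mu} \<and> A \<subseteq> \<Union>\<G> \<and>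
    measure (prod_measure mu k) (\<Union>\<G> - A) < e"
proof (rule outer_approx_countable_union[OF _ _ _ _ _ A e])
  let ?B = "{Pi\<^sub>E {..<k} B | B. \<forall>r<k. B r \<in> sets mu}"
  show "finite_measure (prod_measure mu k)" by (rule finite_measure_prod_measure[OF mu])
  show "sets (prod_measure mu k) = sigma_sets (space (prod_measure mu k)) ?B"
    unfolding sets_PiM space_PiM by (subst prod_algebra_eq_finite) (auto intro!: arg_cong2[where f=sigma_sets])
  show "space (prod_measure mu k) \<in> ?B"
    by (auto simp: space_PiM intro!: exI[of _ "\<lambda>_. space mu"])
  show "X \<inter> Y \<in> ?B" if X: "X \<in> ?B" and Y: "Y \<in> ?B" for X Y
  proof -
    from X obtain B where B: "X = Pi\<^sub>E {..<k} B" "\<And>r. r < k \<Longrightarrow> B r \<in> sets mu" by auto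
    from Y obtain C where C: "Y = Pi\<^sub>E {..<k} C" "\<And>r. r < k \<Longrightarrow> C r \<in> sets mu" by auto
    show ?thesis using B C by (auto simp: PiE_Int intro!: exI[of _ "\<lambda>r. B r \<inter> C r"])
  qed
  fix X assume "X \<in> ?B"
  then obtain B where B: "X = Pi\<^sub>E {..<k} B" "\<And>r. r < k \<Longrightarrow> B r \<in> sets mu" by auto
  show "\<exists>\<G>. countable \<G> \<and> \<G> \<subseteq> ?B \<and> space (prod_measure mu k) - X = \<Union>\<G>"
  proof (intro exI conjI)
    let ?G = "(\<lambda>s. Pi\<^sub>E {..<k} (\<lambda>r. if r = s then space mu - B r else space mu)) ` {..<k}"
    show "countable ?G" by (simp add: countable_finite)
    show "?G \<subseteq> ?B"
    proof (rule image_subsetI)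
      fix s
      have "\<forall>r<k. (if r = s then space mu - B r else space mu) \<in> sets mu" using B(2) by auto
      then show "Pi\<^sub>E {..<k} (\<lambda>r. if r = s then space mu - B r else space mu) \<in> ?B" by blast
    qed
    show "space (prod_measure mu k) - X = \<Union>?G"
    proof (intro set_eqI iffI)
      fix x assume x: "x \<in> space (prod_measure mu k) - X"
      then have xs: "x \<in> extensional {..<k}" "\<And>r. r < k \<Longrightarrow> x r \<in> space mu" "\<not> (\<forall>r<k. x r \<in> B r)"
        by (auto simp add: B(1) space_PiM PiE_iff)
      then obtain s where s: "s < k" "x s \<notin> B s" by blast
      have "x \<in> Pi\<^sub>E {..<k} (\<lambda>r. if r = s then space mu - B r else space mu)"
        using xs(1,2) s by (intro PiE_I) (simp_all add: extensional_def)
      then show "x \<in> \<Union>?G" using s(1) by blast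
    next
      fix x assume "x \<in> \<Union>?G"
      then obtain s where s: "s < k" "x \<in> Pi\<^sub>E {..<k} (\<lambda>r. if r = s then space mu - B r else space mu)" by auto
      have "x r \<in> space mu" if "r < k" for r
        using PiE_mem[OF s(2), of r] that by (auto split: if_splits)
      moreover have "x s \<notin> B s" using PiE_mem[OF s(2), of s] s(1) by auto
      moreover have "x \<in> extensional {..<k}" using s(2) by (simp add: PiE_iff)
      ultimately show "x \<in> space (prod_measure mu k) - X"
        using s(1) by (auto simp: B(1) space_PiM PiE_iff)
    qed
  qed
qed

text \<open>
  Let \<open>f\<close> embed \<open>E\<close> into the unit interval. If the coordinates of \<open>x\<close> are distinct, the
  numbers \<open>f (x i)\<close> have a minimal gap, so for large \<open>n\<close> the integers \<open>\<lfloor>n f (x i)\<rfloor>\<close> are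
  distinct as well. Thus the cells on which \<open>\<lfloor>n f\<rfloor>\<close> is constant provide the sides.
\<close>

lemma offdiag_space_countable_union:
  assumes "borel_iso_space mu"
  shows "\<exists>\<R>. countable \<R> \<and> \<R> \<subseteq> offdiag_rects mu k \<and> offdiag_space mu k = \<Union>\<R>"
proof -
  from assms obtain B f where B: "B \<in> sets (borel :: real measure)" and bij: "bij_betw f (space mu) B"
    and f: "f \<in> measurable mu (restrict_space borel B)"
    unfolding borel_iso_space_def by blast
  have [measurable]: "f \<in> borel_measurable mu"
    using f by (simp add: measurable_restrict_space2_iff)
  have inj: "inj_on f (space mu)" using bij by (simp add: bij_betw_def)
  define cell where "cell n d = {x \<in> space mu. \<lfloor>real n * f x\<rfloor> = d}" for n :: nat and d :: int
  have [measurable]: "cell n d \<in> sets mu" for n d unfolding cell_def by measurable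
  define D where "D = {d \<in> {..<k} \<rightarrow>\<^sub>E (UNIV :: int set). inj_on d {..<k}}"
  define \<R> where "\<R> = (\<lambda>(n, d). Pi\<^sub>E {..<k} (\<lambda>r. cell n (d r))) ` (UNIV \<times> D)"
  show ?thesis
  proof (intro exI conjI)
    have "countable D" unfolding D_def
      by (rule countable_subset[OF _ countable_PiE[of "{..<k}" "\<lambda>_. UNIV"]]) auto
    then show "countable \<R>" unfolding \<R>_def by (intro countable_image countable_SIGMA) auto
    show "\<R> \<subseteq> offdiag_rects mu k"
    proof
      fix R assume "R \<in> \<R>"
      then obtain n d where d: "d \<in> D" "R = Pi\<^sub>E {..<k} (\<lambda>r. cell n (d r))" by (auto simp: \<R>_def)
      have "disjoint_sides mu k (\<lambda>r. cell n (d r))"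
        using d(1) by (auto simp: disjoint_sides_def disjoint_family_on_def D_def inj_on_def cell_def)
      then show "R \<in> offdiag_rects mu k" using d(2) unfolding offdiag_rects_def by blast
    qed
    show "offdiag_space mu k = \<Union>\<R>"
    proof (intro set_eqI iffI)
      fix x assume x: "x \<in> offdiag_space mu k"
      have xs: "x r \<in> space mu" if "r < k" for r
        using x that by (auto simp: offdiag_space_def space_PiM PiE_iff)
      define \<delta> where "\<delta> = Min (insert 1 ((\<lambda>(i, j). \<bar>f (x i) - f (x j)\<bar>) ` {(i, j). i < k \<and> j < k \<and> i \<noteq> j}))"
      have fin: "finite {(i, j). i < k \<and> j < k \<and> i \<noteq> j}"
        by (rule finite_subset[of _ "{..<k} \<times> {..<k}"]) auto
      have ne: "f (x i) \<noteq> f (x j)" if "i < k" "j < k" "i \<noteq> j" for i j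
      proof
        assume "f (x i) = f (x j)"
        then have "x i = x j" using inj xs that by (simp add: inj_on_eq_iff)
        then show False using x that by (auto simp: offdiag_space_def diagonal_def)
      qed
      have "0 < \<delta>" unfolding \<delta>_def using fin ne by (subst Min_gr_iff) auto
      obtain n :: nat where n: "1 / \<delta> \<le> real n" using real_arch_simple by blast
      define d where "d = (\<lambda>r\<in>{..<k}. \<lfloor>real n * f (x r)\<rfloor>)"
      have "inj_on d {..<k}"
      proof (rule inj_onI, rule ccontr)
        fix i j assume ij: "i \<in> {..<k}" "j \<in> {..<k}" "d i = d j" "i \<noteq> j"
        then have "\<delta> \<le> \<bar>f (x i) - f (x j)\<bar>"
          unfolding \<delta>_def using fin by (intro Min_le) auto
        then have "1 \<le> real n * \<bar>f (x i) - f (x j)\<bar>"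
          using n \<open>0 < \<delta>\<close> mult_mono[of "1 / \<delta>" "real n" \<delta> "\<bar>f (x i) - f (x j)\<bar>"] by simp
        also have "\<dots> = \<bar>real n * f (x i) - real n * f (x j)\<bar>"
          by (simp add: abs_mult right_diff_distrib[symmetric])
        finally have "1 \<le> \<bar>real n * f (x i) - real n * f (x j)\<bar>" .
        moreover have "\<lfloor>real n * f (x i)\<rfloor> = \<lfloor>real n * f (x j)\<rfloor>" using ij by (simp add: d_def)
        ultimately show False by linarith
      qed
      then have "d \<in> D" by (auto simp: D_def d_def)
      moreover have "x \<in> Pi\<^sub>E {..<k} (\<lambda>r. cell n (d r))"
        using x xs by (auto simp: cell_def d_def offdiag_space_def space_PiM PiE_iff)
      ultimately show "x \<in> \<Union>\<R>" unfolding \<R>_def by (intro UnionI[OF image_eqI[of _ _ "(n, d)"]]) simp_all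
    next
      fix x assume "x \<in> \<Union>\<R>"
      then obtain n d where d: "d \<in> D" "x \<in> Pi\<^sub>E {..<k} (\<lambda>r. cell n (d r))"
        unfolding \<R>_def by auto
      have c: "x r \<in> cell n (d r)" if "r < k" for r using PiE_mem[OF d(2)] that by simp
      have "x i \<noteq> x j" if "i < k" "j < k" "i \<noteq> j" for i j
        using c[OF that(1)] c[OF that(2)] that d(1) by (auto simp: cell_def D_def inj_on_def)
      moreover have "x \<in> space (prod_measure mu k)"
        using d(2) c by (auto simp: space_PiM PiE_iff cell_def)
      ultimately show "x \<in> offdiag_space mu k"
        unfolding offdiag_space_def diagonal_def by blast
    qed
  qed
qed

lemma offdiag_rects_sets: "R \<in> offdiag_rects mu k \<Longrightarrow> R \<in> sets (prod_measure mu k)"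
  by (auto simp: offdiag_rects_def disjoint_sides_def intro!: sets_PiM_I_finite)

lemma offdiag_space_sets:
  assumes "borel_iso_space mu" shows "offdiag_space mu k \<in> sets (prod_measure mu k)"
proof -
  from offdiag_space_countable_union[OF assms, of k] obtain \<R> where
    "countable \<R>" "\<R> \<subseteq> offdiag_rects mu k" "offdiag_space mu k = \<Union>\<R>" by blast
  moreover have "offdiag_rects mu k \<subseteq> sets (prod_measure mu k)"
    by (intro subsetI offdiag_rects_sets)
  ultimately show ?thesis using sets.countable_Union[of \<R> "prod_measure mu k"] by auto
qed

lemma offdiag_sets_iff:
  assumes "borel_iso_space mu"
  shows "A \<in> offdiag_sets mu k \<longleftrightarrow> A \<in> sets (prod_measure mu k) \<and> A \<subseteq> offdiag_space mu k"
proof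
  assume "A \<in> offdiag_sets mu k"
  then show "A \<in> sets (prod_measure mu k) \<and> A \<subseteq> offdiag_space mu k"
    using offdiag_space_sets[OF assms, of k] by (auto simp: offdiag_sets_def)
next
  assume "A \<in> sets (prod_measure mu k) \<and> A \<subseteq> offdiag_space mu k"
  then have "A = A \<inter> offdiag_space mu k" "A \<in> sets (prod_measure mu k)" by auto
  then show "A \<in> offdiag_sets mu k" unfolding offdiag_sets_def by blast
qed

lemma offdiag_rects_subset: "R \<in> offdiag_rects mu k \<Longrightarrow> R \<subseteq> offdiag_space mu k"
proof
  fix x assume "R \<in> offdiag_rects mu k" and x: "x \<in> R"
  then obtain A where A: "disjoint_sides mu k A" "R = Pi\<^sub>E {..<k} A" by (auto simp: offdiag_rects_def)
  have c: "x r \<in> A r" if "r < k" for r using x that by (auto simp: A PiE_iff)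
  then have "x r \<in> space mu" if "r < k" for r
    using A(1) that sets.sets_into_space by (fastforce simp: disjoint_sides_def)
  moreover have "x i \<noteq> x j" if "i < k" "j < k" "i \<noteq> j" for i j
    using c[OF that(1)] c[OF that(2)] that A(1) by (fastforce simp: disjoint_sides_def disjoint_family_on_def)
  moreover have "x \<in> extensional {..<k}" using x unfolding A(2) by (simp add: PiE_iff)
  ultimately have "x \<in> space (prod_measure mu k)" "x \<notin> diagonal mu k"
    by (simp add: space_PiM PiE_iff, unfold diagonal_def, blast)
  then show "x \<in> offdiag_space mu k" by (simp add: offdiag_space_def)
qed

text \<open>
  A countable cover by boxes is intersected with a countable cover of the off-diagonal space by
  rectangles; a box meets an off-diagonal rectangle in an off-diagonal rectangle.
\<close>

lemma offdiag_outer_approx: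
  assumes iso: "borel_iso_space mu" and fin: "finite_measure mu" and k: "1 \<le> k"
    and A: "A \<in> offdiag_sets mu k" and e: "0 < e"
  shows "\<exists>C :: nat \<Rightarrow> nat \<Rightarrow> 'a set. (\<forall>i. disjoint_sides mu k (C i)) \<and> A \<subseteq> (\<Union>i. Pi\<^sub>E {..<k} (C i)) \<and>
    measure (prod_measure mu k) ((\<Union>i. Pi\<^sub>E {..<k} (C i)) - A) < e"
proof -
  interpret N: finite_measure "prod_measure mu k" by (rule finite_measure_prod_measure[OF fin])
  have A': "A \<in> sets (prod_measure mu k)" "A \<subseteq> offdiag_space mu k"
    using A by (simp_all add: offdiag_sets_iff[OF iso])
  obtain \<G> where \<G>: "countable \<G>" "\<G> \<subseteq> {Pi\<^sub>E {..<k} B | B. \<forall>r<k. B r \<in> sets mu}" "A \<subseteq> \<Union>\<G>"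
    "measure (prod_measure mu k) (\<Union>\<G> - A) < e"
    using outer_box_approx[OF fin A'(1) e] by blast
  obtain \<R> where \<R>: "countable \<R>" "\<R> \<subseteq> offdiag_rects mu k" "offdiag_space mu k = \<Union>\<R>"
    using offdiag_space_countable_union[OF iso, of k] by auto
  \<comment> \<open>The empty rectangle guarantees that there is something to enumerate.\<close>
  define \<H> where "\<H> = insert {} ((\<lambda>(G, R). G \<inter> R) ` (\<G> \<times> \<R>))"
  have empty: "{} \<in> offdiag_rects mu k"
  proof -
    have "Pi\<^sub>E {..<k} (\<lambda>_. {}) = {}" using k by (auto simp: PiE_eq_empty_iff intro!: exI[of _ 0])
    moreover have "disjoint_sides mu k (\<lambda>_. {})" by (simp add: disjoint_sides_def disjoint_family_on_def)
    ultimately show ?thesis unfolding offdiag_rects_def by (intro CollectI exI[of _ "\<lambda>_. {}"] conjI) (rule sym)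
  qed
  have "countable \<H>"
    unfolding \<H>_def by (intro countable_insert countable_image countable_SIGMA \<G>(1) \<R>(1))
  have \<H>: "\<H> \<subseteq> offdiag_rects mu k"
  proof
    fix X assume "X \<in> \<H>"
    then have "X = {} \<or> (\<exists>G\<in>\<G>. \<exists>R\<in>\<R>. X = G \<inter> R)" unfolding \<H>_def by auto
    then consider "X = {}" | G R where "G \<in> \<G>" "R \<in> \<R>" "X = G \<inter> R" by blast
    then show "X \<in> offdiag_rects mu k"
    proof cases
      case 2
      from 2(1) \<G>(2) obtain B where B: "G = Pi\<^sub>E {..<k} B" "\<And>r. r < k \<Longrightarrow> B r \<in> sets mu" by auto
      from 2(2) \<R>(2) obtain C where C: "R = Pi\<^sub>E {..<k} C" "disjoint_sides mu k C" by (auto simp: offdiag_rects_def)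
      have "disjoint_sides mu k (\<lambda>r. B r \<inter> C r)"
        using B C by (fastforce simp: disjoint_sides_def disjoint_family_on_def)
      then show ?thesis unfolding 2(3) B(1) C(1) PiE_Int offdiag_rects_def by blast
    qed (simp add: empty)
  qed
  have UH: "\<Union>\<H> = \<Union>\<G> \<inter> offdiag_space mu k"
    unfolding \<R>(3) \<H>_def by auto
  have ne: "\<H> \<noteq> {}" unfolding \<H>_def by simp
  have "\<exists>C. disjoint_sides mu k C \<and> from_nat_into \<H> i = Pi\<^sub>E {..<k} C" for i
    using \<H> from_nat_into[OF ne, of i] unfolding offdiag_rects_def by auto
  then obtain C where C: "\<And>i. disjoint_sides mu k (C i)" "\<And>i. from_nat_into \<H> i = Pi\<^sub>E {..<k} (C i)" by metis
  have UC: "(\<Union>i. Pi\<^sub>E {..<k} (C i)) = \<Union>\<H>"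
    unfolding C(2)[symmetric] by (simp only: range_from_nat_into[OF ne \<open>countable \<H>\<close>])
  have "\<Union>\<G> \<in> sets (prod_measure mu k)"
  proof (rule sets.countable_Union[OF \<G>(1)], rule subsetI)
    fix G assume "G \<in> \<G>"
    then obtain B where "G = Pi\<^sub>E {..<k} B" "\<forall>r<k. B r \<in> sets mu" using \<G>(2) by blast
    then show "G \<in> sets (prod_measure mu k)" by (auto intro!: sets_PiM_I_finite)
  qed
  then have "measure (prod_measure mu k) (\<Union>\<H> - A) \<le> measure (prod_measure mu k) (\<Union>\<G> - A)"
    unfolding UH using A' by (intro N.finite_measure_mono) auto
  then show ?thesis
  proof (intro exI[of _ C] conjI allI)
    assume *: "measure (prod_measure mu k) (\<Union>\<H> - A) \<le> measure (prod_measure mu k) (\<Union>\<G> - A)"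
    show "A \<subseteq> (\<Union>i. Pi\<^sub>E {..<k} (C i))" unfolding UC UH using \<G>(3) A'(2) by blast
    show "measure (prod_measure mu k) ((\<Union>i. Pi\<^sub>E {..<k} (C i)) - A) < e"
      unfolding UC using * \<G>(4) by simp
  qed (rule C(1))
qed

text \<open>
  A finite part of a good outer cover misses little of the cover, hence little of \<open>A\<close>, and its excess
  over \<open>A\<close> is at most that of the cover.
\<close>

lemma ex_approx_seq:
  assumes iso: "borel_iso_space mu" and fin: "finite_measure mu" and k: "1 \<le> k"
    and A: "A \<in> offdiag_sets mu k"
  shows "\<exists>An. approx_seq mu k An A"
proof -
  interpret N: finite_measure "prod_measure mu k" by (rule finite_measure_prod_measure[OF fin])
  have A': "A \<in> sets (prod_measure mu k)"
    using A by (simp add: offdiag_sets_iff[OF iso])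
  have "\<exists>U \<in> offdiag_unions mu k. measure (prod_measure mu k) (sym_diff U A) < 2 / real (Suc n)" for n
  proof -
    obtain C :: "nat \<Rightarrow> nat \<Rightarrow> 'a set" where C: "\<And>i. disjoint_sides mu k (C i)" "A \<subseteq> (\<Union>i. Pi\<^sub>E {..<k} (C i))"
      "measure (prod_measure mu k) ((\<Union>i. Pi\<^sub>E {..<k} (C i)) - A) < 1 / real (Suc n)"
      using offdiag_outer_approx[OF iso fin k A, of "1 / real (Suc n)"] by fastforce
    let ?R = "\<lambda>i. Pi\<^sub>E {..<k} (C i)"
    define U where "U N = (\<Union>i<N. ?R i)" for N :: nat
    have R: "?R i \<in> offdiag_rects mu k" for i using C(1) by (auto simp: offdiag_rects_def)
    have [measurable]: "?R i \<in> sets (prod_measure mu k)" for i using offdiag_rects_sets[OF R] .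
    have [measurable]: "U N \<in> sets (prod_measure mu k)" for N unfolding U_def by measurable
    have "(\<lambda>N. measure (prod_measure mu k) ((\<Union>i. ?R i) - U N)) \<longlonglongrightarrow> measure (prod_measure mu k) (\<Inter>N. (\<Union>i. ?R i) - U N)"
      by (rule N.finite_Lim_measure_decseq) (auto simp: U_def decseq_def)
    moreover have "(\<Inter>N. (\<Union>i. ?R i) - U N) = {}" by (auto simp: U_def)
    ultimately have "(\<lambda>N. measure (prod_measure mu k) ((\<Union>i. ?R i) - U N)) \<longlonglongrightarrow> 0"
      by (simp only: measure_empty)
    then have "\<forall>\<^sub>F N in sequentially. measure (prod_measure mu k) ((\<Union>i. ?R i) - U N) < 1 / real (Suc n)"
      by (intro order_tendstoD) auto
    then obtain N where N: "measure (prod_measure mu k) ((\<Union>i. ?R i) - U N) < 1 / real (Suc n)"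
      unfolding eventually_sequentially by auto
    have "measure (prod_measure mu k) (sym_diff (U N) A)
      \<le> measure (prod_measure mu k) (((\<Union>i. ?R i) - U N) \<union> ((\<Union>i. ?R i) - A))"
      using C(2) A' by (intro N.finite_measure_mono) (auto simp: U_def)
    also have "\<dots> \<le> measure (prod_measure mu k) ((\<Union>i. ?R i) - U N) + measure (prod_measure mu k) ((\<Union>i. ?R i) - A)"
      using A' by (intro measure_Un_le) auto
    also have "\<dots> < 2 / real (Suc n)" using N C(3) by simp
    finally have "measure (prod_measure mu k) (sym_diff (U N) A) < 2 / real (Suc n)" .
    moreover have "U N \<in> offdiag_unions mu k"
      unfolding offdiag_unions_def U_def using R by (auto intro!: exI[of _ "?R ` {..<N}"])
    ultimately show ?thesis by blast
  qed
  then obtain An where An: "\<And>n. An n \<in> offdiag_unions mu k"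
    "\<And>n. measure (prod_measure mu k) (sym_diff (An n) A) < 2 / real (Suc n)" by metis
  have "(\<lambda>n. measure (prod_measure mu k) (sym_diff (An n) A)) \<longlonglongrightarrow> 0"
  proof (rule tendsto_sandwich[OF _ _ tendsto_const])
    show "(\<lambda>n. 2 / real (Suc n)) \<longlonglongrightarrow> 0"
      using tendsto_mult_right_zero[OF LIMSEQ_Suc[OF lim_1_over_n], of 2] by simp
  qed (use An(2) in \<open>auto intro!: always_eventually less_imp_le simp del: of_nat_Suc\<close>)
  then have "approx_seq mu k An A"
    unfolding approx_seq_def N.emeasure_eq_measure using An(1) tendsto_ennrealI by fastforce
  then show ?thesis by blast
qed

section \<open>Uniqueness in law of Frechet sup measures\<close>

text \<open>
  The half-lines on which the Frechet distribution function is prescribed. The whole space is added as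
  the value of a coordinate without constraint, as needed in criteria for independence.
\<close>

definition ennreal_cuts :: "ennreal set set" where
  "ennreal_cuts = insert UNIV ((\<lambda>x. {..ennreal x}) ` {0<..})"

lemma Int_stable_ennreal_cuts: "Int_stable ennreal_cuts"
proof (rule Int_stableI)
  fix A B assume "A \<in> ennreal_cuts" "B \<in> ennreal_cuts"
  moreover have "{..ennreal x} \<inter> {..ennreal y} = {..ennreal (min x y)}" if "0 < x" "0 < y" for x y
    using that by (auto simp: min_def not_le elim: order_trans intro!: ennreal_leI)
  ultimately show "A \<inter> B \<in> ennreal_cuts"
    by (auto simp: ennreal_cuts_def min_def)
qed

lemma sets_borel_ennreal_cuts: "sets (borel :: ennreal measure) = sigma_sets UNIV ennreal_cuts"
proof (rule antisym)
  let ?S = "sigma UNIV ennreal_cuts"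
  have S: "sets ?S = sigma_sets UNIV ennreal_cuts" by (rule sets_measure_of) auto
  have "ennreal_cuts \<subseteq> sets borel" by (auto simp: ennreal_cuts_def)
  then show "sigma_sets UNIV ennreal_cuts \<subseteq> sets (borel :: ennreal measure)"
    using sets.sigma_sets_subset[of ennreal_cuts "borel :: ennreal measure"] by simp
  have pos: "{..ennreal x} \<in> sets ?S" if "0 < x" for x
    using that unfolding S by (intro sigma_sets.Basic) (auto simp: ennreal_cuts_def)
  have cut: "{..a} \<in> sets ?S" for a :: ennreal
  proof (cases a)
    case (real x)
    show ?thesis
    proof (cases "x = 0")
      case True
      have "{..0 :: ennreal} = (\<Inter>n. {..ennreal (1 / real (Suc n))})"
      proof (intro set_eqI iffI)
        fix y :: ennreal assume y: "y \<in> (\<Inter>n. {..ennreal (1 / real (Suc n))})"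
        have "(\<lambda>n. ennreal (1 / real (Suc n))) \<longlonglongrightarrow> ennreal 0"
          by (intro tendsto_ennrealI LIMSEQ_Suc[OF lim_1_over_n])
        then have "y \<le> ennreal 0" using y by (intro LIMSEQ_le_const) auto
        then show "y \<in> {..0}" by simp
      qed auto
      also have "\<dots> \<in> sets ?S" by (intro sets.countable_INT image_subsetI pos) simp_all
      finally show ?thesis using real True by simp
    qed (use real pos in auto)
  next
    case top
    then show ?thesis unfolding S by (auto simp: ennreal_cuts_def intro!: sigma_sets.Basic)
  qed
  have "sets (borel :: ennreal measure) = sigma_sets UNIV (range greaterThan)"
    unfolding borel_Ioi by (rule sets_measure_of) auto
  also have "\<dots> \<subseteq> sets ?S"
  proof -
    have "{a<..} \<in> sets ?S" for a :: ennreal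
    proof -
      have "{a<..} = space ?S - {..a}" by auto
      also have "\<dots> \<in> sets ?S" by (intro sets.Diff sets.top cut)
      finally show ?thesis .
    qed
    then have "range greaterThan \<subseteq> sets ?S" by (rule image_subsetI)
    from sets.sigma_sets_subset[OF this] show ?thesis by (simp only: space_measure_of_conv)
  qed
  finally show "sets (borel :: ennreal measure) \<subseteq> sigma_sets UNIV ennreal_cuts" unfolding S .
qed

lemma distr_ennreal_eqI:
  fixes X :: "'w \<Rightarrow> ennreal" and Y :: "'v \<Rightarrow> ennreal"
  assumes P: "prob_space P" and Q: "prob_space Q"
    and [measurable]: "X \<in> borel_measurable P" "Y \<in> borel_measurable Q"
    and eq: "\<And>x. 0 < x \<Longrightarrow> measure P {\<omega> \<in> space P. X \<omega> \<le> ennreal x} = measure Q {\<omega> \<in> space Q. Y \<omega> \<le> ennreal x}"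
  shows "distr P borel X = distr Q borel Y"
proof -
  interpret P: prob_space P by fact
  interpret Q: prob_space Q by fact
  interpret DP: prob_space "distr P borel X" by (rule P.prob_space_distr) measurable
  interpret DQ: prob_space "distr Q borel Y" by (rule Q.prob_space_distr) measurable
  show ?thesis
  proof (rule measure_eqI_generator_eq[OF Int_stable_ennreal_cuts, where \<Omega>=UNIV and A="\<lambda>_. UNIV"])
    show "emeasure (distr P borel X) A = emeasure (distr Q borel Y) A" if "A \<in> ennreal_cuts" for A
    proof -
      have "A = UNIV \<or> (\<exists>x>0. A = {..ennreal x})" using that by (auto simp: ennreal_cuts_def)
      then show ?thesis
      proof (elim disjE exE conjE)
        assume "A = UNIV"
        then show ?thesis using DP.emeasure_space_1 DQ.emeasure_space_1 by simp
      next
        fix x :: real assume x: "0 < x" "A = {..ennreal x}"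
        have "X -` A \<inter> space P = {\<omega> \<in> space P. X \<omega> \<le> ennreal x}"
          "Y -` A \<inter> space Q = {\<omega> \<in> space Q. Y \<omega> \<le> ennreal x}" using x(2) by auto
        then show ?thesis
          using x eq[OF x(1)] by (simp add: emeasure_distr P.emeasure_eq_measure Q.emeasure_eq_measure)
      qed
    qed
    show "range (\<lambda>_::nat. UNIV) \<subseteq> ennreal_cuts" by (simp add: ennreal_cuts_def)
    show "emeasure (distr P borel X) UNIV \<noteq> \<infinity>" using DP.emeasure_space_1 by simp
  qed (simp_all add: sets_borel_ennreal_cuts)
qed

lemma frechetD:
  assumes "frechet_sup_measure P mu \<alpha> M"
  shows "prob_space P" "\<And>A. A \<in> sets mu \<Longrightarrow> M A \<in> borel_measurable P"
    "\<And>n A. (\<And>i. i < n \<Longrightarrow> A i \<in> sets mu) \<Longrightarrow> disjoint_family_on A {..<n} \<Longrightarrow>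
       prob_space.indep_vars P (\<lambda>_. borel) (\<lambda>i. M (A i)) {..<n::nat}"
    "\<And>A x. A \<in> sets mu \<Longrightarrow> 0 < x \<Longrightarrow> measure P {\<omega> \<in> space P. M A \<omega> \<le> ennreal x} =
         (if emeasure mu A = \<infinity> then 0 else exp (- (measure mu A * x powr (- \<alpha>))))"
    "\<And>A :: nat \<Rightarrow> _. (\<And>j. A j \<in> sets mu) \<Longrightarrow> AE \<omega> in P. M (\<Union>j. A j) \<omega> = (SUP j. M (A j) \<omega>)"
  using assms unfolding frechet_sup_measure_def by auto

lemma frechet_marginal_law:
  assumes M: "frechet_sup_measure P mu \<alpha> M" and N: "frechet_sup_measure Q mu \<alpha> N" and A: "A \<in> sets mu"
  shows "distr P borel (M A) = distr Q borel (N A)"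
  by (rule distr_ennreal_eqI)
     (simp_all add: frechetD(1,2)[OF M] frechetD(1,2)[OF N] frechetD(4)[OF M] frechetD(4)[OF N] A)

text \<open>
  The distribution function is constantly 1 on \<open>(0, \<infinity>)\<close>. The case of the empty set makes finite
  unions accessible to the axiom on countable unions.
\<close>

lemma frechet_null:
  assumes M: "frechet_sup_measure P mu \<alpha> M" and A: "A \<in> null_sets mu"
  shows "AE \<omega> in P. M A \<omega> = 0"
proof -
  interpret P: prob_space P by (rule frechetD(1)[OF M])
  have A': "A \<in> sets mu" "emeasure mu A = 0" using A by auto
  have [measurable]: "M A \<in> borel_measurable P" by (rule frechetD(2)[OF M A'(1)])
  have "AE \<omega> in P. M A \<omega> \<le> ennreal (1 / real (Suc n))" for n
  proof -
    have "measure P {\<omega> \<in> space P. M A \<omega> \<le> ennreal (1 / real (Suc n))} = 1"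
      by (subst frechetD(4)[OF M A'(1)]) (simp_all add: A' measure_def)
    then show ?thesis by (subst (asm) P.prob_Collect_eq_1) auto
  qed
  then have "AE \<omega> in P. \<forall>n. M A \<omega> \<le> ennreal (1 / real (Suc n))" by (simp add: AE_all_countable)
  then show ?thesis
  proof eventually_elim
    case (elim \<omega>)
    have "(\<lambda>n. ennreal (1 / real (Suc n))) \<longlonglongrightarrow> ennreal 0"
      by (intro tendsto_ennrealI LIMSEQ_Suc[OF lim_1_over_n])
    then have "M A \<omega> \<le> ennreal 0" using elim by (intro LIMSEQ_le_const) auto
    then show ?case by simp
  qed
qed

lemma frechet_finite_union:
  fixes I :: "nat set"
  assumes M: "frechet_sup_measure P mu \<alpha> M" and D: "\<And>i. i \<in> I \<Longrightarrow> D i \<in> sets mu"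
  shows "AE \<omega> in P. M (\<Union>i\<in>I. D i) \<omega> = (SUP i\<in>I. M (D i) \<omega>)"
proof -
  \<comment> \<open>Pad with empty sets, whose values vanish almost surely.\<close>
  define A where "A j = (if j \<in> I then D j else {})" for j
  have "AE \<omega> in P. M (\<Union>j. A j) \<omega> = (SUP j. M (A j) \<omega>)"
    using D by (intro frechetD(5)[OF M]) (auto simp: A_def)
  moreover have un: "(\<Union>j. A j) = (\<Union>i\<in>I. D i)" by (auto simp: A_def split: if_splits)
  have "AE \<omega> in P. M {} \<omega> = 0" by (rule frechet_null[OF M]) auto
  ultimately show ?thesis
  proof (eventually_elim)
    case (elim \<omega>)
    have "(SUP j. M (A j) \<omega>) = (SUP i\<in>I. M (D i) \<omega>)"
    proof (rule antisym)
      show "(SUP j. M (A j) \<omega>) \<le> (SUP i\<in>I. M (D i) \<omega>)"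
        using elim by (auto simp: A_def intro!: SUP_least intro: SUP_upper)
      show "(SUP i\<in>I. M (D i) \<omega>) \<le> (SUP j. M (A j) \<omega>)"
      proof (rule SUP_mono)
        fix i assume "i \<in> I"
        then have "M (D i) \<omega> \<le> M (A i) \<omega>" by (simp add: A_def)
        then show "\<exists>j\<in>UNIV. M (D i) \<omega> \<le> M (A j) \<omega>" by blast
      qed
    qed
    then show ?case using elim by (simp add: un[symmetric])
  qed
qed

lemma frechet_disjoint_law:
  fixes A :: "nat \<Rightarrow> 'a set"
  assumes M: "frechet_sup_measure P mu \<alpha> M" and N: "frechet_sup_measure Q mu \<alpha> N"
    and A: "\<And>i. i < n \<Longrightarrow> A i \<in> sets mu" "disjoint_family_on A {..<n}" and n: "0 < n"
  shows "distr P (PiM {..<n} (\<lambda>_. borel)) (\<lambda>\<omega>. \<lambda>i\<in>{..<n}. M (A i) \<omega>)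
    = distr Q (PiM {..<n} (\<lambda>_. borel)) (\<lambda>\<omega>. \<lambda>i\<in>{..<n}. N (A i) \<omega>)"
proof -
  have *: "distr P (PiM {..<n} (\<lambda>_. borel)) (\<lambda>\<omega>. \<lambda>i\<in>{..<n}. M (A i) \<omega>) = PiM {..<n} (\<lambda>i. distr P borel (M (A i)))"
    if M: "frechet_sup_measure P mu \<alpha> M" for P :: "'x measure" and M
  proof -
    interpret prob_space P by (rule frechetD(1)[OF M])
    have "indep_vars (\<lambda>_. borel) (\<lambda>i. M (A i)) {..<n}" using A by (intro frechetD(3)[OF M]) auto
    then show ?thesis
      using n frechetD(2)[OF M A(1)] by (subst (asm) indep_vars_iff_distr_eq_PiM') auto
  qed
  show ?thesis
    unfolding *[OF M] *[OF N] by (intro PiM_cong refl frechet_marginal_law[OF M N] A) auto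
qed

text \<open>
  The sets in \<open>J\<close> are unions of the atoms of the algebra that they generate, one atom for each subset
  of \<open>J\<close>. The values on the atoms are independent with prescribed laws, and the value on a set is
  almost surely the maximum over its atoms.
\<close>

lemma frechet_finite_law:
  fixes mu :: "'a measure"
  assumes M: "frechet_sup_measure P mu \<alpha> M" and N: "frechet_sup_measure Q mu \<alpha> N"
    and J: "finite J" "J \<subseteq> sets mu"
  shows "distr P (PiM J (\<lambda>_. borel)) (\<lambda>\<omega>. \<lambda>A\<in>J. M A \<omega>) = distr Q (PiM J (\<lambda>_. borel)) (\<lambda>\<omega>. \<lambda>A\<in>J. N A \<omega>)"
proof -
  \<comment> \<open>Number the subsets of \<open>J\<close>; the atom with number \<open>i\<close> is described by the subset \<open>h i\<close>.\<close>
  obtain h where h: "bij_betw h {..<card (Pow J)} (Pow J)"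
    using ex_bij_betw_nat_finite[of "Pow J"] J by (auto simp: lessThan_atLeast0)
  define n where "n = card (Pow J)"
  have n: "0 < n" using J by (simp add: n_def card_Pow)
  define D where "D i = {x \<in> space mu. \<forall>A\<in>J. x \<in> A \<longleftrightarrow> A \<in> h i}" for i
  have D: "D i \<in> sets mu" for i
  proof -
    have "{x \<in> space mu. x \<in> A \<longleftrightarrow> A \<in> h i} \<in> sets mu" if "A \<in> J" for A
    proof -
      have [measurable]: "A \<in> sets mu" using that J by blast
      show ?thesis by measurable
    qed
    then show ?thesis
      unfolding D_def by (rule sets.sets_Collect_finite_All) (use J(1) in auto)
  qed
  have disj: "disjoint_family_on D {..<n}"
  proof (unfold disjoint_family_on_def, intro ballI impI)
    fix i j assume ij: "i \<in> {..<n}" "j \<in> {..<n}" "i \<noteq> j"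
    then have "h i \<noteq> h j" "h i \<subseteq> J" "h j \<subseteq> J"
      using h by (auto simp: bij_betw_def inj_on_def n_def)
    then show "D i \<inter> D j = {}" by (auto simp: D_def)
  qed
  have un: "A = (\<Union>i\<in>{i. i < n \<and> A \<in> h i}. D i)" if A: "A \<in> J" for A
  proof (intro set_eqI iffI)
    fix x assume x: "x \<in> A"
    then have xs: "x \<in> space mu" using A J sets.sets_into_space by blast
    have "{B \<in> J. x \<in> B} \<in> h ` {..<n}" using h by (auto simp: bij_betw_def n_def)
    then obtain i where i: "i < n" "h i = {B \<in> J. x \<in> B}" by auto
    then have "x \<in> D i" "A \<in> h i" using xs x A by (auto simp: D_def)
    then show "x \<in> (\<Union>i\<in>{i. i < n \<and> A \<in> h i}. D i)" using i by blast
  next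
    fix x assume "x \<in> (\<Union>i\<in>{i. i < n \<and> A \<in> h i}. D i)"
    then show "x \<in> A" using A by (auto simp: D_def)
  qed
  define \<Phi> :: "(nat \<Rightarrow> ennreal) \<Rightarrow> 'a set \<Rightarrow> ennreal" where "\<Phi> x = (\<lambda>A\<in>J. SUP i\<in>{i. i < n \<and> A \<in> h i}. x i)" for x
  have \<Phi>[measurable]: "\<Phi> \<in> measurable (PiM {..<n} (\<lambda>_. borel)) (PiM J (\<lambda>_. borel))"
    unfolding \<Phi>_def by (intro measurable_restrict borel_measurable_SUP) auto
  have *: "distr P (PiM J (\<lambda>_. borel)) (\<lambda>\<omega>. \<lambda>A\<in>J. M A \<omega>) =
      distr (distr P (PiM {..<n} (\<lambda>_. borel)) (\<lambda>\<omega>. \<lambda>i\<in>{..<n}. M (D i) \<omega>)) (PiM J (\<lambda>_. borel)) \<Phi>"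
    if M: "frechet_sup_measure P mu \<alpha> M" for P :: "'x measure" and M
  proof -
    have [measurable]: "M A \<in> borel_measurable P" if "A \<in> sets mu" for A
      using frechetD(2)[OF M that] .
    have Dm[measurable]: "(\<lambda>\<omega>. \<lambda>i\<in>{..<n}. M (D i) \<omega>) \<in> measurable P (PiM {..<n} (\<lambda>_. borel))"
      using D by (intro measurable_restrict) measurable
    have "AE \<omega> in P. \<forall>A\<in>J. M (\<Union>i\<in>{i. i < n \<and> A \<in> h i}. D i) \<omega> = (SUP i\<in>{i. i < n \<and> A \<in> h i}. M (D i) \<omega>)"
      using J by (intro AE_finite_allI frechet_finite_union[OF M]) (auto intro: D)
    then have ae: "AE \<omega> in P. (\<lambda>A\<in>J. M A \<omega>) = \<Phi> (\<lambda>i\<in>{..<n}. M (D i) \<omega>)"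
    proof eventually_elim
      case (elim \<omega>)
      show ?case
      proof (rule ext)
        fix A show "(\<lambda>A\<in>J. M A \<omega>) A = \<Phi> (\<lambda>i\<in>{..<n}. M (D i) \<omega>) A"
        proof (cases "A \<in> J")
          case True
          then have "M A \<omega> = (SUP i\<in>{i. i < n \<and> A \<in> h i}. M (D i) \<omega>)"
            using elim un[OF True] by metis
          also have "\<dots> = (SUP i\<in>{i. i < n \<and> A \<in> h i}. (\<lambda>i\<in>{..<n}. M (D i) \<omega>) i)"
            by (intro SUP_cong) auto
          finally show ?thesis using True by (simp add: \<Phi>_def)
        qed (simp add: \<Phi>_def)
      qed
    qed
    have "distr P (PiM J (\<lambda>_. borel)) (\<lambda>\<omega>. \<lambda>A\<in>J. M A \<omega>)
      = distr P (PiM J (\<lambda>_. borel)) (\<lambda>\<omega>. \<Phi> (\<lambda>i\<in>{..<n}. M (D i) \<omega>))"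
      using J by (intro distr_cong_AE refl ae measurable_restrict measurable_compose[OF Dm \<Phi>]) auto
    also have "\<dots> = distr (distr P (PiM {..<n} (\<lambda>_. borel)) (\<lambda>\<omega>. \<lambda>i\<in>{..<n}. M (D i) \<omega>)) (PiM J (\<lambda>_. borel)) \<Phi>"
      by (subst distr_distr[OF \<Phi> Dm]) (simp add: comp_def)
    finally show ?thesis .
  qed
  show ?thesis
    unfolding *[OF M] *[OF N] frechet_disjoint_law[OF M N D disj n] ..
qed

text \<open>
  All sets \<open>A \<in> \<E>\<close> at once: a sup measure is read as a random element of \<open>[0, \<infinity>]\<^sup>\<E>\<close>. Each
  statement about it concerns countably many coordinates, so the product \<open>\<sigma>\<close>-algebra is enough.
\<close>

abbreviation path :: "'a measure \<Rightarrow> ('a set \<Rightarrow> 'w \<Rightarrow> ennreal) \<Rightarrow> 'w \<Rightarrow> 'a set \<Rightarrow> ennreal" where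
  "path mu M \<omega> \<equiv> \<lambda>A\<in>sets mu. M A \<omega>"

abbreviation path_space :: "'a measure \<Rightarrow> ('a set \<Rightarrow> ennreal) measure" where
  "path_space mu \<equiv> PiM (sets mu) (\<lambda>_. borel)"

definition joint_law :: "'a measure \<Rightarrow> 'w measure \<Rightarrow> ('a set \<Rightarrow> 'w \<Rightarrow> ennreal) \<Rightarrow> ('a set \<Rightarrow> ennreal) measure" where
  "joint_law mu P M = distr P (path_space mu) (\<lambda>\<omega>. path mu M \<omega>)"

lemma frechet_law:
  assumes M: "frechet_sup_measure P mu \<alpha> M" and N: "frechet_sup_measure Q mu \<alpha> N"
  shows "joint_law mu P M = joint_law mu Q N"
  unfolding joint_law_def
proof (rule measure_eqI_PiM_infinite)
  have meas: "(\<lambda>\<omega>. \<lambda>A\<in>J. M A \<omega>) \<in> measurable P (PiM J (\<lambda>_. borel))"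
    if "frechet_sup_measure P mu \<alpha> M" "J \<subseteq> sets mu" for P :: "'x measure" and M J
    using frechetD(2)[OF that(1)] that(2) by (intro measurable_restrict) auto
  show "finite_measure (distr P (path_space mu) (\<lambda>\<omega>. path mu M \<omega>))"
    by (intro prob_space.finite_measure prob_space.prob_space_distr frechetD(1)[OF M] meas[OF M order_refl])
  fix B and J assume J: "finite J" "J \<subseteq> sets mu" and B: "\<And>i. i \<in> J \<Longrightarrow> B i \<in> sets (borel :: ennreal measure)"
  have *: "emeasure (joint_law mu P M) (prod_emb (sets mu) (\<lambda>_. borel) J (Pi\<^sub>E J B))
    = emeasure (distr P (PiM J (\<lambda>_. borel)) (\<lambda>\<omega>. \<lambda>A\<in>J. M A \<omega>)) (Pi\<^sub>E J B)"
    if M: "frechet_sup_measure P mu \<alpha> M" for P :: "'x measure" and M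
  proof -
    have "(\<lambda>\<omega>. path mu M \<omega>) -` prod_emb (sets mu) (\<lambda>_. borel) J (Pi\<^sub>E J B) \<inter> space P
      = (\<lambda>\<omega>. \<lambda>A\<in>J. M A \<omega>) -` Pi\<^sub>E J B \<inter> space P"
      using J(2) by (auto simp: prod_emb_def PiE_iff subset_iff)
    moreover have "prod_emb (sets mu) (\<lambda>_. borel) J (Pi\<^sub>E J B) \<in> sets (path_space mu)"
      using J B by (intro sets_PiM_I) auto
    moreover have "Pi\<^sub>E J B \<in> sets (PiM J (\<lambda>_. borel))" using J B by (intro sets_PiM_I_finite) auto
    ultimately show ?thesis
      using meas[OF M J(2)] meas[OF M order_refl] by (simp add: emeasure_distr joint_law_def)
  qed
  show "emeasure (distr P (path_space mu) (\<lambda>\<omega>. path mu M \<omega>)) (prod_emb (sets mu) (\<lambda>_. borel) J (Pi\<^sub>E J B))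
    = emeasure (distr Q (path_space mu) (\<lambda>\<omega>. path mu N \<omega>)) (prod_emb (sets mu) (\<lambda>_. borel) J (Pi\<^sub>E J B))"
    unfolding *[OF M, unfolded joint_law_def] *[OF N, unfolded joint_law_def] frechet_finite_law[OF M N J] ..
qed simp_all

lemma frechet_law_transfer:
  assumes M: "frechet_sup_measure P mu \<alpha> M" and N: "frechet_sup_measure Q mu \<alpha> N"
    and \<Phi>: "\<Phi> \<in> measurable (path_space mu) L"
  shows "distr P L (\<lambda>\<omega>. \<Phi> (path mu M \<omega>)) = distr Q L (\<lambda>\<omega>. \<Phi> (path mu N \<omega>))"
proof -
  have meas: "(\<lambda>\<omega>. path mu M \<omega>) \<in> measurable P (path_space mu)"
    if "frechet_sup_measure P mu \<alpha> M" for P :: "'x measure" and M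
    using frechetD(2)[OF that(1)] by (intro measurable_restrict) auto
  show ?thesis
    using arg_cong[OF frechet_law[OF M N], of "\<lambda>D. distr D L \<Phi>"]
    unfolding joint_law_def distr_distr[OF \<Phi> meas[OF M]] distr_distr[OF \<Phi> meas[OF N]] by (simp add: comp_def)
qed

section \<open>A multiplicative functional of the marked Poisson process\<close>

text \<open>
  The hypothesis on \<open>h\<close> says that \<open>t \<mapsto> - exp (- t) * h (s + t)\<close> is an antiderivative of
  \<open>t \<mapsto> exp (- t) * w (s + t) * h (s + t)\<close>. A finite exceptional set is admitted because \<open>h\<close> has
  kinks in the applications.
\<close>

lemma renewal_identity:
  fixes h w :: "real \<Rightarrow> real"
  assumes S: "finite S" and cont: "continuous_on {0..} h"
    and deriv: "\<And>u. 0 < u \<Longrightarrow> u \<notin> S \<Longrightarrow> (h has_real_derivative (1 - w u) * h u) (at u)"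
    and [measurable]: "h \<in> borel_measurable borel" "w \<in> borel_measurable borel"
    and w: "\<And>u. 0 \<le> u \<Longrightarrow> 0 \<le> w u" and h: "\<And>u. 0 \<le> u \<Longrightarrow> 0 \<le> h u" "\<And>u. 0 \<le> u \<Longrightarrow> h u \<le> K"
    and s: "0 \<le> s"
  shows "(\<integral>\<^sup>+t. ennreal (exponential_density 1 t * (w (s + t) * h (s + t))) \<partial>lborel) = ennreal (h s)"
proof -
  define g where "g = (\<lambda>t. exp (- t) * (w (s + t) * h (s + t)))"
  define f where "f = (\<lambda>(n::nat) t. ennreal (g t) * indicator {0..real n} t)"
  have g0: "0 \<le> g t" if "0 \<le> t" for t
    using that s w[of "s+t"] h(1)[of "s+t"] by (simp add: g_def)
  have [measurable]: "g \<in> borel_measurable borel"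
    unfolding g_def by measurable
  have I: "integral\<^sup>N lborel (f n) = ennreal (h s - exp (- real n) * h (s + real n))" for n
  proof -
    have "(g has_integral ((- exp (- real n) * h (s + real n)) - (- exp (- 0) * h (s + 0)))) {0..real n}"
    proof (rule fundamental_theorem_of_calculus_interior_strong)
      show "finite ((\<lambda>u. u - s) ` S)" using S by simp
      show "continuous_on {0..real n} (\<lambda>t. - exp (- t) * h (s + t))"
        using s by (intro continuous_intros continuous_on_compose2[OF cont]) auto
      show "((\<lambda>t. - exp (- t) * h (s + t)) has_vector_derivative g t) (at t)"
        if "t \<in> {0<..<real n} - (\<lambda>u. u - s) ` S" for t
      proof -
        have "s + t \<notin> S" using that by force
        then have "((\<lambda>t. h (t + s)) has_real_derivative (1 - w (t + s)) * h (t + s)) (at t)"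
          using deriv[of "t + s"] that s by (simp add: DERIV_shift[symmetric] add.commute)
        note this[unfolded add.commute[of _ s]]
        then show ?thesis
          unfolding has_real_derivative_iff_has_vector_derivative[symmetric] g_def
          by (auto intro!: derivative_eq_intros simp: algebra_simps)
      qed
    qed simp
    then show ?thesis
      unfolding f_def using nn_integral_has_integral_lebesgue'[of "{0..real n}" g] g0 by simp
  qed
  have "(\<lambda>n. integral\<^sup>N lborel (f n)) \<longlonglongrightarrow> (\<integral>\<^sup>+t. ennreal (g t) * indicator {0..} t \<partial>lborel)"
  proof (rule nn_integral_LIMSEQ)
    show "incseq f"
      by (auto simp: f_def incseq_def le_fun_def split: split_indicator)
    show "f n \<in> borel_measurable lborel" for n unfolding f_def by measurable
    show "(\<lambda>n. f n t) \<longlonglongrightarrow> ennreal (g t) * indicator {0..} t" for t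
    proof (rule tendsto_eventually)
      obtain N where "t \<le> real N" using real_arch_simple by blast
      then have "\<forall>n\<ge>N. f n t = ennreal (g t) * indicator {0..} t"
        by (auto simp: f_def split: split_indicator)
      then show "\<forall>\<^sub>F n in sequentially. f n t = ennreal (g t) * indicator {0..} t"
        unfolding eventually_sequentially by blast
    qed
  qed
  moreover have "(\<lambda>n. ennreal (h s - exp (- real n) * h (s + real n))) \<longlonglongrightarrow> ennreal (h s - 0)"
  proof (intro tendsto_ennrealI tendsto_diff tendsto_const)
    show "(\<lambda>n. exp (- real n) * h (s + real n)) \<longlonglongrightarrow> 0"
    proof (rule Lim_null_comparison)
      show "\<forall>\<^sub>F n in sequentially. norm (exp (- real n) * h (s + real n)) \<le> exp (- real n) * K"
        using h s by (auto simp: abs_mult)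
      show "(\<lambda>n. exp (- real n) * K) \<longlonglongrightarrow> 0"
      proof (rule tendsto_mult_left_zero)
        show "(\<lambda>n. exp (- real n)) \<longlonglongrightarrow> 0"
          by (rule filterlim_compose[OF exp_at_bot])
             (auto simp: filterlim_uminus_at_bot intro: filterlim_real_sequentially)
      qed
    qed
  qed
  ultimately have "(\<integral>\<^sup>+t. ennreal (g t) * indicator {0..} t \<partial>lborel) = ennreal (h s)"
    unfolding I using LIMSEQ_unique by force
  moreover have "(\<integral>\<^sup>+t. ennreal (exponential_density 1 t * (w (s + t) * h (s + t))) \<partial>lborel)
      = (\<integral>\<^sup>+t. ennreal (g t) * indicator {0..} t \<partial>lborel)"
    by (intro nn_integral_cong) (auto simp: exponential_density_def g_def split: split_indicator)
  ultimately show ?thesis by simp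
qed

definition exp_law :: "real measure" where
  "exp_law = density lborel (exponential_density 1)"

lemma prob_space_exp_law: "prob_space exp_law"
  unfolding exp_law_def by (rule prob_space_exponential_density) simp

lemma sets_exp_law[simp, measurable_cong]: "sets exp_law = sets borel"
  by (simp add: exp_law_def)

lemma space_exp_law[simp]: "space exp_law = UNIV"
  by (simp add: exp_law_def)

text \<open>
  A point is the sequence of interarrival times together with the sequence of marks.
\<close>

definition marked_space :: "'a measure \<Rightarrow> ((nat \<Rightarrow> real) \<times> (nat \<Rightarrow> 'a)) measure" where
  "marked_space m = PiM UNIV (\<lambda>_. exp_law) \<Otimes>\<^sub>M PiM UNIV (\<lambda>_. m)"

text \<open>
  The empty sum starts the process at 0, so the arrival time that is numbered \<open>i\<close> from 0 is
  \<open>arrival (Suc i)\<close>.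
\<close>

definition arrival :: "nat \<Rightarrow> (nat \<Rightarrow> real) \<Rightarrow> real" where
  "arrival n \<tau> = (\<Sum>l<n. \<tau> l)"

lemma arrival_case_nat: "arrival (Suc n) (case_nat t \<tau>) = t + arrival n \<tau>"
  unfolding arrival_def by (subst sum.lessThan_Suc_shift) simp

lemma measurable_arrival[measurable]: "arrival n \<in> borel_measurable (PiM UNIV (\<lambda>_. exp_law))"
  unfolding arrival_def by measurable

lemma prob_space_marked_space: "prob_space m \<Longrightarrow> prob_space (marked_space m)"
  unfolding marked_space_def
  by (intro prob_space_pair prob_space_PiM prob_space_exp_law) 

lemma nn_integral_sequence_split:
  assumes "prob_space m" and [measurable]: "F \<in> borel_measurable (PiM UNIV (\<lambda>_::nat. m))"
  shows "(\<integral>\<^sup>+x. F x \<partial>PiM UNIV (\<lambda>_. m)) = (\<integral>\<^sup>+t. \<integral>\<^sup>+x. F (case_nat t x) \<partial>PiM UNIV (\<lambda>_. m) \<partial>m)"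
proof -
  interpret prob_space m by fact
  interpret sequence_space m by unfold_locales
    have "(\<integral>\<^sup>+x. F x \<partial>S) = (\<integral>\<^sup>+x. F x \<partial>distr (m \<Otimes>\<^sub>M S) S (\<lambda>(s, \<omega>). case_nat s \<omega>))"
    by (simp add: PiM_iter)
  also have "\<dots> = (\<integral>\<^sup>+x. F (case x of (s, \<omega>) \<Rightarrow> case_nat s \<omega>) \<partial>(m \<Otimes>\<^sub>M S))"
    by (rule nn_integral_distr) measurable
  also have "\<dots> = (\<integral>\<^sup>+t. \<integral>\<^sup>+x. F (case_nat t x) \<partial>S \<partial>m)"
    using P.nn_integral_fst[of "\<lambda>x. F (case x of (s, \<omega>) \<Rightarrow> case_nat s \<omega>)" m] by simp
  finally show ?thesis .
qed

text \<open>
  Renewal at the first point: the process after it has the same law.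
\<close>

lemma nn_integral_marked_split:
  assumes m: "prob_space m" and [measurable]: "F \<in> borel_measurable (marked_space m)"
  shows "(\<integral>\<^sup>+x. F x \<partial>marked_space m) =
    (\<integral>\<^sup>+t. \<integral>\<^sup>+a. \<integral>\<^sup>+x. F (case_nat t (fst x), case_nat a (snd x)) \<partial>marked_space m \<partial>m \<partial>exp_law)"
proof -
  let ?S = "PiM UNIV (\<lambda>_::nat. exp_law)" and ?R = "PiM UNIV (\<lambda>_::nat. m)"
  interpret m: prob_space m by fact
  interpret S: prob_space ?S by (intro prob_space_PiM prob_space_exp_law)
  interpret R: prob_space ?R by (intro prob_space_PiM m)
  interpret SR: pair_sigma_finite ?S ?R by unfold_locales
  interpret Sm: pair_sigma_finite ?S m by unfold_locales
  have F[measurable]: "F \<in> borel_measurable (?S \<Otimes>\<^sub>M ?R)"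
    using assms(2) by (simp add: marked_space_def)
  have "(\<integral>\<^sup>+x. F x \<partial>marked_space m) = (\<integral>\<^sup>+\<tau>. \<integral>\<^sup>+\<theta>. F (\<tau>, \<theta>) \<partial>?R \<partial>?S)"
    unfolding marked_space_def by (rule R.nn_integral_fst[symmetric]) measurable
  also have "\<dots> = (\<integral>\<^sup>+t. \<integral>\<^sup>+\<tau>. \<integral>\<^sup>+\<theta>. F (case_nat t \<tau>, \<theta>) \<partial>?R \<partial>?S \<partial>exp_law)"
    by (subst nn_integral_sequence_split[OF prob_space_exp_law]) measurable
  also have "\<dots> = (\<integral>\<^sup>+t. \<integral>\<^sup>+\<tau>. \<integral>\<^sup>+a. \<integral>\<^sup>+\<theta>. F (case_nat t \<tau>, case_nat a \<theta>) \<partial>?R \<partial>m \<partial>?S \<partial>exp_law)"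
    by (intro nn_integral_cong nn_integral_sequence_split[OF m]) (measurable, simp_all add: space_PiM)
  also have "\<dots> = (\<integral>\<^sup>+t. \<integral>\<^sup>+a. \<integral>\<^sup>+\<tau>. \<integral>\<^sup>+\<theta>. F (case_nat t \<tau>, case_nat a \<theta>) \<partial>?R \<partial>?S \<partial>m \<partial>exp_law)"
    by (intro nn_integral_cong Sm.Fubini'[symmetric]) measurable
  also have "\<dots> = (\<integral>\<^sup>+t. \<integral>\<^sup>+a. \<integral>\<^sup>+x. F (case_nat t (fst x), case_nat a (snd x)) \<partial>marked_space m \<partial>m \<partial>exp_law)"
    unfolding marked_space_def
  proof (intro nn_integral_cong)
    fix t a assume [measurable]: "a \<in> space m"
    have "(\<lambda>x. F (case_nat t (fst x), case_nat a (snd x))) \<in> borel_measurable (?S \<Otimes>\<^sub>M ?R)"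
      by measurable
    from R.nn_integral_fst[OF this]
    show "(\<integral>\<^sup>+\<tau>. \<integral>\<^sup>+\<theta>. F (case_nat t \<tau>, case_nat a \<theta>) \<partial>?R \<partial>?S)
        = (\<integral>\<^sup>+x. F (case_nat t (fst x), case_nat a (snd x)) \<partial>(?S \<Otimes>\<^sub>M ?R))"
      by simp
  qed
  finally show ?thesis .
qed

text \<open>
  The partial products weighted with \<open>h\<close> at the last arrival time have constant expectation.
  Removing the first point \<open>(t, a)\<close> leaves the same expression started at \<open>s + t\<close>, so by induction
  the expectation is \<open>\<integral> exp (- t) w (s + t) h (s + t) dt\<close>, which equals \<open>h s\<close>. Suitable pairs
  \<open>(w, h)\<close> give the growth of the arrival times, the void probabilities and the bound on
  \<open>\<Prod>\<^sub>i (1 + f(\<Gamma>\<^sub>i))\<close>.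
\<close>

lemma marked_martingale:
  fixes h w :: "real \<Rightarrow> real" and \<phi> :: "real \<Rightarrow> 'a \<Rightarrow> ennreal"
  assumes m: "prob_space m"
    and \<phi>[measurable]: "(\<lambda>(u, a). \<phi> u a) \<in> borel_measurable (borel \<Otimes>\<^sub>M m)"
    and \<phi>w: "\<And>u. 0 \<le> u \<Longrightarrow> (\<integral>\<^sup>+a. \<phi> u a \<partial>m) = ennreal (w u)"
    and S: "finite S" and cont: "continuous_on {0..} h"
    and deriv: "\<And>u. 0 < u \<Longrightarrow> u \<notin> S \<Longrightarrow> (h has_real_derivative (1 - w u) * h u) (at u)"
    and hm[measurable]: "h \<in> borel_measurable borel" and wm[measurable]: "w \<in> borel_measurable borel"
    and w: "\<And>u. 0 \<le> u \<Longrightarrow> 0 \<le> w u" and h: "\<And>u. 0 \<le> u \<Longrightarrow> 0 \<le> h u" "\<And>u. 0 \<le> u \<Longrightarrow> h u \<le> K"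
    and s: "0 \<le> s"
  shows "(\<integral>\<^sup>+x. (\<Prod>i<n. \<phi> (s + arrival (Suc i) (fst x)) (snd x i)) * ennreal (h (s + arrival n (fst x)))
            \<partial>marked_space m) = ennreal (h s)"
  using s
proof (induction n arbitrary: s)
  case 0
  interpret prob_space "marked_space m" by (rule prob_space_marked_space[OF m])
  show ?case by (simp add: arrival_def emeasure_space_1)
next
  case (Suc n)
  define I where "I = (\<lambda>n s x. (\<Prod>i<n. \<phi> (s + arrival (Suc i) (fst x)) (snd x i)) * ennreal (h (s + arrival n (fst x))))"
  have [measurable]: "(\<lambda>x. arrival n (fst x)) \<in> borel_measurable (marked_space m)"
    "(\<lambda>x. snd x i) \<in> measurable (marked_space m) m" for n i
    by (simp_all add: marked_space_def)
  have I[measurable]: "I n s \<in> borel_measurable (marked_space m)" for n s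
    unfolding I_def by measurable
  interpret m: prob_space m by fact
  have "(\<integral>\<^sup>+x. I (Suc n) s x \<partial>marked_space m) =
    (\<integral>\<^sup>+t. \<integral>\<^sup>+a. \<integral>\<^sup>+x. I (Suc n) s (case_nat t (fst x), case_nat a (snd x)) \<partial>marked_space m \<partial>m \<partial>exp_law)"
    by (rule nn_integral_marked_split[OF m I])
  also have "\<dots> = (\<integral>\<^sup>+t. \<integral>\<^sup>+a. \<integral>\<^sup>+x. \<phi> (s + t) a * I n (s + t) x \<partial>marked_space m \<partial>m \<partial>exp_law)"
    unfolding I_def prod.lessThan_Suc_shift fst_conv snd_conv arrival_case_nat
    by (simp add: arrival_def mult.assoc add.assoc del: sum.lessThan_Suc)
  also have "\<dots> = (\<integral>\<^sup>+t. \<integral>\<^sup>+a. \<phi> (s + t) a * (\<integral>\<^sup>+x. I n (s + t) x \<partial>marked_space m) \<partial>m \<partial>exp_law)"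
    by (intro nn_integral_cong nn_integral_cmult) measurable
  also have "\<dots> = (\<integral>\<^sup>+t. ennreal (exponential_density 1 t) *
      (\<integral>\<^sup>+a. \<phi> (s + t) a * (\<integral>\<^sup>+x. I n (s + t) x \<partial>marked_space m) \<partial>m) \<partial>lborel)"
  proof -
    interpret Q: prob_space "marked_space m" by (rule prob_space_marked_space[OF m])
    have [measurable]: "(\<lambda>(t, x). I n (s + t) x) \<in> borel_measurable (borel \<Otimes>\<^sub>M marked_space m)"
      unfolding I_def by measurable
    have [measurable]: "(\<lambda>t. \<integral>\<^sup>+x. I n (s + t) x \<partial>marked_space m) \<in> borel_measurable borel"
      by (rule Q.borel_measurable_nn_integral) measurable
    have [measurable]: "(\<lambda>t. \<integral>\<^sup>+a. \<phi> (s + t) a * (\<integral>\<^sup>+x. I n (s + t) x \<partial>marked_space m) \<partial>m) \<in> borel_measurable borel"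
      by (rule m.borel_measurable_nn_integral) measurable
    show ?thesis
      unfolding exp_law_def by (rule nn_integral_density) measurable
  qed
  also have "\<dots> = (\<integral>\<^sup>+t. ennreal (exponential_density 1 t * (w (s + t) * h (s + t))) \<partial>lborel)"
  proof (rule nn_integral_cong)
    fix t :: real
    show "ennreal (exponential_density 1 t) * (\<integral>\<^sup>+a. \<phi> (s + t) a * (\<integral>\<^sup>+x. I n (s + t) x \<partial>marked_space m) \<partial>m)
      = ennreal (exponential_density 1 t * (w (s + t) * h (s + t)))"
    proof (cases "0 \<le> t")
      case True
      then have st: "0 \<le> s + t" using Suc by simp
      have "(\<integral>\<^sup>+a. \<phi> (s + t) a * (\<integral>\<^sup>+x. I n (s + t) x \<partial>marked_space m) \<partial>m)
        = (\<integral>\<^sup>+a. \<phi> (s + t) a * ennreal (h (s + t)) \<partial>m)"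
        using Suc.IH[OF st] by (simp add: I_def)
      also have "\<dots> = ennreal (w (s + t)) * ennreal (h (s + t))"
        using \<phi>w[OF st] by (subst nn_integral_multc) auto
      finally show ?thesis using w[OF st] h[OF st] by (simp add: ennreal_mult)
    qed (simp add: exponential_density_def)
  qed
  also have "\<dots> = ennreal (h s)"
    by (rule renewal_identity[OF S cont deriv hm wm w h]) (use Suc in auto)
  finally show ?case by (simp add: I_def)
qed

lemma measurable_marked[measurable]:
  "(\<lambda>x. arrival n (fst x)) \<in> borel_measurable (marked_space m)"
  "(\<lambda>x. snd x i) \<in> measurable (marked_space m) m"
  by (simp_all add: marked_space_def)

section \<open>Void probabilities\<close>

text \<open>
  This quantifies that the arrival times tend to infinity: by Markov's inequality the probability of
  \<open>\<Gamma>\<^sub>n < K\<close> is at most \<open>exp K / 2\<^sup>n\<close>.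
\<close>

lemma nn_integral_exp_minus_arrival:
  assumes m: "prob_space m"
  shows "(\<integral>\<^sup>+x. ennreal (exp (- arrival n (fst x))) \<partial>marked_space m) = ennreal ((1 / 2) ^ n)"
proof -
  interpret m: prob_space m by fact
  have "(\<integral>\<^sup>+x. (\<Prod>i<n. 2) * ennreal (exp (- (0 + arrival n (fst x)))) \<partial>marked_space m) = ennreal (exp (- 0))"
    by (rule marked_martingale[where \<phi>="\<lambda>_ _. 2" and w="\<lambda>_. 2" and S="{}" and K=1 and h="\<lambda>u. exp (- u)" and s=0])
       (auto intro!: continuous_intros derivative_eq_intros m simp: m.emeasure_space_1)
  then have *: "2 ^ n * (\<integral>\<^sup>+x. ennreal (exp (- arrival n (fst x))) \<partial>marked_space m) = 1"
    by (subst (asm) nn_integral_cmult) auto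
  have "ennreal ((1 / 2) ^ n) = ennreal ((1 / 2) ^ n) * (2 ^ n * (\<integral>\<^sup>+x. ennreal (exp (- arrival n (fst x))) \<partial>marked_space m))"
    unfolding * by simp
  also have "\<dots> = (ennreal ((1 / 2) ^ n) * ennreal (2 ^ n)) * (\<integral>\<^sup>+x. ennreal (exp (- arrival n (fst x))) \<partial>marked_space m)"
    by (simp add: mult.assoc ennreal_power[symmetric])
  also have "ennreal ((1 / 2) ^ n) * ennreal (2 ^ n) = 1"
    by (subst ennreal_mult[symmetric]) (simp_all add: power_mult_distrib[symmetric])
  finally show ?thesis by simp
qed

text \<open>
  Let \<open>E n\<close> be the event that the first \<open>n\<close> points avoid the region below the graph of \<open>g\<close>. With
  \<open>h u = exp (- \<integral>(g - u)\<^sup>+ dm)\<close> the martingale identity says that the integral of \<open>h(\<Gamma>\<^sub>n)\<close> over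
  \<open>E n\<close> is \<open>h 0\<close>. Since \<open>h \<le> 1\<close>, with equality beyond the maximum of \<open>g\<close>, the probability of
  \<open>E n\<close> lies between \<open>h 0\<close> and \<open>h 0\<close> plus the probability that \<open>\<Gamma>\<^sub>n\<close> has not passed this
  maximum.
\<close>

lemma void_probability_simple:
  fixes g :: "'a \<Rightarrow> real"
  assumes m: "prob_space m" and g: "simple_function m g" "\<And>a. 0 \<le> g a"
  shows "emeasure (marked_space m) {x \<in> space (marked_space m). \<forall>i. ennreal (g (snd x i)) \<le> ennreal (arrival (Suc i) (fst x))}
    = ennreal (exp (- enn2real (\<integral>\<^sup>+a. ennreal (g a) \<partial>m)))"
proof -
  interpret m: prob_space m by fact
  interpret Q: prob_space "marked_space m" by (rule prob_space_marked_space[OF m])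
  have [measurable]: "g \<in> borel_measurable m" using g(1) by (rule borel_measurable_simple_function)
  define R where "R = g ` space m"
  define pr where "pr y = measure m (g -` {y} \<inter> space m)" for y
  define h where "h u = exp (- (\<Sum>y\<in>R. pr y * max (y - u) 0))" for u
  define w where "w u = (\<Sum>y\<in>R. pr y * (if y \<le> u then 1 else 0))" for u
  define \<phi> :: "real \<Rightarrow> 'a \<Rightarrow> ennreal" where "\<phi> = (\<lambda>u a. if ennreal (g a) \<le> ennreal u then 1 else 0)"
  define E where "E n = {x \<in> space (marked_space m). \<forall>i<n. ennreal (g (snd x i)) \<le> ennreal (arrival (Suc i) (fst x))}" for n
  have fin: "finite R" using g(1) by (auto simp: R_def simple_function_def)
  have R0: "0 \<le> y" if "y \<in> R" for y using that g(2) by (auto simp: R_def)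
  have pr0: "0 \<le> pr y" for y by (simp add: pr_def)
  have sum_eq: "(\<integral>\<^sup>+a. ennreal (F (g a)) \<partial>m) = ennreal (\<Sum>y\<in>R. pr y * F y)" if F: "\<And>y. y \<in> R \<Longrightarrow> 0 \<le> F y" for F
  proof -
    have "ennreal (F (g a)) = (\<Sum>y\<in>R. ennreal (F y) * indicator (g -` {y} \<inter> space m) a)" if "a \<in> space m" for a
    proof -
      have "(\<Sum>y\<in>R. ennreal (F y) * indicator (g -` {y} \<inter> space m) a) = (\<Sum>y\<in>R. if y = g a then ennreal (F y) else 0)"
        using that by (intro sum.cong) (auto split: split_indicator)
      then show ?thesis using fin that by (simp add: R_def)
    qed
    then have "(\<integral>\<^sup>+a. ennreal (F (g a)) \<partial>m) = (\<integral>\<^sup>+a. (\<Sum>y\<in>R. ennreal (F y) * indicator (g -` {y} \<inter> space m) a) \<partial>m)"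
      by (intro nn_integral_cong)
    also have "\<dots> = (\<Sum>y\<in>R. ennreal (F y) * emeasure m (g -` {y} \<inter> space m))"
      by (subst nn_integral_sum) (auto simp: nn_integral_cmult_indicator)
    also have "\<dots> = (\<Sum>y\<in>R. ennreal (pr y * F y))"
      by (intro sum.cong) (auto simp: pr_def m.emeasure_eq_measure ennreal_mult F mult.commute)
    finally show ?thesis using pr0 F by (simp add: sum_ennreal)
  qed
  have int_g: "(\<integral>\<^sup>+a. ennreal (g a) \<partial>m) = ennreal (\<Sum>y\<in>R. pr y * y)"
    by (rule sum_eq) (rule R0)
  have \<phi>w: "(\<integral>\<^sup>+a. \<phi> u a \<partial>m) = ennreal (w u)" if "0 \<le> u" for u
  proof -
    have "(\<integral>\<^sup>+a. \<phi> u a \<partial>m) = (\<integral>\<^sup>+a. ennreal (if g a \<le> u then 1 else 0) \<partial>m)"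
      using that by (intro nn_integral_cong) (simp add: \<phi>_def)
    then show ?thesis using sum_eq[of "\<lambda>y. if y \<le> u then 1 else 0"] by (simp add: w_def)
  qed
  have sum1: "(\<Sum>y\<in>R. pr y) = 1"
    using sum_eq[of "\<lambda>_. 1"] pr0 by (simp add: m.emeasure_space_1 sum_nonneg)
  have A: "(\<integral>\<^sup>+x. (\<Prod>i<n. \<phi> (0 + arrival (Suc i) (fst x)) (snd x i)) * ennreal (h (0 + arrival n (fst x))) \<partial>marked_space m) = ennreal (h 0)" for n
  proof (rule marked_martingale[where w=w and S=R and K=1])
    show "(\<lambda>(u, a). \<phi> u a) \<in> borel_measurable (borel \<Otimes>\<^sub>M m)"
      unfolding \<phi>_def by measurable
    show "continuous_on {0..} h"
      unfolding h_def by (intro continuous_intros)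
    show "h \<in> borel_measurable borel" "w \<in> borel_measurable borel"
      unfolding h_def w_def by measurable
    show "(h has_real_derivative (1 - w u) * h u) (at u)" if "0 < u" "u \<notin> R" for u
    proof -
      have "((\<lambda>u. max (y - u) 0) has_real_derivative - (1 - (if y \<le> u then 1 else 0))) (at u)" if "y \<in> R" for y
      proof (cases "y < u")
        case True
        have "\<forall>\<^sub>F v in nhds u. y < v"
          using True eventually_nhds_in_open[of "{y<..}" u] by simp
        then have "\<forall>\<^sub>F v in nhds u. max (y - v) 0 = 0" by eventually_elim auto
        then show ?thesis using True by (subst DERIV_cong_ev[OF refl _ refl]) auto
      next
        case False
        then have "u < y" using that \<open>u \<notin> R\<close> by (metis linorder_neqE_linordered_idom)
        then have "\<forall>\<^sub>F v in nhds u. v < y"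
          using eventually_nhds_in_open[of "{..<y}" u] by simp
        then have "\<forall>\<^sub>F v in nhds u. max (y - v) 0 = y - v" by eventually_elim auto
        then show ?thesis using \<open>u < y\<close>
          by (subst DERIV_cong_ev[OF refl _ refl]) (auto intro!: derivative_eq_intros)
      qed
      then have "((\<lambda>u. - (\<Sum>y\<in>R. pr y * max (y - u) 0)) has_real_derivative
          - (\<Sum>y\<in>R. pr y * - (1 - (if y \<le> u then 1 else 0)))) (at u)"
        by (intro DERIV_minus DERIV_sum DERIV_cmult)
      moreover have "- (\<Sum>y\<in>R. pr y * - (1 - (if y \<le> u then 1 else 0))) = 1 - w u"
      proof -
        have "1 - w u = (\<Sum>y\<in>R. pr y - pr y * (if y \<le> u then 1 else 0))"
          unfolding sum_subtractf sum1 w_def ..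
        also have "\<dots> = (\<Sum>y\<in>R. - (pr y * - (1 - (if y \<le> u then 1 else 0))))"
          by (intro sum.cong) auto
        finally show ?thesis by (simp only: sum_negf)
      qed
      ultimately have "((\<lambda>u. - (\<Sum>y\<in>R. pr y * max (y - u) 0)) has_real_derivative 1 - w u) (at u)"
        by simp
      from DERIV_fun_exp[OF this] show ?thesis
        unfolding h_def by (simp add: mult.commute)
    qed
    show "0 \<le> w u" for u using pr0 by (auto simp: w_def intro!: sum_nonneg)
    show "0 \<le> h u" "h u \<le> 1" for u
      using pr0 by (auto simp: h_def intro!: sum_nonneg mult_nonneg_nonneg)
  qed (use m fin \<phi>w in auto)
  have [measurable]: "E n \<in> sets (marked_space m)" for n
    unfolding E_def by measurable
  have prodE: "(\<Prod>i<n. \<phi> (0 + arrival (Suc i) (fst x)) (snd x i)) = indicator (E n) x"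
    if "x \<in> space (marked_space m)" for n x
    using that by (auto simp: \<phi>_def E_def prod_zero_iff split: split_indicator)
  have h1: "h u \<le> 1" for u
    using pr0 by (auto simp: h_def intro!: sum_nonneg mult_nonneg_nonneg)
  have lower: "ennreal (h 0) \<le> emeasure (marked_space m) (E n)" for n
  proof -
    have "ennreal (h 0) \<le> (\<integral>\<^sup>+x. indicator (E n) x \<partial>marked_space m)"
      unfolding A[of n, symmetric]
    proof (rule nn_integral_mono)
      fix x assume x: "x \<in> space (marked_space m)"
      show "(\<Prod>i<n. \<phi> (0 + arrival (Suc i) (fst x)) (snd x i)) * ennreal (h (0 + arrival n (fst x))) \<le> indicator (E n) x"
        unfolding prodE[OF x] using h1 by (auto split: split_indicator)
    qed
    then show ?thesis by simp
  qed
  obtain K where K: "\<And>y. y \<in> R \<Longrightarrow> y \<le> K" 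
    using fin by (metis Max_ge)
  \<comment> \<open>If the last arrival time is below \<open>K\<close>, then \<open>exp K * exp (- \<Gamma>\<^sub>n) \<ge> 1\<close>.\<close>
  have upper: "emeasure (marked_space m) (E n) \<le> ennreal (h 0 + exp K * (1 / 2) ^ n)" for n
  proof -
    have hK: "h u = 1" if "K \<le> u" for u
    proof -
      have "max (y - u) 0 = 0" if "y \<in> R" for y using K[OF that] \<open>K \<le> u\<close> by simp
      then show ?thesis by (simp add: h_def)
    qed
    have "emeasure (marked_space m) (E n) = (\<integral>\<^sup>+x. indicator (E n) x \<partial>marked_space m)" by simp
    also have "\<dots> \<le> (\<integral>\<^sup>+x. indicator (E n) x * ennreal (h (0 + arrival n (fst x))) + ennreal (exp K) * ennreal (exp (- arrival n (fst x))) \<partial>marked_space m)"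
    proof (rule nn_integral_mono)
      fix x assume "x \<in> space (marked_space m)"
      show "indicator (E n) x \<le> indicator (E n) x * ennreal (h (0 + arrival n (fst x))) + ennreal (exp K) * ennreal (exp (- arrival n (fst x)))"
      proof (cases "K \<le> arrival n (fst x)")
        case False
        then have "1 \<le> ennreal (exp K * exp (- arrival n (fst x)))"
          by (simp add: exp_add[symmetric] ennreal_1[symmetric] del: ennreal_1)
        also have "\<dots> = ennreal (exp K) * ennreal (exp (- arrival n (fst x)))"
          by (simp add: ennreal_mult)
        finally have "1 \<le> indicator (E n) x * ennreal (h (0 + arrival n (fst x))) + ennreal (exp K) * ennreal (exp (- arrival n (fst x)))"
          by (rule add_increasing[OF zero_le])
        moreover have "indicator (E n) x \<le> (1 :: ennreal)" by (simp split: split_indicator)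
        ultimately show ?thesis by (rule order_trans[rotated])
      qed (simp add: hK)
    qed
    also have "\<dots> = (\<integral>\<^sup>+x. indicator (E n) x * ennreal (h (0 + arrival n (fst x))) \<partial>marked_space m) + ennreal (exp K) * ennreal ((1 / 2) ^ n)"
    proof (subst nn_integral_add)
      show "(\<lambda>x. indicator (E n) x * ennreal (h (0 + arrival n (fst x)))) \<in> borel_measurable (marked_space m)"
        unfolding h_def by measurable
      show "(\<lambda>x. ennreal (exp K) * ennreal (exp (- arrival n (fst x)))) \<in> borel_measurable (marked_space m)"
        by measurable
    qed (simp add: nn_integral_cmult nn_integral_exp_minus_arrival[OF m])
    also have "(\<integral>\<^sup>+x. indicator (E n) x * ennreal (h (0 + arrival n (fst x))) \<partial>marked_space m) = ennreal (h 0)"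
      unfolding A[of n, symmetric] by (intro nn_integral_cong) (simp add: prodE[symmetric])
    also have "ennreal (h 0) + ennreal (exp K) * ennreal ((1 / 2) ^ n) = ennreal (h 0 + exp K * (1 / 2) ^ n)"
      by (simp add: ennreal_plus ennreal_mult h_def)
    finally show ?thesis .
  qed
  have "(\<lambda>n. emeasure (marked_space m) (E n)) \<longlonglongrightarrow> emeasure (marked_space m) (\<Inter>n. E n)"
    by (rule Lim_emeasure_decseq) (auto simp: decseq_def E_def)
  moreover have "(\<lambda>n. emeasure (marked_space m) (E n)) \<longlonglongrightarrow> ennreal (h 0)"
  proof (rule tendsto_sandwich[where f="\<lambda>_. ennreal (h 0)" and h="\<lambda>n. ennreal (h 0 + exp K * (1 / 2) ^ n)"])
    show "(\<lambda>n. ennreal (h 0 + exp K * (1 / 2) ^ n)) \<longlonglongrightarrow> ennreal (h 0)"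
    proof (rule tendsto_ennrealI)
      have "(\<lambda>n. h 0 + exp K * (1 / 2) ^ n) \<longlonglongrightarrow> h 0 + exp K * 0"
        by (intro tendsto_intros LIMSEQ_power_zero) auto
      then show "(\<lambda>n. h 0 + exp K * (1 / 2) ^ n) \<longlonglongrightarrow> h 0" by simp
    qed
  qed (auto simp: lower upper)
  ultimately have "emeasure (marked_space m) (\<Inter>n. E n) = ennreal (h 0)"
    by (rule LIMSEQ_unique)
  moreover have "(\<Inter>n. E n) = {x \<in> space (marked_space m). \<forall>i. ennreal (g (snd x i)) \<le> ennreal (arrival (Suc i) (fst x))}"
    by (auto simp: E_def)
  moreover have "h 0 = exp (- enn2real (\<integral>\<^sup>+a. ennreal (g a) \<partial>m))"
  proof -
    have "(\<Sum>y\<in>R. pr y * max (y - 0) 0) = (\<Sum>y\<in>R. pr y * y)"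
      using R0 by (intro sum.cong) auto
    then show ?thesis
      using pr0 R0 unfolding int_g h_def by (subst enn2real_ennreal) (auto intro!: sum_nonneg)
  qed
  ultimately show ?thesis by simp
qed

text \<open>
  Simple functions that increase to \<open>g\<close> turn the event into a decreasing intersection.
\<close>

lemma void_probability:
  fixes g :: "'a \<Rightarrow> ennreal"
  assumes m: "prob_space m" and [measurable]: "g \<in> borel_measurable m" and fin: "(\<integral>\<^sup>+a. g a \<partial>m) < \<infinity>"
  shows "emeasure (marked_space m) {x \<in> space (marked_space m). \<forall>i. g (snd x i) \<le> ennreal (arrival (Suc i) (fst x))}
    = ennreal (exp (- enn2real (\<integral>\<^sup>+a. g a \<partial>m)))"
proof -
  interpret Q: prob_space "marked_space m" by (rule prob_space_marked_space[OF m])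
  obtain f where f: "\<And>i. simple_function m (f i)" "incseq f" "\<And>i x. f i x < top" "\<And>x. (SUP i. f i x) = g x"
    using borel_measurable_implies_simple_function_sequence'[of g m] by auto
  have [measurable]: "f n \<in> borel_measurable m" for n
    using f(1) by (rule borel_measurable_simple_function)
  define E where "E n = {x \<in> space (marked_space m). \<forall>i. f n (snd x i) \<le> ennreal (arrival (Suc i) (fst x))}" for n
  have [measurable]: "E n \<in> sets (marked_space m)" for n
    unfolding E_def by measurable
  have E: "emeasure (marked_space m) (E n) = ennreal (exp (- enn2real (\<integral>\<^sup>+a. f n a \<partial>m)))" for n
  proof -
    have "f n = (\<lambda>a. ennreal (enn2real (f n a)))" using f(3) by (auto simp: less_top)
    moreover have "simple_function m (\<lambda>a. enn2real (f n a))"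
      using simple_function_compose1[OF f(1), of enn2real] by simp
    ultimately show ?thesis
      using void_probability_simple[OF m, of "\<lambda>a. enn2real (f n a)"] f(3) by (simp add: E_def)
  qed
  have "(\<lambda>n. emeasure (marked_space m) (E n)) \<longlonglongrightarrow> emeasure (marked_space m) (\<Inter>n. E n)"
  proof (rule Lim_emeasure_decseq)
    show "decseq E"
      unfolding decseq_def
    proof (intro allI impI)
      fix i j :: nat assume "i \<le> j"
      then have "f i a \<le> f j a" for a using f(2) by (simp add: incseq_def le_fun_def)
      then show "E j \<subseteq> E i" unfolding E_def using order_trans by blast
    qed
  qed auto
  moreover have "(\<lambda>n. emeasure (marked_space m) (E n)) \<longlonglongrightarrow> ennreal (exp (- enn2real (\<integral>\<^sup>+a. g a \<partial>m)))"
    unfolding E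
  proof (intro tendsto_ennrealI tendsto_exp tendsto_minus tendsto_enn2real)
    have "(\<lambda>n. \<integral>\<^sup>+a. f n a \<partial>m) \<longlonglongrightarrow> (\<integral>\<^sup>+a. g a \<partial>m)"
    proof (rule nn_integral_LIMSEQ[OF f(2)])
      show "(\<lambda>n. f n a) \<longlonglongrightarrow> g a" for a
        unfolding f(4)[symmetric] using f(2) by (intro LIMSEQ_SUP) (auto simp: incseq_def le_fun_def)
    qed measurable
    then show "(\<lambda>n. \<integral>\<^sup>+a. f n a \<partial>m) \<longlonglongrightarrow> ennreal (enn2real (\<integral>\<^sup>+a. g a \<partial>m))"
      using fin by simp
  qed simp
  ultimately have "emeasure (marked_space m) (\<Inter>n. E n) = ennreal (exp (- enn2real (\<integral>\<^sup>+a. g a \<partial>m)))"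
    by (rule LIMSEQ_unique)
  moreover have "(\<Inter>n. E n) = {x \<in> space (marked_space m). \<forall>i. g (snd x i) \<le> ennreal (arrival (Suc i) (fst x))}"
    by (auto simp: E_def f(4)[symmetric] SUP_le_iff)
  ultimately show ?thesis by simp
qed

section \<open>The moment bound for constant density\<close>

text \<open>
  For \<open>p < 1 < q\<close> this function is integrable on \<open>(0, \<infinity>)\<close>: it is \<open>u\<^sup>-\<^sup>p\<close> up to 1 and
  \<open>u\<^sup>-\<^sup>q\<close> from 1 on.
\<close>

definition profile :: "real \<Rightarrow> real \<Rightarrow> real \<Rightarrow> real" where
  "profile p q u = min (u powr (- p)) (u powr (- q))"

lemma profile_nonneg: "0 \<le> profile p q u"
  by (simp add: profile_def)

lemma measurable_profile[measurable]: "profile p q \<in> borel_measurable borel"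
  unfolding profile_def[abs_def] by measurable

text \<open>
  The martingale identity with \<open>h u = exp (\<integral>\<^sub>u\<^sup>\<infinity> f) \<ge> 1\<close>, where \<open>f\<close> is the profile. In the proof
  \<open>H\<close> is this integral in closed form, and the exponent in the bound is \<open>\<integral>\<^sub>0\<^sup>\<infinity> f\<close>.
\<close>

lemma expectation_profile_product:
  assumes m: "prob_space m" and p: "0 < p" "p < 1" and q: "1 < q"
  shows "(\<integral>\<^sup>+x. (\<Prod>i<n. 1 + ennreal (profile p q (arrival (Suc i) (fst x)))) \<partial>marked_space m)
    \<le> ennreal (exp (1 / (1 - p) + 1 / (q - 1)))"
proof -
  interpret m: prob_space m by fact
  define H where "H u = (if u \<le> 1 then (1 - u powr (1 - p)) / (1 - p) + 1 / (q - 1) else u powr (1 - q) / (q - 1))" for u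
  have H0: "0 \<le> H u" if "0 \<le> u" for u
    using that p q powr_mono2[of "1 - p" u 1] by (auto simp: H_def)
  have H1: "H u \<le> H 0" if "0 \<le> u" for u
  proof (cases "u \<le> 1")
    case True
    have "(1 - u powr (1 - p)) / (1 - p) \<le> (1 - 0 powr (1 - p)) / (1 - p)"
      using p by (intro divide_right_mono) auto
    then show ?thesis using True by (simp add: H_def)
  next
    case False
    then have "u powr (1 - q) \<le> 1" using q powr_mono[of "1 - q" 0 u] by simp
    then have "H u \<le> 1 / (q - 1)" using False q by (simp add: H_def divide_right_mono)
    also have "\<dots> \<le> H 0" using p by (simp add: H_def)
    finally show ?thesis .
  qed
  have [measurable]: "H \<in> borel_measurable borel" unfolding H_def[abs_def] by measurable
  have "(\<integral>\<^sup>+x. (\<Prod>i<n. 1 + ennreal (profile p q (arrival (Suc i) (fst x)))) \<partial>marked_space m)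
    \<le> (\<integral>\<^sup>+x. (\<Prod>i<n. 1 + ennreal (profile p q (0 + arrival (Suc i) (fst x)))) * ennreal (exp (H (max 0 (0 + arrival n (fst x))))) \<partial>marked_space m)"
  proof (rule nn_integral_mono)
    fix x
    have "1 \<le> ennreal (exp (H (max 0 (0 + arrival n (fst x)))))"
      using H0 by (simp add: ennreal_1[symmetric] del: ennreal_1)
    from mult_left_mono[OF this zero_le]
    show "(\<Prod>i<n. 1 + ennreal (profile p q (arrival (Suc i) (fst x)))) \<le>
      (\<Prod>i<n. 1 + ennreal (profile p q (0 + arrival (Suc i) (fst x)))) * ennreal (exp (H (max 0 (0 + arrival n (fst x)))))"
      by simp
  qed
  also have "\<dots> = ennreal (exp (H (max 0 0)))"
  proof (rule marked_martingale[where \<phi>="\<lambda>u _. 1 + ennreal (profile p q u)" and w="\<lambda>u. 1 + profile p q u" and S="{1}"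
        and K="exp (H 0)" and h="\<lambda>u. exp (H (max 0 u))" and s=0])
    show "(\<integral>\<^sup>+a. 1 + ennreal (profile p q u) \<partial>m) = ennreal (1 + profile p q u)" for u
      by (simp add: m.emeasure_space_1 profile_nonneg)
    show "continuous_on {0..} (\<lambda>u. exp (H (max 0 u)))"
    proof (intro continuous_on_exp)
      have "continuous_on ({0..1} \<union> {1..}) (\<lambda>u. if u \<le> 1 then (1 - u powr (1 - p)) / (1 - p) + 1 / (q - 1) else u powr (1 - q) / (q - 1))"
        using p q by (intro continuous_on_If continuous_intros continuous_on_powr') auto
      moreover have "{0..1} \<union> {1..} = {0::real..}" by auto
      ultimately have "continuous_on {0..} H" by (simp add: H_def[abs_def])
      then show "continuous_on {0..} (\<lambda>u. H (max 0 u))"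
        by (rule continuous_on_compose2) (auto intro!: continuous_intros)
    qed
    show "((\<lambda>u. exp (H (max 0 u))) has_real_derivative (1 - (1 + profile p q u)) * exp (H (max 0 u))) (at u)"
      if "0 < u" "u \<notin> {1}" for u
    proof -
      have "(H has_real_derivative - profile p q u) (at u)"
      proof (cases "u < 1")
        case True
        have ev: "\<forall>\<^sub>F v in nhds u. H v = (1 - v powr (1 - p)) / (1 - p) + 1 / (q - 1)"
          using eventually_nhds_in_open[of "{0<..<1}" u] True that
          by (auto simp: H_def elim!: eventually_mono)
        have "profile p q u = u powr (- p)"
          using True that p q powr_mono'[of p q u] by (simp add: profile_def powr_mono' min_def)
        then show ?thesis using that p q
          by (subst DERIV_cong_ev[OF refl ev refl]) (auto intro!: derivative_eq_intros)
      next
        case False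
        then have u: "1 < u" using that by auto
        have ev: "\<forall>\<^sub>F v in nhds u. H v = v powr (1 - q) / (q - 1)"
          using eventually_nhds_in_open[of "{1<..}" u] u
          by (auto simp: H_def elim!: eventually_mono)
        have "profile p q u = u powr (- q)"
          using u p q powr_mono[of "-q" "-p" u] by (simp add: profile_def min_def)
        show ?thesis
        proof (subst DERIV_cong_ev[OF refl ev refl])
          have "((\<lambda>v. v powr (1 - q) / (q - 1)) has_real_derivative (1 - q) * u powr (1 - q - 1) / (q - 1)) (at u)"
            using that by (intro DERIV_cdivide has_real_derivative_powr) auto
          also have "(1 - q) * u powr (1 - q - 1) / (q - 1) = - profile p q u"
            using q unfolding \<open>profile p q u = u powr (- q)\<close> by (simp add: divide_simps) (simp add: algebra_simps)
          finally show "((\<lambda>v. v powr (1 - q) / (q - 1)) has_real_derivative - profile p q u) (at u)" .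
        qed
      qed
      from DERIV_fun_exp[OF this] have "((\<lambda>u. exp (H u)) has_real_derivative exp (H u) * - profile p q u) (at u)" .
      moreover have "\<forall>\<^sub>F v in nhds u. exp (H (max 0 v)) = exp (H v)"
        using eventually_nhds_in_open[of "{0<..}" u] that by (auto elim!: eventually_mono)
      ultimately show ?thesis using that by (subst DERIV_cong_ev[OF refl _ refl]) (auto simp: mult.commute)
    qed
  qed (use m H0 H1 profile_nonneg in \<open>auto simp: add_nonneg_nonneg\<close>)
  also have "H (max 0 0) = 1 / (1 - p) + 1 / (q - 1)"
    using p by (simp add: H_def)
  finally show ?thesis .
qed

definition distinct_below :: "nat \<Rightarrow> nat \<Rightarrow> (nat \<Rightarrow> nat) set" where
  "distinct_below k N = {j \<in> {..<k} \<rightarrow>\<^sub>E {..<N}. inj_on j {..<k}}"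

lemma finite_distinct_below: "finite (distinct_below k N)"
  unfolding distinct_below_def by (rule finite_subset[OF _ finite_PiE[of "{..<k}" "\<lambda>_. {..<N}"]]) auto

text \<open>
  Tuples with the same range \<open>J\<close> contribute the same product, at most \<open>k\<^sup>k\<close> tuples have range \<open>J\<close>,
  and the sum of \<open>\<Prod>\<^sub>i\<^sub>\<in>\<^sub>J u\<^sub>i\<close> over all \<open>J\<close> is \<open>\<Prod>\<^sub>i (1 + u\<^sub>i)\<close>.
\<close>

lemma sum_distinct_le:
  fixes u :: "nat \<Rightarrow> ennreal"
  shows "(\<Sum>j\<in>distinct_below k N. \<Prod>r<k. u (j r)) \<le> of_nat (k ^ k) * (\<Prod>i<N. 1 + u i)"
proof -
  let ?D = "distinct_below k N"
  let ?img = "\<lambda>j. j ` {..<k}"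
  have "(\<Sum>j\<in>?D. \<Prod>r<k. u (j r)) = (\<Sum>j\<in>?D. \<Prod>i\<in>?img j. u i)"
    by (intro sum.cong) (auto simp: distinct_below_def prod.reindex)
  also have "\<dots> = (\<Sum>J\<in>?img ` ?D. \<Sum>j\<in>{j\<in>?D. ?img j = J}. \<Prod>i\<in>?img j. u i)"
    by (rule sum.image_gen) (rule finite_distinct_below)
  also have "\<dots> = (\<Sum>J\<in>?img ` ?D. of_nat (card {j\<in>?D. ?img j = J}) * (\<Prod>i\<in>J. u i))"
  proof (rule sum.cong[OF refl])
    fix J
    have "(\<Sum>j\<in>{j\<in>?D. ?img j = J}. \<Prod>i\<in>?img j. u i) = (\<Sum>j\<in>{j\<in>?D. ?img j = J}. \<Prod>i\<in>J. u i)"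
      by (rule sum.cong) simp_all
    then show "(\<Sum>j\<in>{j\<in>?D. ?img j = J}. \<Prod>i\<in>?img j. u i) = of_nat (card {j\<in>?D. ?img j = J}) * (\<Prod>i\<in>J. u i)"
      by (simp only: sum_constant)
  qed
  also have "\<dots> \<le> (\<Sum>J\<in>?img ` ?D. of_nat (k ^ k) * (\<Prod>i\<in>J. u i))"
  proof (intro sum_mono mult_right_mono)
    fix J assume "J \<in> ?img ` ?D"
    then obtain j where "j \<in> ?D" "J = ?img j" by blast
    then have J: "finite J" "card J = k"
      by (simp_all add: distinct_below_def card_image)
    have "{j\<in>?D. ?img j = J} \<subseteq> {..<k} \<rightarrow>\<^sub>E J"
    proof
      fix j assume "j \<in> {j\<in>?D. ?img j = J}"
      then show "j \<in> {..<k} \<rightarrow>\<^sub>E J" by (force simp: distinct_below_def PiE_iff)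
    qed
    then have "card {j\<in>?D. ?img j = J} \<le> card ({..<k} \<rightarrow>\<^sub>E J)"
      by (rule card_mono[rotated]) (simp add: finite_PiE J)
    also have "\<dots> = k ^ k" using J by (simp add: card_funcsetE)
    finally show "(of_nat (card {j\<in>?D. ?img j = J}) :: ennreal) \<le> of_nat (k ^ k)"
      by (rule of_nat_mono)
  qed simp
  also have "\<dots> \<le> (\<Sum>J\<in>Pow {..<N}. of_nat (k ^ k) * (\<Prod>i\<in>J. u i))"
  proof (rule sum_mono2)
    show "?img ` ?D \<subseteq> Pow {..<N}" by (force simp: distinct_below_def PiE_iff)
  qed simp_all
  also have "\<dots> = of_nat (k ^ k) * (\<Sum>J\<in>Pow {..<N}. (\<Prod>i\<in>J. u i))"
    by (simp add: sum_distrib_left)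
  also have "(\<Sum>J\<in>Pow {..<N}. (\<Prod>i\<in>J. u i)) = (\<Prod>i<N. u i + 1)"
    by (subst prod_add) auto
  finally show ?thesis by (simp add: add.commute)
qed

text \<open>
  Linearising the power costs no more than a term that is independent of \<open>u\<close>; the threshold \<open>t\<close> is
  chosen at the end, in the moment bound.
\<close>

lemma young_split:
  fixes t u s :: real
  assumes "0 < t" "0 \<le> u" "0 < s" "s < 1"
  shows "u powr s \<le> t powr s + t powr (s - 1) * u"
proof (cases "u \<le> t")
  case True
  then have "u powr s \<le> t powr s" using assms by (intro powr_mono2) auto
  then show ?thesis using assms by (simp add: add_increasing2)
next
  case False
  then have "u powr s = u powr (s - 1) * u" using assms by (simp add: powr_diff)
  also have "\<dots> \<le> t powr (s - 1) * u"
    using False assms by (intro mult_right_mono powr_mono2') auto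
  finally show ?thesis by (simp add: add_increasing)
qed

text \<open>
  Let \<open>I\<close> be the set of positions with \<open>G (j r) \<le> 1\<close>. There \<open>G\<^sup>-\<^sup>p\<close> is the profile; at the other
  positions it is the power \<open>s\<close> of the profile, and \<open>young_split\<close> applies to the product over
  them. In the first resulting term the profiles over \<open>I\<close> are bounded by the full product.
\<close>

lemma product_powr_split:
  fixes G :: "nat \<Rightarrow> real" and j :: "nat \<Rightarrow> nat"
  assumes G: "\<And>i. 0 < G i" and j: "inj_on j {..<k}" "\<And>r. r < k \<Longrightarrow> j r < N"
    and t: "0 < t" and q: "1 < q" and s: "0 < s" "s < 1" and p: "p = q * s" 
  shows "(\<Prod>r<k. G (j r) powr (- p)) \<le> t powr s * (\<Prod>i<N. 1 + profile p q (G i))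
     + t powr (s - 1) * (\<Prod>r<k. profile p q (G (j r)))"
proof -
  define I where "I = {r \<in> {..<k}. G (j r) \<le> 1}"
  define J where "J = {..<k} - I"
  have IJ: "finite I" "finite J" "I \<inter> J = {}" "{..<k} = I \<union> J" "I \<subseteq> {..<k}" "J \<subseteq> {..<k}"
    by (auto simp: I_def J_def)
  have pq: "p < q" "0 < p" using p q s by auto
  have fI: "profile p q (G (j r)) = G (j r) powr (- p)" if "r \<in> I" for r
    using that G[of "j r"] pq by (auto simp: I_def profile_def min_def intro!: antisym powr_mono')
  have fJ: "profile p q (G (j r)) = G (j r) powr (- q)" if "r \<in> J" for r
    using that G[of "j r"] pq powr_mono[of "-q" "-p" "G (j r)"] by (auto simp: I_def J_def profile_def min_def)
  have "(\<Prod>r\<in>J. G (j r) powr (- p)) = (\<Prod>r\<in>J. profile p q (G (j r)) powr s)"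
    by (intro prod.cong) (auto simp: fJ[unfolded p] p powr_powr)
  also have "\<dots> = (\<Prod>r\<in>J. profile p q (G (j r))) powr s"
    by (simp add: prod_powr_distrib profile_nonneg)
  also have "\<dots> \<le> t powr s + t powr (s - 1) * (\<Prod>r\<in>J. profile p q (G (j r)))"
    using t s by (intro young_split prod_nonneg) (auto simp: profile_nonneg)
  finally have J: "(\<Prod>r\<in>J. G (j r) powr (- p)) \<le> t powr s + t powr (s - 1) * (\<Prod>r\<in>J. profile p q (G (j r)))" .
  have "(\<Prod>r<k. G (j r) powr (- p)) = (\<Prod>r\<in>I. profile p q (G (j r))) * (\<Prod>r\<in>J. G (j r) powr (- p))"
    unfolding IJ(4) using IJ by (simp add: prod.union_disjoint fI)
  also have "\<dots> \<le> (\<Prod>r\<in>I. profile p q (G (j r))) * (t powr s + t powr (s - 1) * (\<Prod>r\<in>J. profile p q (G (j r))))"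
    by (intro mult_left_mono J prod_nonneg) (auto simp: profile_nonneg)
  also have "\<dots> = t powr s * (\<Prod>r\<in>I. profile p q (G (j r))) + t powr (s - 1) * (\<Prod>r<k. profile p q (G (j r)))"
    unfolding IJ(4) using IJ by (simp add: prod.union_disjoint algebra_simps)
  also have "(\<Prod>r\<in>I. profile p q (G (j r))) = (\<Prod>i\<in>j ` I. profile p q (G i))"
    using inj_on_subset[OF j(1) IJ(5)] by (simp add: prod.reindex)
  also have "\<dots> \<le> (\<Prod>i\<in>j ` I. 1 + profile p q (G i))"
    by (intro prod_mono) (auto simp: profile_nonneg)
  also have "\<dots> \<le> (\<Prod>i<N. 1 + profile p q (G i))"
    using j IJ by (intro prod_mono2) (auto simp: profile_nonneg)
  finally show ?thesis using t by (simp add: mult_left_mono)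
qed

lemma AE_arrival_pos:
  assumes m: "prob_space m"
  shows "AE x in marked_space m. \<forall>i. 0 < arrival (Suc i) (fst x)"
proof -
  let ?S = "PiM UNIV (\<lambda>_::nat. exp_law)" and ?R = "PiM UNIV (\<lambda>_::nat. m)"
  interpret S: prob_space ?S by (intro prob_space_PiM prob_space_exp_law)
  interpret R: prob_space ?R by (intro prob_space_PiM m)
  interpret SR: pair_sigma_finite ?S ?R by unfold_locales
  have "AE t in exp_law. 0 < t"
  proof -
    have "AE t in lborel. t \<noteq> (0::real)" by (rule AE_lborel_singleton)
    then show ?thesis
      unfolding exp_law_def by (subst AE_density) (auto simp: exponential_density_def elim!: eventually_mono)
  qed
  then have "AE \<tau> in ?S. 0 < \<tau> i" for i
    using AE_PiM_component[of UNIV "\<lambda>_. exp_law" i "\<lambda>t. 0 < t"] prob_space_exp_law by simp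
  then have "AE \<tau> in ?S. \<forall>i. 0 < \<tau> i" by (simp add: AE_all_countable)
  then have "AE \<tau> in ?S. \<forall>i. 0 < arrival (Suc i) \<tau>"
    by eventually_elim (auto simp: arrival_def intro!: sum_pos simp del: sum.lessThan_Suc)
  then have "AE \<tau> in ?S. AE \<theta> in ?R. \<forall>i. 0 < arrival (Suc i) (fst (\<tau>, \<theta>))"
    by eventually_elim simp
  then show ?thesis
    unfolding marked_space_def by (intro SR.AE_pair_measure) measurable
qed

text \<open>
  Marks at distinct indices are independent of each other and of the arrival times.
\<close>

lemma nn_integral_marked_times_indicator:
  assumes m: "prob_space m" and [measurable]: "F \<in> borel_measurable (PiM UNIV (\<lambda>_. exp_law))"
    and A[measurable]: "A \<in> sets (prod_measure m k)" and j: "inj_on j {..<k}"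
  shows "(\<integral>\<^sup>+x. F (fst x) * indicator A (\<lambda>r\<in>{..<k}. snd x (j r)) \<partial>marked_space m)
    = (\<integral>\<^sup>+x. F (fst x) \<partial>marked_space m) * emeasure (prod_measure m k) A"
proof -
  let ?S = "PiM UNIV (\<lambda>_::nat. exp_law)" and ?R = "PiM UNIV (\<lambda>_::nat. m)"
  interpret S: prob_space ?S by (intro prob_space_PiM prob_space_exp_law)
  interpret R: prob_space ?R by (intro prob_space_PiM m)
  have law: "distr ?R (prod_measure m k) (\<lambda>\<theta>. \<lambda>r\<in>{..<k}. \<theta> (j r)) = prod_measure m k"
    using distr_PiM_reindex[of UNIV "\<lambda>_. m" j "{..<k}"] m j by simp
  have [measurable]: "(\<lambda>\<theta>. \<lambda>r\<in>{..<k}. \<theta> (j r)) \<in> measurable ?R (prod_measure m k)"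
    by measurable
  have 1: "(\<integral>\<^sup>+\<theta>. indicator A (\<lambda>r\<in>{..<k}. \<theta> (j r)) \<partial>?R) = emeasure (prod_measure m k) A"
  proof -
    have "(\<integral>\<^sup>+\<theta>. indicator A (\<lambda>r\<in>{..<k}. \<theta> (j r)) \<partial>?R)
      = (\<integral>\<^sup>+y. indicator A y \<partial>distr ?R (prod_measure m k) (\<lambda>\<theta>. \<lambda>r\<in>{..<k}. \<theta> (j r)))"
      by (rule nn_integral_distr[symmetric]) measurable
    then show ?thesis unfolding law by simp
  qed
  have "(\<integral>\<^sup>+x. F (fst x) * indicator A (\<lambda>r\<in>{..<k}. snd x (j r)) \<partial>marked_space m)
    = (\<integral>\<^sup>+\<tau>. \<integral>\<^sup>+\<theta>. F \<tau> * indicator A (\<lambda>r\<in>{..<k}. \<theta> (j r)) \<partial>?R \<partial>?S)"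
    unfolding marked_space_def
    using R.nn_integral_fst[of "\<lambda>x. F (fst x) * indicator A (\<lambda>r\<in>{..<k}. snd x (j r))" ?S] by simp
  also have "\<dots> = (\<integral>\<^sup>+\<tau>. F \<tau> \<partial>?S) * emeasure (prod_measure m k) A"
    by (simp add: nn_integral_cmult 1 nn_integral_multc)
  also have "(\<integral>\<^sup>+\<tau>. F \<tau> \<partial>?S) = (\<integral>\<^sup>+\<tau>. \<integral>\<^sup>+\<theta>. F \<tau> \<partial>?R \<partial>?S)"
    by (simp add: R.emeasure_space_1)
  also have "\<dots> = (\<integral>\<^sup>+x. F (fst x) \<partial>marked_space m)"
    unfolding marked_space_def
    using R.nn_integral_fst[of "\<lambda>x. F (fst x)" ?S] by simp
  finally show ?thesis .
qed

abbreviation canonical_series :: "real \<Rightarrow> ennreal \<Rightarrow> nat \<Rightarrow> (nat \<Rightarrow> 'a) set \<Rightarrow> (nat \<Rightarrow> real) \<times> (nat \<Rightarrow> 'a) \<Rightarrow> ennreal" where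
  "canonical_series \<alpha> b \<equiv> series_rep \<alpha> (\<lambda>_. b) (\<lambda>i x. arrival (Suc i) (fst x)) (\<lambda>i x. snd x i)"

text \<open>
  With \<open>\<psi> = b\<close> the power \<open>\<gamma>\<close> of a term of the series is
  \<open>b\<^sup>k\<^sup>p \<Prod>\<^sub>r \<Gamma>\<^sub>j\<^sub>r\<^sup>-\<^sup>p 1\<^sub>A\<close>. By \<open>product_powr_split\<close> it is at most \<open>W N\<close> as soon as \<open>N\<close> exceeds all
  entries of \<open>j\<close>, and the expectation of \<open>W N\<close> is bounded uniformly in \<open>N\<close>. The hypothesis on \<open>t\<close>
  merges the two terms.
\<close>

lemma canonical_series_moment_aux:
  assumes m: "prob_space m" and b: "0 < b" and \<gamma>: "0 < \<gamma>" "\<gamma> < \<alpha>" and r: "\<alpha> < r"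
    and A[measurable]: "A \<in> sets (prod_measure m k)"
    and t: "0 < t" "measure (prod_measure m k) A \<le> t"
  shows "(\<integral>\<^sup>+x. epowr (canonical_series \<alpha> (ennreal b) k A x) \<gamma> \<partial>marked_space m)
    \<le> ennreal (b powr (real k * (\<gamma> / \<alpha>)) * exp (1 / (1 - \<gamma> / \<alpha>) + 1 / (r / \<alpha> - 1)) * (1 + real (k ^ k)) * t powr (\<gamma> / r))"
proof -
  define p where "p = \<gamma> / \<alpha>"
  define q where "q = r / \<alpha>"
  define s where "s = \<gamma> / r"
  have \<alpha>: "0 < \<alpha>" using \<gamma> by simp
  have p: "0 < p" "p < 1" and q: "1 < q" and s: "0 < s" "s < 1" and pqs: "p = q * s"
    using \<gamma> r \<alpha> by (auto simp: p_def q_def s_def)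
  define C where "C = exp (1 / (1 - p) + 1 / (q - 1))"
  interpret Q: prob_space "marked_space m" by (rule prob_space_marked_space[OF m])
  interpret mk: prob_space "prod_measure m k" by (intro prob_space_PiM m)
  let ?G = "\<lambda>i x. arrival (Suc i) (fst x)"
  let ?T = "\<lambda>j x. (\<lambda>r\<in>{..<k}. snd x (j r))"
  let ?f = "\<lambda>i x. ennreal (profile p q (?G i x))"
  define Z where "Z N x = (\<Prod>i<N. 1 + ?f i x)" for N and x :: "(nat \<Rightarrow> real) \<times> (nat \<Rightarrow> 'a)"
  define V where "V N x = (\<Sum>j\<in>distinct_below k N. (\<Prod>r<k. ?f (j r) x) * indicator A (?T j x))" for N and x :: "(nat \<Rightarrow> real) \<times> (nat \<Rightarrow> 'a)"
  define W where "W N x = ennreal (b powr (real k * p)) * (ennreal (t powr s) * Z N x + ennreal (t powr (s - 1)) * V N x)" for N and x :: "(nat \<Rightarrow> real) \<times> (nat \<Rightarrow> 'a)"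
  have [measurable]: "?T j \<in> measurable (marked_space m) (prod_measure m k)" for j
    by measurable
  have [measurable]: "Z N \<in> borel_measurable (marked_space m)" "V N \<in> borel_measurable (marked_space m)" for N
    unfolding Z_def V_def by measurable
  have [measurable]: "W N \<in> borel_measurable (marked_space m)" for N
    unfolding W_def by measurable
  have EZ: "(\<integral>\<^sup>+x. Z N x \<partial>marked_space m) \<le> ennreal C" for N
    unfolding Z_def C_def by (rule expectation_profile_product[OF m p q])
  have EV: "(\<integral>\<^sup>+x. V N x \<partial>marked_space m) \<le> ennreal (real (k ^ k) * C * t)" for N
  proof -
    have "(\<integral>\<^sup>+x. V N x \<partial>marked_space m) = (\<Sum>j\<in>distinct_below k N. \<integral>\<^sup>+x. (\<Prod>r<k. ?f (j r) x) * indicator A (?T j x) \<partial>marked_space m)"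
      unfolding V_def by (rule nn_integral_sum) measurable
    also have "\<dots> = (\<Sum>j\<in>distinct_below k N. (\<integral>\<^sup>+x. (\<Prod>r<k. ?f (j r) x) \<partial>marked_space m) * emeasure (prod_measure m k) A)"
    proof (rule sum.cong[OF refl])
      fix j assume "j \<in> distinct_below k N"
      then have "inj_on j {..<k}" by (simp add: distinct_below_def)
      from nn_integral_marked_times_indicator[OF m _ A this, of "\<lambda>\<tau>. \<Prod>r<k. ennreal (profile p q (arrival (Suc (j r)) \<tau>))"]
      show "(\<integral>\<^sup>+x. (\<Prod>r<k. ?f (j r) x) * indicator A (?T j x) \<partial>marked_space m)
        = (\<integral>\<^sup>+x. (\<Prod>r<k. ?f (j r) x) \<partial>marked_space m) * emeasure (prod_measure m k) A"
        by measurable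
    qed
    also have "\<dots> = (\<integral>\<^sup>+x. (\<Sum>j\<in>distinct_below k N. \<Prod>r<k. ?f (j r) x) \<partial>marked_space m) * emeasure (prod_measure m k) A"
      by (subst nn_integral_sum) (auto simp: sum_distrib_right)
    also have "\<dots> \<le> (\<integral>\<^sup>+x. of_nat (k ^ k) * Z N x \<partial>marked_space m) * emeasure (prod_measure m k) A"
      unfolding Z_def by (intro mult_right_mono nn_integral_mono sum_distinct_le) simp
    also have "\<dots> = of_nat (k ^ k) * (\<integral>\<^sup>+x. Z N x \<partial>marked_space m) * emeasure (prod_measure m k) A"
      by (subst nn_integral_cmult) auto
    also have "\<dots> \<le> of_nat (k ^ k) * ennreal C * ennreal t"
      using t by (intro mult_mono EZ) (auto simp: mk.emeasure_eq_measure intro!: ennreal_leI)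
    also have "\<dots> = ennreal (real (k ^ k) * C * t)"
      using t by (simp add: ennreal_mult C_def ennreal_of_nat_eq_real_of_nat del: of_nat_power)
    finally show ?thesis .
  qed
  have EW: "(\<integral>\<^sup>+x. W N x \<partial>marked_space m) \<le> ennreal (b powr (real k * p) * C * (1 + real (k ^ k)) * t powr s)" for N
  proof -
    have "(\<integral>\<^sup>+x. W N x \<partial>marked_space m)
      = ennreal (b powr (real k * p)) * (ennreal (t powr s) * (\<integral>\<^sup>+x. Z N x \<partial>marked_space m) + ennreal (t powr (s - 1)) * (\<integral>\<^sup>+x. V N x \<partial>marked_space m))"
      unfolding W_def by (simp add: nn_integral_cmult nn_integral_add)
    also have "\<dots> \<le> ennreal (b powr (real k * p)) * (ennreal (t powr s) * ennreal C + ennreal (t powr (s - 1)) * ennreal (real (k ^ k) * C * t))"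
      by (intro mult_left_mono add_mono EZ EV) auto
    also have "\<dots> = ennreal (b powr (real k * p) * (t powr s * C + t powr (s - 1) * (real (k ^ k) * C * t)))"
      using t by (simp add: ennreal_mult ennreal_plus C_def del: of_nat_power)
    also have "t powr (s - 1) * (real (k ^ k) * C * t) = real (k ^ k) * C * t powr s"
      using t by (simp add: powr_diff)
    finally show ?thesis by (simp add: algebra_simps)
  qed
  have inc: "incseq W"
  proof (rule incseq_SucI, rule le_funI)
    fix N x
    have "Z N x \<le> Z (Suc N) x"
    proof -
      have "Z N x * 1 \<le> Z N x * (1 + ?f N x)" by (intro mult_left_mono) auto
      then show ?thesis by (simp add: Z_def)
    qed
    moreover have "V N x \<le> V (Suc N) x"
      unfolding V_def
    proof (rule sum_mono2[OF finite_distinct_below])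
      show "distinct_below k N \<subseteq> distinct_below k (Suc N)"
        by (auto simp: distinct_below_def PiE_iff less_Suc_eq)
    qed simp
    ultimately show "W N x \<le> W (Suc N) x"
      unfolding W_def by (intro mult_left_mono add_mono) auto
  qed
  have "AE x in marked_space m. epowr (canonical_series \<alpha> (ennreal b) k A x) \<gamma> \<le> (SUP N. W N x)"
    using AE_arrival_pos[OF m]
  proof eventually_elim
    fix x :: "(nat \<Rightarrow> real) \<times> (nat \<Rightarrow> 'a)" assume G: "\<forall>i. 0 < arrival (Suc i) (fst x)"
    have "canonical_series \<alpha> (ennreal b) k A x \<le> epowr (SUP N. W N x) (1 / \<gamma>)"
      unfolding series_rep_def
    proof (rule SUP_least)
      fix j assume j: "j \<in> distinct_indices k"
      define y where "y = (\<Prod>r<k. ?G (j r) x powr (- 1 / \<alpha>) * b powr (1 / \<alpha>))"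
      obtain N where N: "\<And>r. r < k \<Longrightarrow> j r < N"
      proof
        show "j r < Suc (Max (j ` {..<k}))" if "r < k" for r
          using that by (simp add: less_Suc_eq_le)
      qed
      have jN: "j \<in> distinct_below k N"
        using j N by (auto simp: distinct_indices_def distinct_below_def PiE_iff)
      have inj: "inj_on j {..<k}" using j by (simp add: distinct_indices_def)
      show "(\<Prod>r<k. ennreal (?G (j r) x powr (- 1 / \<alpha>)) * epowr (ennreal b) (1 / \<alpha>)) * indicator A (?T j x)
        \<le> epowr (SUP N. W N x) (1 / \<gamma>)"
      proof (cases "?T j x \<in> A")
        case True
        have "(\<Prod>r<k. ennreal (?G (j r) x powr (- 1 / \<alpha>)) * epowr (ennreal b) (1 / \<alpha>)) = ennreal y"
          using b by (simp add: y_def epowr_ennreal ennreal_mult[symmetric] prod_ennreal)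
        moreover have "epowr (ennreal y) \<gamma> \<le> W N x"
        proof -
          have "y powr \<gamma> = (\<Prod>r<k. (?G (j r) x powr (- 1 / \<alpha>) * b powr (1 / \<alpha>)) powr \<gamma>)"
            unfolding y_def by (rule prod_powr_distrib)
          also have "\<dots> = (\<Prod>r<k. ?G (j r) x powr (- p) * b powr p)"
            by (intro prod.cong) (auto simp: powr_mult powr_powr p_def)
          also have "\<dots> = b powr (real k * p) * (\<Prod>r<k. ?G (j r) x powr (- p))"
            using b by (simp add: prod.distrib powr_power mult.commute)
          also have "\<dots> \<le> b powr (real k * p) * (t powr s * (\<Prod>i<N. 1 + profile p q (?G i x))
              + t powr (s - 1) * (\<Prod>r<k. profile p q (?G (j r) x)))"
            using G by (intro mult_left_mono product_powr_split[where G="\<lambda>i. ?G i x"] inj N t q s pqs) auto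
          finally have "epowr (ennreal y) \<gamma> \<le> ennreal (b powr (real k * p) * (t powr s * (\<Prod>i<N. 1 + profile p q (?G i x))
              + t powr (s - 1) * (\<Prod>r<k. profile p q (?G (j r) x))))"
            by (simp add: epowr_ennreal y_def prod_nonneg ennreal_leI)
          also have "\<dots> = ennreal (b powr (real k * p)) * (ennreal (t powr s) * Z N x + ennreal (t powr (s - 1)) * (\<Prod>r<k. ?f (j r) x))"
          proof -
            have 1: "Z N x = ennreal (\<Prod>i<N. 1 + profile p q (?G i x))"
              unfolding Z_def by (subst prod_ennreal[symmetric]) (auto simp: profile_nonneg)
            have 2: "(\<Prod>r<k. ?f (j r) x) = ennreal (\<Prod>r<k. profile p q (?G (j r) x))"
              by (rule prod_ennreal) (simp add: profile_nonneg)
            have 3: "0 \<le> (\<Prod>i<N. 1 + profile p q (?G i x))" "0 \<le> (\<Prod>r<k. profile p q (?G (j r) x))"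
              by (auto intro!: prod_nonneg simp: profile_nonneg)
            show ?thesis
              unfolding 1 2 using 3 by (simp add: ennreal_mult ennreal_plus)
          qed
          also have "\<dots> \<le> W N x"
          proof -
            have "(\<Prod>r<k. ?f (j r) x) = (\<Prod>r<k. ?f (j r) x) * indicator A (?T j x)" using True by simp
            also have "\<dots> \<le> V N x"
              unfolding V_def by (rule member_le_sum[OF jN]) (auto simp: finite_distinct_below)
            finally show ?thesis
              unfolding W_def by (intro mult_left_mono add_mono) auto
          qed
          finally show ?thesis .
        qed
        then have "epowr (ennreal y) \<gamma> \<le> (SUP N. W N x)" by (rule SUP_upper2[OF UNIV_I])
        then have "epowr (epowr (ennreal y) \<gamma>) (1 / \<gamma>) \<le> epowr (SUP N. W N x) (1 / \<gamma>)"
          using \<gamma> by (intro epowr_mono) auto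
        ultimately show ?thesis using True \<gamma> by (simp add: epowr_inverse)
      qed simp
    qed
    then have "epowr (canonical_series \<alpha> (ennreal b) k A x) \<gamma> \<le> epowr (epowr (SUP N. W N x) (1 / \<gamma>)) \<gamma>"
      using \<gamma> by (intro epowr_mono) auto
    then show "epowr (canonical_series \<alpha> (ennreal b) k A x) \<gamma> \<le> (SUP N. W N x)"
      using \<gamma> by (simp add: epowr_inverse')
  qed
  then have "(\<integral>\<^sup>+x. epowr (canonical_series \<alpha> (ennreal b) k A x) \<gamma> \<partial>marked_space m) \<le> (\<integral>\<^sup>+x. (SUP N. W N x) \<partial>marked_space m)"
    by (rule nn_integral_mono_AE)
  also have "\<dots> = (SUP N. \<integral>\<^sup>+x. W N x \<partial>marked_space m)"
    by (rule nn_integral_monotone_convergence_SUP[OF inc]) simp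
  also have "\<dots> \<le> ennreal (b powr (real k * p) * C * (1 + real (k ^ k)) * t powr s)"
    by (rule SUP_least) (rule EW)
  finally show ?thesis unfolding C_def p_def q_def s_def .
qed

text \<open>
  The best threshold is \<open>t = m\<^sup>k(A)\<close>; if this is 0, let \<open>t\<close> tend to 0.
\<close>

lemma canonical_series_moment:
  assumes m: "prob_space m" and b: "0 < b" and \<gamma>: "0 < \<gamma>" "\<gamma> < \<alpha>" and r: "\<alpha> < r"
    and A: "A \<in> sets (prod_measure m k)"
  shows "(\<integral>\<^sup>+x. epowr (canonical_series \<alpha> (ennreal b) k A x) \<gamma> \<partial>marked_space m)
    \<le> ennreal (b powr (real k * (\<gamma> / \<alpha>)) * exp (1 / (1 - \<gamma> / \<alpha>) + 1 / (r / \<alpha> - 1)) * (1 + real (k ^ k))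
       * measure (prod_measure m k) A powr (\<gamma> / r))" (is "?I \<le> ennreal (?B * ?a powr _)")
proof (cases "?a = 0")
  case False
  then show ?thesis
    by (intro canonical_series_moment_aux assms) (auto simp: less_le)
next
  case True
  have "(\<lambda>n. ennreal (?B * (1 / real (Suc n)) powr (\<gamma> / r))) \<longlonglongrightarrow> ennreal (?B * 0 powr (\<gamma> / r))"
    using \<gamma> r by (intro tendsto_ennrealI tendsto_mult tendsto_const tendsto_powr' LIMSEQ_Suc[OF lim_1_over_n]) auto
  moreover have "?I \<le> ennreal (?B * (1 / real (Suc n)) powr (\<gamma> / r))" for n
    using True by (intro canonical_series_moment_aux assms) auto
  ultimately have "?I \<le> ennreal (?B * 0 powr (\<gamma> / r))"
    by (intro LIMSEQ_le_const) auto
  then show ?thesis using True by simp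
qed

section \<open>The series as a Frechet sup measure\<close>

lemma prod_SUP_ennreal:
  fixes a :: "nat \<Rightarrow> nat \<Rightarrow> ennreal"
  shows "(\<Prod>r<k. SUP i. a r i) = (SUP j\<in>{..<k} \<rightarrow>\<^sub>E UNIV. \<Prod>r<k. a r (j r))"
proof (rule antisym)
  show "(SUP j\<in>{..<k} \<rightarrow>\<^sub>E UNIV. \<Prod>r<k. a r (j r)) \<le> (\<Prod>r<k. SUP i. a r i)"
    by (intro SUP_least prod_mono_ennreal) (auto intro: SUP_upper)
  show "(\<Prod>r<k. SUP i. a r i) \<le> (SUP j\<in>{..<k} \<rightarrow>\<^sub>E UNIV. \<Prod>r<k. a r (j r))"
  proof (induction k)
    case (Suc k)
    have "(\<Prod>r<Suc k. SUP i. a r i) \<le> (SUP j\<in>{..<k} \<rightarrow>\<^sub>E UNIV. \<Prod>r<k. a r (j r)) * (SUP i. a k i)"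
      using Suc by (simp add: mult_right_mono)
    also have "\<dots> = (SUP j\<in>{..<k} \<rightarrow>\<^sub>E UNIV. SUP i. (\<Prod>r<k. a r (j r)) * a k i)"
      unfolding SUP_mult_right_ennreal SUP_mult_left_ennreal by (rule SUP_commute)
    also have "\<dots> \<le> (SUP j\<in>{..<Suc k} \<rightarrow>\<^sub>E UNIV. \<Prod>r<Suc k. a r (j r))"
    proof (intro SUP_least)
      fix j :: "nat \<Rightarrow> nat" and i :: nat assume j: "j \<in> {..<k} \<rightarrow>\<^sub>E UNIV"
      have "(\<Prod>r<k. a r (j r)) * a k i = (\<Prod>r<Suc k. a r ((j(k := i)) r))" by simp
      also have "\<dots> \<le> (SUP j\<in>{..<Suc k} \<rightarrow>\<^sub>E UNIV. \<Prod>r<Suc k. a r (j r))"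
        using j by (intro SUP_upper) (auto simp: PiE_iff extensional_def)
      finally show "(\<Prod>r<k. a r (j r)) * a k i \<le> (SUP j\<in>{..<Suc k} \<rightarrow>\<^sub>E UNIV. \<Prod>r<Suc k. a r (j r))" .
    qed
    finally show ?case .
  qed simp
qed

definition point_mass :: "real \<Rightarrow> ('a \<Rightarrow> ennreal) \<Rightarrow> (nat \<Rightarrow> 'v \<Rightarrow> real) \<Rightarrow> (nat \<Rightarrow> 'v \<Rightarrow> 'a) \<Rightarrow> nat \<Rightarrow> 'v \<Rightarrow> ennreal" where
  "point_mass \<alpha> \<psi> \<Gamma> T i \<omega> = ennreal (\<Gamma> i \<omega> powr (- 1 / \<alpha>)) * epowr (\<psi> (T i \<omega>)) (1 / \<alpha>)"

definition series_measure :: "real \<Rightarrow> ('a \<Rightarrow> ennreal) \<Rightarrow> (nat \<Rightarrow> 'v \<Rightarrow> real) \<Rightarrow> (nat \<Rightarrow> 'v \<Rightarrow> 'a) \<Rightarrow> 'a set \<Rightarrow> 'v \<Rightarrow> ennreal" where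
  "series_measure \<alpha> \<psi> \<Gamma> T A \<omega> = (SUP i. point_mass \<alpha> \<psi> \<Gamma> T i \<omega> * indicator A (T i \<omega>))"

lemma series_rep_alt:
  "series_rep \<alpha> \<psi> \<Gamma> T k A \<omega> = (SUP j\<in>distinct_indices k. (\<Prod>r<k. point_mass \<alpha> \<psi> \<Gamma> T (j r) \<omega>) * indicator A (\<lambda>r\<in>{..<k}. T (j r) \<omega>))"
  unfolding series_rep_def point_mass_def ..

lemma SUP_indicator_UN:
  "(indicator (\<Union>i\<in>I. B i) x :: ennreal) = (SUP i\<in>I. indicator (B i) x)"
proof (rule antisym)
  show "(indicator (\<Union>i\<in>I. B i) x :: ennreal) \<le> (SUP i\<in>I. indicator (B i) x)"
    by (auto split: split_indicator intro!: SUP_upper2)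
  show "(SUP i\<in>I. indicator (B i) x) \<le> (indicator (\<Union>i\<in>I. B i) x :: ennreal)"
    by (rule SUP_least) (auto split: split_indicator)
qed

lemma series_rep_UN:
  "series_rep \<alpha> \<psi> \<Gamma> T k (\<Union>i\<in>I. B i) \<omega> = (SUP i\<in>I. series_rep \<alpha> \<psi> \<Gamma> T k (B i) \<omega>)"
  unfolding series_rep_alt SUP_indicator_UN SUP_mult_left_ennreal by (rule SUP_commute)

lemma series_measure_UN:
  "series_measure \<alpha> \<psi> \<Gamma> T (\<Union>i\<in>I. B i) \<omega> = (SUP i\<in>I. series_measure \<alpha> \<psi> \<Gamma> T (B i) \<omega>)"
  unfolding series_measure_def SUP_indicator_UN SUP_mult_left_ennreal by (rule SUP_commute)

text \<open>
  Multiply out the product of suprema. A tuple with a repeated index contributes 0, because its mark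
  would have to lie in two disjoint sides.
\<close>

lemma series_rep_rect:
  assumes C: "disjoint_sides mu k C"
  shows "series_rep \<alpha> \<psi> \<Gamma> T k (Pi\<^sub>E {..<k} C) \<omega> = (\<Prod>r<k. series_measure \<alpha> \<psi> \<Gamma> T (C r) \<omega>)"
proof -
  define a where "a r i = point_mass \<alpha> \<psi> \<Gamma> T i \<omega> * indicator (C r) (T i \<omega>)" for r i
  have term_eq: "(\<Prod>r<k. point_mass \<alpha> \<psi> \<Gamma> T (j r) \<omega>) * indicator (Pi\<^sub>E {..<k} C) (\<lambda>r\<in>{..<k}. T (j r) \<omega>) = (\<Prod>r<k. a r (j r))" for j
  proof -
    have "(indicator (Pi\<^sub>E {..<k} C) (\<lambda>r\<in>{..<k}. T (j r) \<omega>) :: ennreal) = (\<Prod>r<k. indicator (C r) (T (j r) \<omega>))"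
    proof (cases "\<forall>r<k. T (j r) \<omega> \<in> C r")
      case False
      then have "(\<Prod>r<k. indicator (C r) (T (j r) \<omega>) :: ennreal) = 0"
        by (intro prod_zero) (auto split: split_indicator)
      then show ?thesis using False by (auto split: split_indicator simp: PiE_iff)
    qed (auto split: split_indicator)
    then show ?thesis by (simp add: a_def prod.distrib)
  qed
  have zero: "(\<Prod>r<k. a r (j r)) = 0" if "\<not> inj_on j {..<k}" for j
  proof -
    from that obtain r s where rs: "r < k" "s < k" "r \<noteq> s" "j r = j s" by (auto simp: inj_on_def)
    then have "C r \<inter> C s = {}" using C by (auto simp: disjoint_sides_def disjoint_family_on_def)
    then have "a r (j r) = 0 \<or> a s (j s) = 0" using rs(4) by (auto simp: a_def split: split_indicator)
    then show ?thesis using rs(1,2) by (auto intro!: prod_zero)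
  qed
  have "(\<Prod>r<k. series_measure \<alpha> \<psi> \<Gamma> T (C r) \<omega>) = (SUP j\<in>{..<k} \<rightarrow>\<^sub>E UNIV. \<Prod>r<k. a r (j r))"
    unfolding series_measure_def a_def by (rule prod_SUP_ennreal)
  also have "\<dots> = (SUP j\<in>distinct_indices k. \<Prod>r<k. a r (j r))"
  proof (rule antisym)
    show "(SUP j\<in>{..<k} \<rightarrow>\<^sub>E UNIV. \<Prod>r<k. a r (j r)) \<le> (SUP j\<in>distinct_indices k. \<Prod>r<k. a r (j r))"
    proof (rule SUP_least)
      fix j :: "nat \<Rightarrow> nat" assume j: "j \<in> {..<k} \<rightarrow>\<^sub>E UNIV"
      show "(\<Prod>r<k. a r (j r)) \<le> (SUP j\<in>distinct_indices k. \<Prod>r<k. a r (j r))"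
      proof (cases "inj_on j {..<k}")
        case True
        then show ?thesis using j by (intro SUP_upper) (simp add: distinct_indices_def)
      qed (simp add: zero)
    qed
    show "(SUP j\<in>distinct_indices k. \<Prod>r<k. a r (j r)) \<le> (SUP j\<in>{..<k} \<rightarrow>\<^sub>E UNIV. \<Prod>r<k. a r (j r))"
      by (intro SUP_subset_mono) (auto simp: distinct_indices_def)
  qed
  also have "\<dots> = series_rep \<alpha> \<psi> \<Gamma> T k (Pi\<^sub>E {..<k} C) \<omega>"
    unfolding series_rep_alt term_eq ..
  finally show ?thesis ..
qed

lemma measurable_point_mass:
  assumes [measurable]: "\<And>i. \<Gamma> i \<in> borel_measurable Q" "\<And>i. T i \<in> measurable Q m" "\<psi> \<in> borel_measurable m"
  shows "point_mass \<alpha> \<psi> \<Gamma> T i \<in> borel_measurable Q"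
  unfolding point_mass_def[abs_def] by measurable

lemma countable_distinct_indices: "countable (distinct_indices k)"
  by (rule countable_subset[OF _ countable_PiE[of "{..<k}" "\<lambda>_. UNIV"]]) (auto simp: distinct_indices_def)

lemma measurable_series_rep:
  assumes m: "\<And>i. \<Gamma> i \<in> borel_measurable Q" "\<And>i. T i \<in> measurable Q m" "\<psi> \<in> borel_measurable m"
    and [measurable]: "A \<in> sets (prod_measure m k)"
  shows "series_rep \<alpha> \<psi> \<Gamma> T k A \<in> borel_measurable Q"
proof -
  note [measurable] = measurable_point_mass[OF m] m(2)
  show ?thesis
    unfolding series_rep_alt[abs_def]
    by (intro borel_measurable_SUP countable_distinct_indices) measurable
qed

text \<open>
  The properties of a marked Poisson process that make its series a Frechet sup measure. They hold on
  \<open>marked_space m\<close> and for every process as in \<open>series_setup\<close>, so both are treated together.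
\<close>

definition void_law :: "'v measure \<Rightarrow> 'a measure \<Rightarrow> (nat \<Rightarrow> 'v \<Rightarrow> real) \<Rightarrow> (nat \<Rightarrow> 'v \<Rightarrow> 'a) \<Rightarrow> bool" where
  "void_law Q m \<Gamma> T \<longleftrightarrow> prob_space Q \<and> prob_space m \<and> (\<forall>i. \<Gamma> i \<in> borel_measurable Q) \<and> (\<forall>i. T i \<in> measurable Q m) \<and>
    (AE \<omega> in Q. \<forall>i. 0 < \<Gamma> i \<omega>) \<and> (\<forall>i. distr Q m (T i) = m) \<and>
    (\<forall>g \<in> borel_measurable m. (\<integral>\<^sup>+a. g a \<partial>m) < \<infinity> \<longrightarrow>
       emeasure Q {\<omega> \<in> space Q. \<forall>i. g (T i \<omega>) \<le> ennreal (\<Gamma> i \<omega>)} = ennreal (exp (- enn2real (\<integral>\<^sup>+a. g a \<partial>m))))"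

lemma void_lawD:
  assumes "void_law Q m \<Gamma> T"
  shows "prob_space Q" "prob_space m" "\<And>i. \<Gamma> i \<in> borel_measurable Q" "\<And>i. T i \<in> measurable Q m"
    "AE \<omega> in Q. \<forall>i. 0 < \<Gamma> i \<omega>" "\<And>i. distr Q m (T i) = m"
    "\<And>g. g \<in> borel_measurable m \<Longrightarrow> (\<integral>\<^sup>+a. g a \<partial>m) < \<infinity> \<Longrightarrow>
       emeasure Q {\<omega> \<in> space Q. \<forall>i. g (T i \<omega>) \<le> ennreal (\<Gamma> i \<omega>)} = ennreal (exp (- enn2real (\<integral>\<^sup>+a. g a \<partial>m)))"
  using assms unfolding void_law_def by auto

lemma void_law_marked_space:
  assumes m: "prob_space m"
  shows "void_law (marked_space m) m (\<lambda>i x. arrival (Suc i) (fst x)) (\<lambda>i x. snd x i)"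
proof -
  let ?S = "PiM UNIV (\<lambda>_::nat. exp_law)" and ?R = "PiM UNIV (\<lambda>_::nat. m)"
  interpret S: prob_space ?S by (intro prob_space_PiM prob_space_exp_law)
  interpret R: prob_space ?R by (intro prob_space_PiM m)
  have "distr (marked_space m) m (\<lambda>x. snd x i) = m" for i
  proof -
    have "distr (distr (marked_space m) ?R snd) m (\<lambda>\<theta>. \<theta> i) = distr (marked_space m) m (\<lambda>x. snd x i)"
      unfolding marked_space_def by (subst distr_distr) (auto simp: comp_def)
    moreover have "distr (marked_space m) ?R snd = ?R"
    proof (rule measure_eqI)
      fix A assume "A \<in> sets (distr (marked_space m) ?R snd)"
      then have A: "A \<in> sets ?R" by simp
      have "snd -` A \<inter> space (?S \<Otimes>\<^sub>M ?R) = space ?S \<times> A"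
        using sets.sets_into_space[OF A] by (auto simp: space_pair_measure)
      then show "emeasure (distr (marked_space m) ?R snd) A = emeasure ?R A"
        using A unfolding marked_space_def
        by (simp add: emeasure_distr R.emeasure_pair_measure_Times S.emeasure_space_1)
    qed simp
    ultimately show ?thesis using distr_PiM_component[of UNIV "\<lambda>_. m" i] m by simp
  qed
  then show ?thesis
    unfolding void_law_def
    using prob_space_marked_space[OF m] m AE_arrival_pos[OF m] void_probability[OF m] by auto
qed

text \<open>
  The interarrival times are increments of \<open>\<Gamma>\<close>, so they are measurable with respect to the
  \<open>\<sigma>\<close>-algebra of \<open>\<Gamma>\<close>, and the independence of \<open>\<Gamma>\<close> and \<open>T\<close> makes the joint law a product.
\<close>

lemma joint_law_series_setup:
  assumes ser: "series_setup mu m \<psi> Q \<Gamma> T"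
  obtains \<tau> where "\<And>i \<omega>. \<omega> \<in> space Q \<Longrightarrow> \<Gamma> i \<omega> = arrival (Suc i) (\<lambda>i. \<tau> i \<omega>)"
    "(\<lambda>\<omega>. (\<lambda>i. \<tau> i \<omega>, \<lambda>i. T i \<omega>)) \<in> measurable Q (marked_space m)"
    "distr Q (marked_space m) (\<lambda>\<omega>. (\<lambda>i. \<tau> i \<omega>, \<lambda>i. T i \<omega>)) = marked_space m"
proof -
  let ?S = "PiM UNIV (\<lambda>_::nat. exp_law)" and ?R = "PiM UNIV (\<lambda>_::nat. m)"
  from ser obtain \<tau> where Q: "prob_space Q" and m: "prob_space m"
    and ind\<tau>: "prob_space.indep_vars Q (\<lambda>_. borel) \<tau> (UNIV :: nat set)"
    and dist\<tau>: "\<And>i. distributed Q lborel (\<tau> i) (exponential_density 1)"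
    and \<Gamma>: "\<And>i \<omega>. \<omega> \<in> space Q \<Longrightarrow> \<Gamma> i \<omega> = (\<Sum>l\<le>i. \<tau> l \<omega>)"
    and indT: "prob_space.indep_vars Q (\<lambda>_. m) T (UNIV :: nat set)" and distT: "\<And>i. distr Q m (T i) = m"
    and ind: "prob_space.indep_set Q
      (sets (vimage_algebra (space Q) (\<lambda>\<omega> i. \<Gamma> i \<omega>) (PiM UNIV (\<lambda>_. borel))))
      (sets (vimage_algebra (space Q) (\<lambda>\<omega> i. T i \<omega>) (PiM UNIV (\<lambda>_. m))))"
    unfolding series_setup_def poisson_arrivals_def by auto
  interpret Q: prob_space Q by fact
  interpret S: prob_space ?S by (intro prob_space_PiM prob_space_exp_law)
  interpret R: prob_space ?R by (intro prob_space_PiM m)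
  have \<tau>m[measurable]: "\<tau> i \<in> borel_measurable Q" for i
    using dist\<tau>[of i] by (auto simp: distributed_def)
  have Tm[measurable]: "T i \<in> measurable Q m" for i
    using indT by (auto simp: Q.indep_vars_def2)
  have law\<tau>: "distr Q ?S (\<lambda>\<omega> i. \<tau> i \<omega>) = ?S"
  proof -
    have "distr Q borel (\<tau> i) = exp_law" for i
    proof -
      have "distr Q borel (\<tau> i) = distr Q lborel (\<tau> i)" by (rule distr_cong) auto
      then show ?thesis using dist\<tau>[of i] by (simp add: distributed_def exp_law_def)
    qed
    moreover have "distr Q (PiM UNIV (\<lambda>_. borel)) (\<lambda>\<omega>. \<lambda>i\<in>UNIV. \<tau> i \<omega>) = PiM UNIV (\<lambda>i. distr Q borel (\<tau> i))"
      using ind\<tau> by (subst (asm) Q.indep_vars_iff_distr_eq_PiM) auto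
    moreover have "distr Q ?S (\<lambda>\<omega> i. \<tau> i \<omega>) = distr Q (PiM UNIV (\<lambda>_. borel)) (\<lambda>\<omega>. \<lambda>i\<in>UNIV. \<tau> i \<omega>)"
      by (intro distr_cong) (auto intro!: sets_PiM_cong)
    ultimately show ?thesis by simp
  qed
  have lawT: "distr Q ?R (\<lambda>\<omega> i. T i \<omega>) = ?R"
    using indT by (subst (asm) Q.indep_vars_iff_distr_eq_PiM) (auto simp: distT restrict_UNIV)
  have \<tau>seq[measurable]: "(\<lambda>\<omega> i. \<tau> i \<omega>) \<in> measurable Q ?S"
  proof -
    have "\<tau> i \<in> measurable Q exp_law" for i by measurable
    from measurable_restrict[of UNIV \<tau> Q "\<lambda>_. exp_law", OF this] show ?thesis by (simp add: restrict_UNIV)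
  qed
  have Tseq[measurable]: "(\<lambda>\<omega> i. T i \<omega>) \<in> measurable Q ?R"
    using measurable_restrict[of UNIV T Q "\<lambda>_. m", OF Tm] by (simp add: restrict_UNIV)
  \<comment> \<open>The inverse of forming partial sums.\<close>
  define incr where "incr x i = x i - (if i = 0 then 0 else x (i - 1))" for x :: "nat \<Rightarrow> real" and i
  have incr: "incr \<in> measurable (PiM UNIV (\<lambda>_. borel)) ?S"
  proof -
    have "(\<lambda>x. \<lambda>i\<in>UNIV. incr x i) \<in> measurable (PiM UNIV (\<lambda>_. borel)) ?S"
      unfolding incr_def by (intro measurable_restrict) measurable
    then show ?thesis by (simp add: restrict_UNIV)
  qed
  have \<tau>_inc: "(\<lambda>i. \<tau> i \<omega>) = incr (\<lambda>i. \<Gamma> i \<omega>)" if "\<omega> \<in> space Q" for \<omega>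
  proof
    fix i show "\<tau> i \<omega> = incr (\<lambda>i. \<Gamma> i \<omega>) i"
      by (cases i) (simp_all add: incr_def \<Gamma>[OF that])
  qed
  have "distr Q (?S \<Otimes>\<^sub>M ?R) (\<lambda>\<omega>. (\<lambda>i. \<tau> i \<omega>, \<lambda>i. T i \<omega>)) = ?S \<Otimes>\<^sub>M ?R"
  proof (rule pair_measure_eqI[symmetric])
    fix A B assume A: "A \<in> sets ?S" and B: "B \<in> sets ?R"
    have 1: "(\<lambda>\<omega> i. \<tau> i \<omega>) -` A \<inter> space Q \<in> sets (vimage_algebra (space Q) (\<lambda>\<omega> i. \<Gamma> i \<omega>) (PiM UNIV (\<lambda>_. borel)))"
    proof -
      have "(\<lambda>\<omega> i. \<tau> i \<omega>) -` A \<inter> space Q = (\<lambda>\<omega> i. \<Gamma> i \<omega>) -` (incr -` A \<inter> space (PiM UNIV (\<lambda>_. borel))) \<inter> space Q"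
        using \<tau>_inc by (auto simp: space_PiM)
      then show ?thesis using in_vimage_algebra[OF measurable_sets[OF incr A]] by (simp only:)
    qed
    have 2: "(\<lambda>\<omega> i. T i \<omega>) -` B \<inter> space Q \<in> sets (vimage_algebra (space Q) (\<lambda>\<omega> i. T i \<omega>) ?R)"
      using B by (rule in_vimage_algebra)
    have "emeasure (distr Q (?S \<Otimes>\<^sub>M ?R) (\<lambda>\<omega>. (\<lambda>i. \<tau> i \<omega>, \<lambda>i. T i \<omega>))) (A \<times> B)
      = emeasure Q (((\<lambda>\<omega> i. \<tau> i \<omega>) -` A \<inter> space Q) \<inter> ((\<lambda>\<omega> i. T i \<omega>) -` B \<inter> space Q))"
      using A B by (subst emeasure_distr) (auto intro!: arg_cong[where f="emeasure Q"])
    also have "\<dots> = emeasure Q ((\<lambda>\<omega> i. \<tau> i \<omega>) -` A \<inter> space Q) * emeasure Q ((\<lambda>\<omega> i. T i \<omega>) -` B \<inter> space Q)"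
      using ind 1 2 by (simp add: Q.indep_sets2_eq Q.emeasure_eq_measure ennreal_mult)
    also have "\<dots> = emeasure ?S A * emeasure ?R B"
      using A B emeasure_distr[OF \<tau>seq A] emeasure_distr[OF Tseq B] by (simp add: law\<tau> lawT)
    finally show "emeasure ?S A * emeasure ?R B = emeasure (distr Q (?S \<Otimes>\<^sub>M ?R) (\<lambda>\<omega>. (\<lambda>i. \<tau> i \<omega>, \<lambda>i. T i \<omega>))) (A \<times> B)" ..
  qed (auto intro: S.sigma_finite_measure_axioms R.sigma_finite_measure_axioms)
  then show ?thesis
    using \<Gamma> by (intro that[of \<tau>]) (auto simp: arrival_def lessThan_Suc_atMost marked_space_def)
qed

lemma void_law_series_setup:
  assumes ser: "series_setup mu m \<psi> Q \<Gamma> T"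
  shows "void_law Q m \<Gamma> T"
proof -
  obtain \<tau> where \<Gamma>: "\<And>i \<omega>. \<omega> \<in> space Q \<Longrightarrow> \<Gamma> i \<omega> = arrival (Suc i) (\<lambda>i. \<tau> i \<omega>)"
    and meas: "(\<lambda>\<omega>. (\<lambda>i. \<tau> i \<omega>, \<lambda>i. T i \<omega>)) \<in> measurable Q (marked_space m)" (is "?F \<in> _")
    and law: "distr Q (marked_space m) (\<lambda>\<omega>. (\<lambda>i. \<tau> i \<omega>, \<lambda>i. T i \<omega>)) = marked_space m"
    by (rule joint_law_series_setup[OF ser]) blast
  have Q: "prob_space Q" and m: "prob_space m" and distT: "\<And>i. distr Q m (T i) = m"
    using ser unfolding series_setup_def by auto
  note V = void_lawD[OF void_law_marked_space[OF m]]
  have Tm: "T i \<in> measurable Q m" for i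
    using measurable_compose[OF meas V(4)[of i]] by simp
  have \<Gamma>m: "\<Gamma> i \<in> borel_measurable Q" for i
    using measurable_compose[OF meas V(3)[of i]] by (subst measurable_cong[OF \<Gamma>]) auto
  have "AE x in distr Q (marked_space m) ?F. \<forall>i. 0 < arrival (Suc i) (fst x)"
    unfolding law by (rule V(5))
  from AE_distrD[OF meas this] have pos: "AE \<omega> in Q. \<forall>i. 0 < \<Gamma> i \<omega>"
    by (rule AE_mp) (auto intro!: AE_I2 simp: \<Gamma>)
  have "emeasure Q {\<omega> \<in> space Q. \<forall>i. g (T i \<omega>) \<le> ennreal (\<Gamma> i \<omega>)} = ennreal (exp (- enn2real (\<integral>\<^sup>+a. g a \<partial>m)))"
    if g: "g \<in> borel_measurable m" "(\<integral>\<^sup>+a. g a \<partial>m) < \<infinity>" for g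
  proof -
    note [measurable] = g(1)
    let ?E = "{x \<in> space (marked_space m). \<forall>i. g (snd x i) \<le> ennreal (arrival (Suc i) (fst x))}"
    have E: "?E \<in> sets (marked_space m)" by measurable
    have "{\<omega> \<in> space Q. \<forall>i. g (T i \<omega>) \<le> ennreal (\<Gamma> i \<omega>)} = ?F -` ?E \<inter> space Q"
      using measurable_space[OF meas] by (auto simp: \<Gamma>)
    then have "emeasure Q {\<omega> \<in> space Q. \<forall>i. g (T i \<omega>) \<le> ennreal (\<Gamma> i \<omega>)} = emeasure (distr Q (marked_space m) ?F) ?E"
      using emeasure_distr[OF meas E] by simp
    also have "\<dots> = ennreal (exp (- enn2real (\<integral>\<^sup>+a. g a \<partial>m)))"
      unfolding law by (rule V(7)[OF g])
    finally show ?thesis .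
  qed
  then show ?thesis
    unfolding void_law_def using Q m distT Tm \<Gamma>m pos by auto
qed

lemma point_threshold:
  assumes "0 < \<alpha>" "0 < G" "0 < c" "0 < x"
  shows "ennreal (G powr (- 1 / \<alpha>)) * epowr (ennreal c) (1 / \<alpha>) \<le> ennreal x \<longleftrightarrow>
    ennreal c * ennreal (x powr (- \<alpha>)) \<le> ennreal G"
proof -
  have "ennreal (G powr (- 1 / \<alpha>)) * epowr (ennreal c) (1 / \<alpha>) \<le> ennreal x \<longleftrightarrow> G powr (- 1 / \<alpha>) * c powr (1 / \<alpha>) \<le> x"
    using assms by (simp add: epowr_ennreal ennreal_mult[symmetric])
  also have "G powr (- 1 / \<alpha>) * c powr (1 / \<alpha>) = (c / G) powr (1 / \<alpha>)"
    using assms by (simp add: powr_divide powr_minus_divide)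
  also have "(c / G) powr (1 / \<alpha>) \<le> x \<longleftrightarrow> c / G \<le> x powr \<alpha>"
  proof
    assume "(c / G) powr (1 / \<alpha>) \<le> x"
    then have "((c / G) powr (1 / \<alpha>)) powr \<alpha> \<le> x powr \<alpha>" using assms by (intro powr_mono2) auto
    then show "c / G \<le> x powr \<alpha>" using assms by (simp add: powr_powr)
  next
    assume "c / G \<le> x powr \<alpha>"
    then have "(c / G) powr (1 / \<alpha>) \<le> (x powr \<alpha>) powr (1 / \<alpha>)" using assms by (intro powr_mono2) auto
    then show "(c / G) powr (1 / \<alpha>) \<le> x" using assms by (simp add: powr_powr)
  qed
  also have "\<dots> \<longleftrightarrow> c * x powr (- \<alpha>) \<le> G"
    using assms by (simp add: powr_minus field_simps)
  also have "\<dots> \<longleftrightarrow> ennreal c * ennreal (x powr (- \<alpha>)) \<le> ennreal G"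
    using assms by (simp add: ennreal_mult[symmetric])
  finally show ?thesis .
qed

text \<open>
  The point \<open>(\<Gamma>\<^sub>l, T\<^sub>l)\<close> violates a constraint if and only if \<open>\<Gamma>\<^sub>l < g (T\<^sub>l)\<close>, where
  \<open>g = \<psi> x\<^sub>i\<^sup>-\<^sup>\<alpha>\<close> on \<open>A\<^sub>i\<close> and \<open>g = 0\<close> elsewhere; hence the event is a void event.
\<close>

lemma series_measure_joint_cdf:
  assumes V: "void_law Q m \<Gamma> T" and mu: "mu = density m \<psi>" "finite_measure mu"
    and \<psi>[measurable]: "\<psi> \<in> borel_measurable m" and \<psi>pos: "AE a in m. 0 < \<psi> a \<and> \<psi> a < \<infinity>" and \<alpha>: "0 < \<alpha>"
    and J: "finite J" "disjoint_family_on A J" "\<And>i. i \<in> J \<Longrightarrow> A i \<in> sets mu" and x: "\<And>i. i \<in> J \<Longrightarrow> 0 < x i"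
  shows "measure Q {\<omega> \<in> space Q. \<forall>i\<in>J. series_measure \<alpha> \<psi> \<Gamma> T (A i) \<omega> \<le> ennreal (x i)}
    = exp (- (\<Sum>i\<in>J. measure mu (A i) * x i powr (- \<alpha>)))"
proof -
  note V = void_lawD[OF V]
  interpret Q: prob_space Q by (rule V(1))
  interpret mu: finite_measure mu by fact
  have Am: "A i \<in> sets m" if "i \<in> J" for i using J(3)[OF that] by (simp add: mu(1))
  note [measurable] = V(3) V(4) Am
  define g where "g a = (\<Sum>i\<in>J. ennreal (x i powr (- \<alpha>)) * (\<psi> a * indicator (A i) a))" for a
  have [measurable]: "g \<in> borel_measurable m" unfolding g_def[abs_def] by measurable
  have int_g: "(\<integral>\<^sup>+a. g a \<partial>m) = ennreal (\<Sum>i\<in>J. measure mu (A i) * x i powr (- \<alpha>))"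
  proof -
    have "(\<integral>\<^sup>+a. g a \<partial>m) = (\<Sum>i\<in>J. ennreal (x i powr (- \<alpha>)) * (\<integral>\<^sup>+a. \<psi> a * indicator (A i) a \<partial>m))"
      unfolding g_def by (subst nn_integral_sum) (auto simp: nn_integral_cmult Am)
    also have "\<dots> = (\<Sum>i\<in>J. ennreal (x i powr (- \<alpha>)) * emeasure mu (A i))"
      unfolding mu(1) by (intro sum.cong refl) (simp add: emeasure_density Am)
    also have "\<dots> = (\<Sum>i\<in>J. ennreal (measure mu (A i) * x i powr (- \<alpha>)))"
      by (intro sum.cong refl) (simp add: mu.emeasure_eq_measure ennreal_mult mult.commute)
    finally show ?thesis by (simp add: sum_ennreal)
  qed
  have \<psi>T: "AE \<omega> in Q. \<forall>l. 0 < \<psi> (T l \<omega>) \<and> \<psi> (T l \<omega>) < \<infinity>"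
  proof (unfold AE_all_countable, rule allI)
    fix l
    have "AE a in distr Q m (T l). 0 < \<psi> a \<and> \<psi> a < \<infinity>" unfolding V(6) by (rule \<psi>pos)
    then show "AE \<omega> in Q. 0 < \<psi> (T l \<omega>) \<and> \<psi> (T l \<omega>) < \<infinity>" by (rule AE_distrD[rotated]) (rule V(4))
  qed
  have [measurable]: "point_mass \<alpha> \<psi> \<Gamma> T l \<in> borel_measurable Q" for l
    by (rule measurable_point_mass[OF V(3) V(4) \<psi>])
  have [measurable]: "series_measure \<alpha> \<psi> \<Gamma> T (A i) \<in> borel_measurable Q" if "i \<in> J" for i
    using Am[OF that] unfolding series_measure_def[abs_def] by measurable
  have "AE \<omega> in Q. (\<forall>i\<in>J. series_measure \<alpha> \<psi> \<Gamma> T (A i) \<omega> \<le> ennreal (x i)) \<longleftrightarrow> (\<forall>l. g (T l \<omega>) \<le> ennreal (\<Gamma> l \<omega>))"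
    using V(5) \<psi>T
  proof eventually_elim
    case (elim \<omega>)
    have "(\<forall>i\<in>J. point_mass \<alpha> \<psi> \<Gamma> T l \<omega> * indicator (A i) (T l \<omega>) \<le> ennreal (x i)) \<longleftrightarrow> g (T l \<omega>) \<le> ennreal (\<Gamma> l \<omega>)" for l
    proof (cases "\<exists>i\<in>J. T l \<omega> \<in> A i")
      case True
      then obtain i where i: "i \<in> J" "T l \<omega> \<in> A i" by blast
      have other: "T l \<omega> \<notin> A i'" if "i' \<in> J" "i' \<noteq> i" for i'
        using J(2) i that by (auto simp: disjoint_family_on_def)
      have gi: "g (T l \<omega>) = ennreal (x i powr (- \<alpha>)) * \<psi> (T l \<omega>)"
      proof -
        have "g (T l \<omega>) = (\<Sum>i'\<in>J. if i' = i then ennreal (x i powr (- \<alpha>)) * \<psi> (T l \<omega>) else 0)"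
          unfolding g_def using other i by (intro sum.cong) auto
        then show ?thesis using i(1) J(1) by simp
      qed
      obtain c where c: "0 < c" "\<psi> (T l \<omega>) = ennreal c"
        using elim(2)[rule_format, of l] by (cases "\<psi> (T l \<omega>)") (auto simp: ennreal_less_zero_iff)
      have "(\<forall>i\<in>J. point_mass \<alpha> \<psi> \<Gamma> T l \<omega> * indicator (A i) (T l \<omega>) \<le> ennreal (x i)) \<longleftrightarrow> point_mass \<alpha> \<psi> \<Gamma> T l \<omega> \<le> ennreal (x i)"
        using i other by (auto split: split_indicator)
      also have "\<dots> \<longleftrightarrow> g (T l \<omega>) \<le> ennreal (\<Gamma> l \<omega>)"
        unfolding gi point_mass_def c(2) using point_threshold[of \<alpha> "\<Gamma> l \<omega>" c "x i"] \<alpha> elim(1) c(1) x[OF i(1)]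
        by (simp add: mult.commute)
      finally show ?thesis .
    next
      case False
      then have "g (T l \<omega>) = 0" unfolding g_def by (intro sum.neutral) auto
      then show ?thesis using False by auto
    qed
    then show ?case unfolding series_measure_def SUP_le_iff by blast
  qed
  then have "measure Q {\<omega> \<in> space Q. \<forall>i\<in>J. series_measure \<alpha> \<psi> \<Gamma> T (A i) \<omega> \<le> ennreal (x i)}
    = measure Q {\<omega> \<in> space Q. \<forall>l. g (T l \<omega>) \<le> ennreal (\<Gamma> l \<omega>)}"
  proof (intro Q.finite_measure_eq_AE)
    show "{\<omega> \<in> space Q. \<forall>i\<in>J. series_measure \<alpha> \<psi> \<Gamma> T (A i) \<omega> \<le> ennreal (x i)} \<in> sets Q"
      using J(1) by (intro sets.sets_Collect_finite_All) measurable
  qed (auto elim!: eventually_mono)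
  also have "\<dots> = exp (- (\<Sum>i\<in>J. measure mu (A i) * x i powr (- \<alpha>)))"
    using V(7)[of g] int_g by (simp add: Q.emeasure_eq_measure sum_nonneg)
  finally show ?thesis .
qed

text \<open>
  The joint distribution function of the values on disjoint sets factorises, which gives the marginal
  laws and independence; the axiom on countable unions holds in every sample point.
\<close>

lemma frechet_series_measure:
  assumes V: "void_law Q m \<Gamma> T" and mu: "mu = density m \<psi>" "finite_measure mu"
    and \<psi>[measurable]: "\<psi> \<in> borel_measurable m" and \<psi>pos: "AE a in m. 0 < \<psi> a \<and> \<psi> a < \<infinity>" and \<alpha>: "0 < \<alpha>"
  shows "frechet_sup_measure Q mu \<alpha> (series_measure \<alpha> \<psi> \<Gamma> T)"
proof -
  let ?N = "series_measure \<alpha> \<psi> \<Gamma> T"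
  note cdf = series_measure_joint_cdf[OF V mu \<psi> \<psi>pos \<alpha>]
  interpret Q: prob_space Q by (rule void_lawD(1)[OF V])
  interpret mu: finite_measure mu by fact
  have N[measurable]: "?N A \<in> borel_measurable Q" if "A \<in> sets mu" for A
  proof -
    have [measurable]: "A \<in> sets m" using that by (simp add: mu(1))
    note [measurable] = void_lawD(3,4)[OF V] measurable_point_mass[OF void_lawD(3,4)[OF V] \<psi>]
    show ?thesis unfolding series_measure_def[abs_def] by measurable
  qed
  have marginal: "measure Q {\<omega> \<in> space Q. ?N A \<omega> \<le> ennreal x} = exp (- (measure mu A * x powr (- \<alpha>)))"
    if "A \<in> sets mu" "0 < x" for A x
    using cdf[of "{()}" "\<lambda>_. A" "\<lambda>_. x"] that by (simp add: disjoint_family_on_def)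
  have indep: "Q.indep_vars (\<lambda>_. borel) (\<lambda>i. ?N (A i)) {..<n}"
    if A: "\<forall>i<n. A i \<in> sets mu" "disjoint_family_on A {..<n}" for n :: nat and A
  proof (cases "n = 0")
    case True
    then show ?thesis by (simp add: Q.indep_vars_def2 Q.indep_sets_def)
  next
    case False
    show ?thesis
    proof (subst Q.indep_vars_finite[where E="\<lambda>_. ennreal_cuts"])
      show "\<forall>B\<in>{..<n} \<rightarrow> ennreal_cuts. Q.prob (\<Inter>j\<in>{..<n}. ?N (A j) -` B j \<inter> space Q)
        = (\<Prod>j<n. Q.prob (?N (A j) -` B j \<inter> space Q))"
      proof
        fix B assume B: "B \<in> {..<n} \<rightarrow> ennreal_cuts"
        \<comment> \<open>Only the coordinates in \<open>J\<close> are constrained.\<close>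
        define J where "J = {j. j < n \<and> B j \<noteq> UNIV}"
        have J: "finite J" "J \<subseteq> {..<n}" by (auto simp: J_def)
        have "\<forall>j\<in>J. \<exists>x>0. B j = {..ennreal x}"
          using B by (auto simp: J_def ennreal_cuts_def Pi_iff)
        then obtain x where x: "\<And>j. j \<in> J \<Longrightarrow> 0 < x j" "\<And>j. j \<in> J \<Longrightarrow> B j = {..ennreal (x j)}" by metis
        have AJ: "A j \<in> sets mu" if "j \<in> J" for j using that J A(1) by auto
        have "(\<Inter>j\<in>{..<n}. ?N (A j) -` B j \<inter> space Q) = {\<omega> \<in> space Q. \<forall>j\<in>J. ?N (A j) \<omega> \<le> ennreal (x j)}"
        proof (intro set_eqI iffI)
          fix \<omega> assume "\<omega> \<in> (\<Inter>j\<in>{..<n}. ?N (A j) -` B j \<inter> space Q)"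
          then have *: "?N (A j) \<omega> \<in> B j \<and> \<omega> \<in> space Q" if "j < n" for j
            unfolding INT_iff using that by simp
          then have "\<omega> \<in> space Q" "\<forall>j<n. ?N (A j) \<omega> \<in> B j" using *[of 0] False by auto
          then show "\<omega> \<in> {\<omega> \<in> space Q. \<forall>j\<in>J. ?N (A j) \<omega> \<le> ennreal (x j)}"
            using x(2) J(2) by fastforce
        next
          fix \<omega> assume \<omega>: "\<omega> \<in> {\<omega> \<in> space Q. \<forall>j\<in>J. ?N (A j) \<omega> \<le> ennreal (x j)}"
          have "?N (A j) \<omega> \<in> B j" if "j < n" for j
            using \<omega> x(2)[of j] that by (cases "j \<in> J") (auto simp: J_def)
          then show "\<omega> \<in> (\<Inter>j\<in>{..<n}. ?N (A j) -` B j \<inter> space Q)" using \<omega> unfolding INT_iff by simp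
        qed
        then have "Q.prob (\<Inter>j\<in>{..<n}. ?N (A j) -` B j \<inter> space Q) = exp (- (\<Sum>j\<in>J. measure mu (A j) * x j powr (- \<alpha>)))"
          using cdf[OF J(1) disjoint_family_on_mono[OF J(2) A(2)] AJ x(1)] by simp
        also have "\<dots> = (\<Prod>j\<in>J. exp (- (measure mu (A j) * x j powr (- \<alpha>))))"
          using J(1) by (simp add: exp_sum sum_negf[symmetric])
        also have "\<dots> = (\<Prod>j\<in>J. Q.prob (?N (A j) -` B j \<inter> space Q))"
        proof (rule prod.cong[OF refl])
          fix j assume j: "j \<in> J"
          have "?N (A j) -` B j \<inter> space Q = {\<omega> \<in> space Q. ?N (A j) \<omega> \<le> ennreal (x j)}"
            using x(2)[OF j] by auto
          then show "exp (- (measure mu (A j) * x j powr (- \<alpha>))) = Q.prob (?N (A j) -` B j \<inter> space Q)"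
            using marginal[OF AJ[OF j] x(1)[OF j]] by simp
        qed
        also have "\<dots> = (\<Prod>j<n. Q.prob (?N (A j) -` B j \<inter> space Q))"
          by (rule prod.mono_neutral_left) (auto simp: J_def Q.prob_space)
        finally show "Q.prob (\<Inter>j\<in>{..<n}. ?N (A j) -` B j \<inter> space Q) = (\<Prod>j<n. Q.prob (?N (A j) -` B j \<inter> space Q))" .
      qed
    qed (use False A(1) in \<open>auto simp: sets_borel_ennreal_cuts Int_stable_ennreal_cuts ennreal_cuts_def[THEN eqset_imp_iff] intro!: N\<close>)
  qed
  show ?thesis
    unfolding frechet_sup_measure_def
    using Q.prob_space_axioms N indep marginal by (auto simp: series_measure_UN)
qed

section \<open>Transfer of the off-diagonal extension\<close>

text \<open>
  The properties of a series and its sup measure that are used below, apart from the moment bound; maxitivity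
  is required in every sample point, not just almost surely. Every index set \<open>I\<close> is admitted, so the empty union
  gives the value 0 on the empty set and finite unions are covered.
\<close>

definition offdiag_rep :: "'v measure \<Rightarrow> 'a measure \<Rightarrow> real \<Rightarrow> ('a set \<Rightarrow> 'v \<Rightarrow> ennreal) \<Rightarrow>
    (nat \<Rightarrow> (nat \<Rightarrow> 'a) set \<Rightarrow> 'v \<Rightarrow> ennreal) \<Rightarrow> bool" where
  "offdiag_rep Q mu \<alpha> N S \<longleftrightarrow> frechet_sup_measure Q mu \<alpha> N \<and>
    (\<forall>k. \<forall>A \<in> sets (prod_measure mu k). S k A \<in> borel_measurable Q) \<and>
    (\<forall>k (I :: nat set) B \<omega>. S k (\<Union>i\<in>I. B i) \<omega> = (SUP i\<in>I. S k (B i) \<omega>)) \<and>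
    (\<forall>k C \<omega>. disjoint_sides mu k C \<longrightarrow> S k (Pi\<^sub>E {..<k} C) \<omega> = (\<Prod>r<k. N (C r) \<omega>))"

lemma offdiag_repD:
  assumes "offdiag_rep Q mu \<alpha> N S"
  shows "frechet_sup_measure Q mu \<alpha> N"
    "\<And>k A. A \<in> sets (prod_measure mu k) \<Longrightarrow> S k A \<in> borel_measurable Q"
    "\<And>k (I :: nat set) B \<omega>. S k (\<Union>i\<in>I. B i) \<omega> = (SUP i\<in>I. S k (B i) \<omega>)"
    "\<And>k C \<omega>. disjoint_sides mu k C \<Longrightarrow> S k (Pi\<^sub>E {..<k} C) \<omega> = (\<Prod>r<k. N (C r) \<omega>)"
  using assms unfolding offdiag_rep_def by auto

lemma offdiag_rep_Un:
  assumes "offdiag_rep Q mu \<alpha> N S" shows "S k (A \<union> B) \<omega> = max (S k A \<omega>) (S k B \<omega>)"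
proof -
  have "S k (\<Union>i\<in>{0, 1::nat}. if i = 0 then A else B) \<omega> = (SUP i\<in>{0, 1::nat}. S k (if i = 0 then A else B) \<omega>)"
    by (rule offdiag_repD(3)[OF assms])
  moreover have "(\<Union>i\<in>{0, 1::nat}. if i = 0 then A else B) = A \<union> B" by auto
  ultimately show ?thesis by (simp add: sup_max)
qed

lemma offdiag_rep_mono:
  assumes "offdiag_rep Q mu \<alpha> N S" "A \<subseteq> B" shows "S k A \<omega> \<le> S k B \<omega>"
  using offdiag_rep_Un[OF assms(1), of k A B \<omega>] assms(2) by (simp add: Un_absorb1 max_def split: if_splits)

lemma offdiag_rep_rect_union:
  assumes "offdiag_rep Q mu \<alpha> N S" "\<And>i. i \<in> I \<Longrightarrow> disjoint_sides mu k (C i)"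
  shows "S k (\<Union>i\<in>I. Pi\<^sub>E {..<k} (C i)) \<omega> = (SUP i\<in>(I :: nat set). \<Prod>r<k. N (C i r) \<omega>)"
  unfolding offdiag_repD(3)[OF assms(1)]
  by (intro SUP_cong refl offdiag_repD(4)[OF assms(1)] assms(2))

lemma offdiag_rep_void_law:
  assumes V: "void_law Q m \<Gamma> T" and mu: "mu = density m \<psi>" "finite_measure mu"
    and \<psi>: "\<psi> \<in> borel_measurable m" and \<psi>pos: "AE a in m. 0 < \<psi> a \<and> \<psi> a < \<infinity>" and \<alpha>: "0 < \<alpha>"
  shows "offdiag_rep Q mu \<alpha> (series_measure \<alpha> \<psi> \<Gamma> T) (series_rep \<alpha> \<psi> \<Gamma> T)"
  unfolding offdiag_rep_def
proof (intro conjI allI ballI impI)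
  show "frechet_sup_measure Q mu \<alpha> (series_measure \<alpha> \<psi> \<Gamma> T)"
    by (rule frechet_series_measure[OF V mu \<psi> \<psi>pos \<alpha>])
  have "sets (prod_measure mu k) = sets (prod_measure m k)" for k
    by (intro sets_PiM_cong) (simp_all add: mu(1))
  then show "series_rep \<alpha> \<psi> \<Gamma> T k A \<in> borel_measurable Q" if "A \<in> sets (prod_measure mu k)" for k A
    using that by (intro measurable_series_rep[OF void_lawD(3,4)[OF V] \<psi>]) simp
next
  show "series_rep \<alpha> \<psi> \<Gamma> T k (\<Union>i\<in>I. B i) \<omega> = (SUP i\<in>I. series_rep \<alpha> \<psi> \<Gamma> T k (B i) \<omega>)" for k \<omega> B and I :: "nat set"
    by (rule series_rep_UN)
  show "series_rep \<alpha> \<psi> \<Gamma> T k (Pi\<^sub>E {..<k} C) \<omega> = (\<Prod>r<k. series_measure \<alpha> \<psi> \<Gamma> T (C r) \<omega>)"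
    if "disjoint_sides mu k C" for k C \<omega> using that by (rule series_rep_rect)
qed

definition moment_bound :: "'v measure \<Rightarrow> 'a measure \<Rightarrow> real \<Rightarrow> (nat \<Rightarrow> real \<Rightarrow> real \<Rightarrow> real) \<Rightarrow>
    (nat \<Rightarrow> (nat \<Rightarrow> 'a) set \<Rightarrow> 'v \<Rightarrow> ennreal) \<Rightarrow> nat \<Rightarrow> (nat \<Rightarrow> 'a) set \<Rightarrow> bool" where
  "moment_bound Q mu \<alpha> c S k A \<longleftrightarrow> (\<forall>\<gamma> r. 0 < \<gamma> \<and> \<gamma> < \<alpha> \<and> \<alpha> < r \<longrightarrow>
     Lnorm Q \<gamma> (S k A) \<le> ennreal (c k r \<gamma> * measure (prod_measure mu k) A powr (1 / r)))"

lemma prod_measure_scale: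
  assumes m: "prob_space m" and mu: "mu = density m (\<lambda>_. ennreal b)" and b: "0 \<le> b"
    and A: "A \<in> sets (prod_measure mu k)"
  shows "emeasure (prod_measure mu k) A = ennreal (b ^ k) * emeasure (prod_measure m k) A"
proof -
  interpret m: prob_space m by fact
  have emu: "emeasure mu B = ennreal b * emeasure m B" if "B \<in> sets m" for B
    using that by (simp add: mu emeasure_density nn_integral_cmult_indicator)
  have "space mu = space m" by (simp add: mu)
  then have "emeasure mu (space mu) = ennreal b" using emu[OF sets.top] by (simp add: m.emeasure_space_1)
  then interpret mu: finite_measure mu by (intro finite_measureI) simp
  interpret pm: product_sigma_finite "\<lambda>_. m" by unfold_locales
  interpret pmu: product_sigma_finite "\<lambda>_. mu" by unfold_locales
  have sets_eq: "sets (prod_measure m k) = sets (prod_measure mu k)"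
    by (intro sets_PiM_cong) (simp_all add: mu)
  have "density (prod_measure m k) (\<lambda>_. ennreal (b ^ k)) = prod_measure mu k"
  proof (rule pmu.PiM_eqI)
    fix B :: "nat \<Rightarrow> 'a set" assume "\<And>i. i \<in> {..<k} \<Longrightarrow> B i \<in> sets mu"
    then have B: "\<And>i. i \<in> {..<k} \<Longrightarrow> B i \<in> sets m" by (simp add: mu)
    then have "emeasure (density (prod_measure m k) (\<lambda>_. ennreal (b ^ k))) (Pi\<^sub>E {..<k} B)
      = ennreal (b ^ k) * (\<Prod>i<k. emeasure m (B i))"
      using pm.emeasure_PiM[of "{..<k}" B, OF _ B]
      by (subst emeasure_density) (auto simp: nn_integral_cmult_indicator sets_PiM_I_finite)
    also have "\<dots> = (\<Prod>i<k. emeasure mu (B i))"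
      using B b by (simp add: emu prod.distrib ennreal_power)
    finally show "emeasure (density (prod_measure m k) (\<lambda>_. ennreal (b ^ k))) (Pi\<^sub>E {..<k} B) = (\<Prod>i<k. emeasure mu (B i))" .
  qed (simp_all add: sets_eq)
  then have "emeasure (prod_measure mu k) A = emeasure (density (prod_measure m k) (\<lambda>_. ennreal (b ^ k))) A" by simp
  also have "\<dots> = ennreal (b ^ k) * emeasure (prod_measure m k) A"
    using A by (simp add: emeasure_density nn_integral_cmult_indicator sets_eq)
  finally show ?thesis .
qed

text \<open>
  Take for \<open>m\<close> the normalised measure \<open>\<mu> / b\<close> with \<open>b = \<mu>(E)\<close>, so that the density is the
  constant \<open>b\<close> and \<open>\<mu>\<^sup>k = b\<^sup>k m\<^sup>k\<close>.
\<close>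

lemma ex_canonical_rep:
  fixes mu :: "'a measure"
  assumes fin: "finite_measure mu" and nz: "emeasure mu (space mu) \<noteq> 0" and \<alpha>: "0 < \<alpha>"
  obtains Q :: "((nat \<Rightarrow> real) \<times> (nat \<Rightarrow> 'a)) measure" and N S c where "offdiag_rep Q mu \<alpha> N S"
    "\<And>k r \<gamma>. 0 < c k r \<gamma>"
    "\<And>k A. A \<in> sets (prod_measure mu k) \<Longrightarrow> moment_bound Q mu \<alpha> c S k A"
proof -
  interpret mu: finite_measure mu by fact
  define b where "b = measure mu (space mu)"
  have b: "0 < b" using nz by (simp add: b_def mu.emeasure_eq_measure zero_less_measure_iff)
  define m where "m = density mu (\<lambda>_. ennreal (1 / b))"
  have m: "prob_space m"
  proof
    show "emeasure m (space m) = 1"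
      using b by (simp add: m_def emeasure_density mu.emeasure_eq_measure b_def[symmetric] ennreal_mult[symmetric])
  qed
  have mu_eq: "mu = density m (\<lambda>_. ennreal b)"
    unfolding m_def using b by (subst density_density_eq) (auto simp: ennreal_mult[symmetric] density_1)
  define S :: "nat \<Rightarrow> (nat \<Rightarrow> 'a) set \<Rightarrow> (nat \<Rightarrow> real) \<times> (nat \<Rightarrow> 'a) \<Rightarrow> ennreal"
    where "S = canonical_series \<alpha> (ennreal b)"
  define B where "B k r \<gamma> = b powr (real k * (\<gamma> / \<alpha>)) * exp (1 / (1 - \<gamma> / \<alpha>) + 1 / (r / \<alpha> - 1)) * (1 + real (k ^ k))" for k r \<gamma>
  define c where "c k r \<gamma> = B k r \<gamma> powr (1 / \<gamma>) * (1 / b ^ k) powr (1 / r)" for k r \<gamma>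
  have B: "0 < B k r \<gamma>" for k r \<gamma>
    using b by (simp add: B_def add_pos_nonneg)
  show ?thesis
  proof (rule that)
    show "offdiag_rep (marked_space m) mu \<alpha> (series_measure \<alpha> (\<lambda>_. ennreal b) (\<lambda>i x. arrival (Suc i) (fst x)) (\<lambda>i x. snd x i)) S"
      unfolding S_def using b by (intro offdiag_rep_void_law[OF void_law_marked_space[OF m] mu_eq fin _ _ \<alpha>]) auto
    show "0 < c k r \<gamma>" for k r \<gamma>
      using B[of k r \<gamma>] b by (simp add: c_def)
    fix k A assume A: "A \<in> sets (prod_measure mu k)"
    interpret mk: prob_space "prod_measure m k" by (intro prob_space_PiM m)
    interpret muk: finite_measure "prod_measure mu k" by (rule finite_measure_prod_measure[OF fin])
    have sets_eq: "sets (prod_measure m k) = sets (prod_measure mu k)"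
      by (intro sets_PiM_cong) (simp_all add: m_def)
    have ma: "measure (prod_measure m k) A = measure (prod_measure mu k) A * (1 / b ^ k)"
      using prod_measure_scale[OF m mu_eq _ A] b
      by (simp add: mk.emeasure_eq_measure muk.emeasure_eq_measure ennreal_mult[symmetric])
    show "moment_bound (marked_space m) mu \<alpha> c S k A"
      unfolding moment_bound_def
    proof (intro allI impI, elim conjE)
      fix \<gamma> r assume \<gamma>: "0 < \<gamma>" "\<gamma> < \<alpha>" and r: "\<alpha> < r"
      have "Lnorm (marked_space m) \<gamma> (S k A) \<le> epowr (ennreal (B k r \<gamma> * measure (prod_measure m k) A powr (\<gamma> / r))) (1 / \<gamma>)"
        unfolding Lnorm_def S_def B_def using \<gamma> A
        by (intro epowr_mono canonical_series_moment[OF m b \<gamma> r]) (auto simp: sets_eq)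
      also have "\<dots> = ennreal ((B k r \<gamma> * measure (prod_measure m k) A powr (\<gamma> / r)) powr (1 / \<gamma>))"
        using B[of k r \<gamma>] by (intro epowr_ennreal) simp
      also have "(B k r \<gamma> * measure (prod_measure m k) A powr (\<gamma> / r)) powr (1 / \<gamma>)
          = B k r \<gamma> powr (1 / \<gamma>) * measure (prod_measure m k) A powr (1 / r)"
        using B[of k r \<gamma>] \<gamma> by (simp add: powr_mult powr_powr)
      also have "\<dots> = c k r \<gamma> * measure (prod_measure mu k) A powr (1 / r)"
        unfolding ma c_def using b by (simp add: powr_mult powr_divide)
      finally show "Lnorm (marked_space m) \<gamma> (S k A) \<le> ennreal (c k r \<gamma> * measure (prod_measure mu k) A powr (1 / r))" .
    qed
  qed
qed

lemma Lnorm_law_transfer: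
  assumes M: "frechet_sup_measure P mu \<alpha> M" and N: "frechet_sup_measure Q mu \<alpha> N"
    and \<Phi>: "\<Phi> \<in> borel_measurable (path_space mu)"
  shows "Lnorm P \<gamma> (\<lambda>\<omega>. \<Phi> (path mu M \<omega>)) = Lnorm Q \<gamma> (\<lambda>\<omega>. \<Phi> (path mu N \<omega>))"
proof -
  have *: "(\<integral>\<^sup>+\<omega>. epowr (\<Phi> (path mu M \<omega>)) \<gamma> \<partial>P)
    = (\<integral>\<^sup>+x. epowr x \<gamma> \<partial>distr P borel (\<lambda>\<omega>. \<Phi> (path mu M \<omega>)))"
    if "frechet_sup_measure P mu \<alpha> M" for P :: "'x measure" and M
  proof -
    have "(\<lambda>\<omega>. path mu M \<omega>) \<in> measurable P (path_space mu)"
      using frechetD(2)[OF that] by (intro measurable_restrict) auto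
    from measurable_compose[OF this \<Phi>] show ?thesis by (subst nn_integral_distr) auto
  qed
  show ?thesis
    unfolding Lnorm_def *[OF M] *[OF N] frechet_law_transfer[OF M N \<Phi>] ..
qed

text \<open>
  For sides \<open>C i\<close> with \<open>i \<in> I\<close> and \<open>x = M\<close> this is the value of the extension on the union of the
  corresponding rectangles, as a function of the values on \<open>\<E>\<close>.
\<close>

definition rect_sup :: "nat \<Rightarrow> nat set \<Rightarrow> (nat \<Rightarrow> nat \<Rightarrow> 'a set) \<Rightarrow> ('a set \<Rightarrow> ennreal) \<Rightarrow> ennreal" where
  "rect_sup k I C x = (SUP i\<in>I. \<Prod>r<k. x (C i r))"

lemma measurable_rect_sup:
  assumes "\<And>i. i \<in> I \<Longrightarrow> disjoint_sides mu k (C i)"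
  shows "rect_sup k I C \<in> borel_measurable (path_space mu)"
  unfolding rect_sup_def[abs_def] using assms
  by (intro borel_measurable_SUP borel_measurable_prod_ennreal measurable_component_singleton)
     (auto simp: disjoint_sides_def)

lemma rect_sup_restrict:
  assumes "\<And>i. i \<in> I \<Longrightarrow> disjoint_sides mu k (C i)"
  shows "rect_sup k I C (path mu M \<omega>) = (SUP i\<in>I. \<Prod>r<k. M (C i r) \<omega>)"
  unfolding rect_sup_def using assms by (intro SUP_cong prod.cong refl) (auto simp: disjoint_sides_def)

lemma rect_sup_rep:
  assumes "offdiag_rep Q mu \<alpha> N S" "\<And>i. i \<in> I \<Longrightarrow> disjoint_sides mu k (C i)"
  shows "rect_sup k I C (path mu N \<omega>) = S k (\<Union>i\<in>I. Pi\<^sub>E {..<k} (C i)) \<omega>"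
  using rect_sup_restrict[OF assms(2)] offdiag_rep_rect_union[OF assms] by simp

text \<open>
  On countable unions of off-diagonal rectangles the law of the extension is determined by that of the
  sup measure, so the bound carries over. An arbitrary set is covered by such a union of almost the same
  measure, and the extension is monotone.
\<close>

lemma moment_bound_transfer:
  assumes iso: "borel_iso_space mu" and fin: "finite_measure mu"
    and R0: "offdiag_rep Q0 mu \<alpha> N0 S0" and c: "\<And>k r \<gamma>. 0 < c k r \<gamma>"
    and b0: "\<And>k A. A \<in> sets (prod_measure mu k) \<Longrightarrow> moment_bound Q0 mu \<alpha> c S0 k A"
    and R: "offdiag_rep Q mu \<alpha> N S" and k: "1 \<le> k" and A: "A \<in> offdiag_sets mu k"
  shows "moment_bound Q mu \<alpha> c S k A"
  unfolding moment_bound_def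
proof (intro allI impI, elim conjE)
  fix \<gamma> r assume \<gamma>: "0 < \<gamma>" "\<gamma> < \<alpha>" and r: "\<alpha> < r"
  let ?mk = "measure (prod_measure mu k)"
  interpret muk: finite_measure "prod_measure mu k" by (rule finite_measure_prod_measure[OF fin])
  have A': "A \<in> sets (prod_measure mu k)" using A by (simp add: offdiag_sets_iff[OF iso])
  have "Lnorm Q \<gamma> (S k A) \<le> ennreal (c k r \<gamma> * (?mk A + 1 / real (Suc n)) powr (1 / r))" for n
  proof -
    obtain C :: "nat \<Rightarrow> nat \<Rightarrow> 'a set" where C: "\<forall>i. disjoint_sides mu k (C i)" "A \<subseteq> (\<Union>i. Pi\<^sub>E {..<k} (C i))"
      "?mk ((\<Union>i. Pi\<^sub>E {..<k} (C i)) - A) < 1 / real (Suc n)"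
      using offdiag_outer_approx[OF iso fin k A, of "1 / real (Suc n)"] by auto
    define G where "G = (\<Union>i. Pi\<^sub>E {..<k} (C i))"
    have rects: "Pi\<^sub>E {..<k} (C i) \<in> sets (prod_measure mu k)" for i
      using C(1) by (intro offdiag_rects_sets) (auto simp: offdiag_rects_def)
    have Gm: "G \<in> sets (prod_measure mu k)" unfolding G_def using rects by blast
    have "Lnorm Q \<gamma> (S k A) \<le> Lnorm Q \<gamma> (S k G)"
      using \<gamma> C(2) by (intro Lnorm_mono_AE AE_I2 offdiag_rep_mono[OF R]) (auto simp: G_def)
    also have "\<dots> = Lnorm Q \<gamma> (\<lambda>\<omega>. rect_sup k UNIV C (path mu N \<omega>))"
      using rect_sup_rep[OF R, of UNIV k C] C(1) by (simp add: G_def)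
    also have "\<dots> = Lnorm Q0 \<gamma> (\<lambda>\<omega>. rect_sup k UNIV C (path mu N0 \<omega>))"
      using C(1) by (intro Lnorm_law_transfer[OF offdiag_repD(1)[OF R] offdiag_repD(1)[OF R0]] measurable_rect_sup) auto
    also have "\<dots> = Lnorm Q0 \<gamma> (S0 k G)"
      using rect_sup_rep[OF R0, of UNIV k C] C(1) by (simp add: G_def)
    also have "\<dots> \<le> ennreal (c k r \<gamma> * ?mk G powr (1 / r))"
      using b0[OF Gm] \<gamma> r unfolding moment_bound_def by blast
    also have "\<dots> \<le> ennreal (c k r \<gamma> * (?mk A + 1 / real (Suc n)) powr (1 / r))"
    proof -
      have "?mk G \<le> ?mk A + ?mk (G - A)"
        using measure_Un_le[of A "prod_measure mu k" "G - A"] A' Gm C(2) by (simp add: G_def Un_absorb1)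
      also have "\<dots> \<le> ?mk A + 1 / real (Suc n)" using C(3) by (simp add: G_def)
      finally show ?thesis
        using c[of k r \<gamma>] \<gamma> r by (intro ennreal_leI mult_left_mono powr_mono2) auto
    qed
    finally show ?thesis .
  qed
  moreover have "(\<lambda>n. ennreal (c k r \<gamma> * (?mk A + 1 / real (Suc n)) powr (1 / r))) \<longlonglongrightarrow> ennreal (c k r \<gamma> * (?mk A + 0) powr (1 / r))"
    using \<gamma> r by (intro tendsto_ennrealI tendsto_mult tendsto_const tendsto_powr' tendsto_add LIMSEQ_Suc[OF lim_1_over_n]) auto
  ultimately have "Lnorm Q \<gamma> (S k A) \<le> ennreal (c k r \<gamma> * (?mk A + 0) powr (1 / r))"
    by (intro LIMSEQ_le_const) auto
  then show "Lnorm Q \<gamma> (S k A) \<le> ennreal (c k r \<gamma> * ?mk A powr (1 / r))" by simp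
qed

definition outer_cover :: "'a measure \<Rightarrow> nat \<Rightarrow> (nat \<Rightarrow> 'a) set \<Rightarrow> (nat \<Rightarrow> nat \<Rightarrow> nat \<Rightarrow> 'a set) \<Rightarrow> bool" where
  "outer_cover mu k A C \<longleftrightarrow> (\<forall>n i. disjoint_sides mu k (C n i)) \<and> (\<forall>n. A \<subseteq> (\<Union>i. Pi\<^sub>E {..<k} (C n i))) \<and>
     (\<forall>n. measure (prod_measure mu k) ((\<Union>i. Pi\<^sub>E {..<k} (C n i)) - A) < 1 / real (Suc n))"

text \<open>
  One outer cover is fixed for each set, so that the same functional of the values on \<open>\<E>\<close> serves all
  probability spaces.
\<close>

definition cover :: "'a measure \<Rightarrow> nat \<Rightarrow> (nat \<Rightarrow> 'a) set \<Rightarrow> nat \<Rightarrow> nat \<Rightarrow> nat \<Rightarrow> 'a set" where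
  "cover mu k A = (SOME C. outer_cover mu k A C)"

lemma outer_cover_cover:
  fixes mu :: "'a measure"
  assumes iso: "borel_iso_space mu" and fin: "finite_measure mu" and k: "1 \<le> k" and A: "A \<in> offdiag_sets mu k"
  shows "outer_cover mu k A (cover mu k A)"
proof -
  define good where "good n C \<longleftrightarrow> (\<forall>i. disjoint_sides mu k (C i)) \<and> A \<subseteq> (\<Union>i. Pi\<^sub>E {..<k} (C i)) \<and>
    measure (prod_measure mu k) ((\<Union>i. Pi\<^sub>E {..<k} (C i)) - A) < 1 / real (Suc n)" for n and C :: "nat \<Rightarrow> nat \<Rightarrow> 'a set"
  have "\<exists>C. good n C" for n
    unfolding good_def by (rule offdiag_outer_approx[OF iso fin k A]) simp
  then obtain C where "\<And>n. good n (C n)" by metis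
  then have "outer_cover mu k A C" unfolding outer_cover_def good_def by blast
  then show ?thesis unfolding cover_def by (rule someI[of "outer_cover mu k A"])
qed

text \<open>
  Evaluated at the values of a Frechet sup measure this is the extension to \<open>A\<close>.
\<close>

definition outer_value :: "'a measure \<Rightarrow> nat \<Rightarrow> (nat \<Rightarrow> 'a) set \<Rightarrow> ('a set \<Rightarrow> ennreal) \<Rightarrow> ennreal" where
  "outer_value mu k A x = (INF n. rect_sup k UNIV (cover mu k A n) x)"

lemma measurable_outer_value:
  assumes "borel_iso_space mu" "finite_measure mu" "1 \<le> k" "A \<in> offdiag_sets mu k"
  shows "outer_value mu k A \<in> borel_measurable (path_space mu)"
  unfolding outer_value_def[abs_def] using outer_cover_cover[OF assms]
  by (intro borel_measurable_INF measurable_rect_sup) (auto simp: outer_cover_def)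

lemma INF_max_eq:
  fixes a :: ennreal assumes "(INF n. b n) = 0" shows "(INF n::nat. max a (b n)) = a"
proof (rule antisym)
  show "(INF n. max a (b n)) \<le> a"
  proof (rule dense_ge)
    fix y assume y: "a < y"
    then have "(INF n. b n) < y" using assms by (simp add: zero_less_iff_neq_zero) auto
    then obtain n where "b n < y" by (auto simp: INF_less_iff)
    then have "max a (b n) \<le> y" using y by (simp add: less_imp_le)
    then show "(INF n. max a (b n)) \<le> y" by (rule INF_lower2[OF UNIV_I])
  qed
qed (auto intro: INF_greatest)

text \<open>
  With \<open>G n\<close> the covers of \<open>A\<close>, maxitivity gives
  \<open>S(G n) = max (S(A)) (S(G n - A))\<close>. By the moment bound the infimum \<open>L\<close> of the second terms has
  \<open>L\<^sup>\<gamma>\<close> norm 0, hence vanishes almost surely. Any admissible \<open>\<gamma>\<close> and \<open>r\<close> serve here.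
\<close>

lemma offdiag_rep_outer_value:
  assumes iso: "borel_iso_space mu" and fin: "finite_measure mu" and \<alpha>: "0 < \<alpha>"
    and R: "offdiag_rep Q mu \<alpha> N S" and c: "\<And>k r \<gamma>. 0 < c k r \<gamma>"
    and b: "\<And>A. A \<in> offdiag_sets mu k \<Longrightarrow> moment_bound Q mu \<alpha> c S k A"
    and k: "1 \<le> k" and A: "A \<in> offdiag_sets mu k"
  shows "AE \<omega> in Q. outer_value mu k A (path mu N \<omega>) = S k A \<omega>"
proof -
  let ?mk = "measure (prod_measure mu k)"
  define G where "G n = (\<Union>i. Pi\<^sub>E {..<k} (cover mu k A n i))" for n
  have C: "\<And>n i. disjoint_sides mu k (cover mu k A n i)" "\<And>n. A \<subseteq> G n" "\<And>n. ?mk (G n - A) < 1 / real (Suc n)"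
    using outer_cover_cover[OF iso fin k A] by (auto simp: outer_cover_def G_def)
  have rects: "Pi\<^sub>E {..<k} (cover mu k A n i) \<in> offdiag_rects mu k" for n i
    using C(1) by (auto simp: offdiag_rects_def)
  have Gm: "G n \<in> offdiag_sets mu k" for n
    unfolding offdiag_sets_iff[OF iso] G_def using offdiag_rects_sets[OF rects] offdiag_rects_subset[OF rects] by blast
  have GA: "G n - A \<in> offdiag_sets mu k" for n
    using Gm[of n] A unfolding offdiag_sets_iff[OF iso] by auto
  have [measurable]: "S k (G n - A) \<in> borel_measurable Q" for n
    using GA[of n] by (intro offdiag_repD(2)[OF R]) (simp add: offdiag_sets_iff[OF iso])
  define \<gamma> where "\<gamma> = \<alpha> / 2"
  define r where "r = 2 * \<alpha>"
  have \<gamma>: "0 < \<gamma>" "\<gamma> < \<alpha>" and r: "\<alpha> < r" using \<alpha> by (auto simp: \<gamma>_def r_def)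
  define L where "L \<omega> = (INF n. S k (G n - A) \<omega>)" for \<omega>
  have [measurable]: "L \<in> borel_measurable Q" unfolding L_def[abs_def] by measurable
  have "Lnorm Q \<gamma> L \<le> ennreal (c k r \<gamma> * (1 / real (Suc n)) powr (1 / r))" for n
  proof -
    have "Lnorm Q \<gamma> L \<le> Lnorm Q \<gamma> (S k (G n - A))"
      using \<gamma> by (intro Lnorm_mono_AE) (auto simp: L_def intro: INF_lower)
    also have "\<dots> \<le> ennreal (c k r \<gamma> * ?mk (G n - A) powr (1 / r))"
      using b[OF GA] \<gamma> r unfolding moment_bound_def by blast
    also have "\<dots> \<le> ennreal (c k r \<gamma> * (1 / real (Suc n)) powr (1 / r))"
      using C(3)[of n] c[of k r \<gamma>] \<gamma> r by (intro ennreal_leI mult_left_mono powr_mono2) auto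
    finally show ?thesis .
  qed
  moreover have "(\<lambda>n. ennreal (c k r \<gamma> * (1 / real (Suc n)) powr (1 / r))) \<longlonglongrightarrow> ennreal (c k r \<gamma> * 0 powr (1 / r))"
    using \<gamma> r by (intro tendsto_ennrealI tendsto_mult tendsto_const tendsto_powr' LIMSEQ_Suc[OF lim_1_over_n]) auto
  ultimately have "Lnorm Q \<gamma> L \<le> ennreal (c k r \<gamma> * 0 powr (1 / r))"
    by (intro LIMSEQ_le_const) auto
  then have "(\<integral>\<^sup>+\<omega>. epowr (L \<omega>) \<gamma> \<partial>Q) = 0" by (simp add: Lnorm_def)
  then have "AE \<omega> in Q. epowr (L \<omega>) \<gamma> = 0" by (subst (asm) nn_integral_0_iff_AE) auto
  then show ?thesis
  proof eventually_elim
    case (elim \<omega>)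
    have "outer_value mu k A (path mu N \<omega>) = (INF n. S k (G n) \<omega>)"
      unfolding outer_value_def G_def using rect_sup_rep[OF R, of UNIV k] C(1) by simp
    also have "\<dots> = (INF n. max (S k A \<omega>) (S k (G n - A) \<omega>))"
      using C(2) by (simp add: offdiag_rep_Un[OF R, symmetric] Un_absorb1)
    also have "\<dots> = S k A \<omega>" using elim by (intro INF_max_eq) (simp add: L_def)
    finally show ?case .
  qed
qed

section \<open>Existence, law and properties of the extension\<close>

lemma union_value_rect_sup:
  assumes "union_value mu M k U X"
  shows "\<exists>n C. (\<forall>i<n. disjoint_sides mu k (C i)) \<and> U = (\<Union>i<n. Pi\<^sub>E {..<k} (C i)) \<and>
    X = (\<lambda>\<omega>. rect_sup k {..<n} C (path mu M \<omega>))"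
  using assms unfolding union_value_def
proof (elim exE conjE)
  fix n :: nat and B Y
  assume U: "U = (\<Union>i<n. B i)" and BY: "\<forall>i<n. rect_value mu M k (B i) (Y i)"
    and X: "X = (\<lambda>\<omega>. SUP i\<in>{..<n}. Y i \<omega>)"
  have "\<forall>i\<in>{..<n}. \<exists>C. disjoint_sides mu k C \<and> B i = Pi\<^sub>E {..<k} C \<and> Y i = (\<lambda>\<omega>. \<Prod>r<k. M (C r) \<omega>)"
    using BY unfolding rect_value_def by simp
  from bchoice[OF this] obtain C where
    C: "\<forall>i\<in>{..<n}. disjoint_sides mu k (C i) \<and> B i = Pi\<^sub>E {..<k} (C i) \<and> Y i = (\<lambda>\<omega>. \<Prod>r<k. M (C i r) \<omega>)" ..
  show ?thesis
  proof (intro exI conjI)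
    show "\<forall>i<n. disjoint_sides mu k (C i)" using C by simp
    show "U = (\<Union>i<n. Pi\<^sub>E {..<k} (C i))" unfolding U using C by simp
    show "X = (\<lambda>\<omega>. rect_sup k {..<n} C (path mu M \<omega>))"
    proof
      fix \<omega>
      have "X \<omega> = (SUP i\<in>{..<n}. \<Prod>r<k. M (C i r) \<omega>)" unfolding X using C by (intro SUP_cong) auto
      then show "X \<omega> = rect_sup k {..<n} C (path mu M \<omega>)"
        using C by (subst rect_sup_restrict) auto
    qed
  qed
qed

lemma offdiag_unions_sets:
  assumes iso: "borel_iso_space mu" and C: "\<And>i. i \<in> I \<Longrightarrow> disjoint_sides mu k (C i)"
  shows "(\<Union>i\<in>(I :: nat set). Pi\<^sub>E {..<k} (C i)) \<in> offdiag_sets mu k"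
proof -
  have R: "Pi\<^sub>E {..<k} (C i) \<in> offdiag_rects mu k" if "i \<in> I" for i
    using C[OF that] by (auto simp: offdiag_rects_def)
  show ?thesis
    unfolding offdiag_sets_iff[OF iso]
  proof
    show "(\<Union>i\<in>I. Pi\<^sub>E {..<k} (C i)) \<in> sets (prod_measure mu k)"
      using offdiag_rects_sets[OF R] by (intro sets.countable_UN') auto
    show "(\<Union>i\<in>I. Pi\<^sub>E {..<k} (C i)) \<subseteq> offdiag_space mu k"
      using offdiag_rects_subset[OF R] by blast
  qed
qed

lemma edist_offdiag_rep_le:
  assumes R: "offdiag_rep Q mu \<alpha> N S" and fin: "S k A \<omega> < \<infinity>" "S k B \<omega> < \<infinity>"
  shows "edist_abs (S k B \<omega>) (S k A \<omega>) \<le> S k (sym_diff B A) \<omega>"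
proof (rule edist_abs_le)
  show "S k B \<omega> \<le> max (S k A \<omega>) (S k (sym_diff B A) \<omega>)"
    unfolding offdiag_rep_Un[OF R, symmetric] by (rule offdiag_rep_mono[OF R]) auto
  show "S k A \<omega> \<le> max (S k B \<omega>) (S k (sym_diff B A) \<omega>)"
    unfolding offdiag_rep_Un[OF R, symmetric] by (rule offdiag_rep_mono[OF R]) auto
qed (use fin in auto)

lemma AE_finite_of_Lnorm:
  assumes [measurable]: "X \<in> borel_measurable Q" and "Lnorm Q \<gamma> X < \<infinity>"
  shows "AE \<omega> in Q. X \<omega> < \<infinity>"
proof -
  have "(\<integral>\<^sup>+\<omega>. epowr (X \<omega>) \<gamma> \<partial>Q) < \<infinity>" using assms(2) by (simp add: Lnorm_def epowr_less_top_iff[unfolded infinity_ennreal_def])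
  then have "AE \<omega> in Q. epowr (X \<omega>) \<gamma> \<noteq> \<infinity>" by (intro nn_integral_PInf_AE) auto
  then show ?thesis by eventually_elim (auto simp: epowr_def less_top split: if_splits)
qed

lemma measurable_joint:
  assumes "frechet_sup_measure P mu \<alpha> M"
  shows "(\<lambda>\<omega>. path mu M \<omega>) \<in> measurable P (path_space mu)"
  using frechetD(2)[OF assms] by (intro measurable_restrict) auto

lemma AE_law_transfer:
  assumes M: "frechet_sup_measure P mu \<alpha> M" and N: "frechet_sup_measure Q mu \<alpha> N"
    and [measurable]: "Measurable.pred (path_space mu) p"
    and ae: "AE \<omega> in Q. p (path mu N \<omega>)"
  shows "AE \<omega> in P. p (path mu M \<omega>)"
proof -
  have p: "{x \<in> space (path_space mu). p x} \<in> sets (path_space mu)"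
    by measurable
  have "AE x in joint_law mu Q N. p x"
    unfolding joint_law_def using ae by (subst AE_distr_iff[OF measurable_joint[OF N] p]) simp
  then have "AE x in joint_law mu P M. p x" unfolding frechet_law[OF M N] .
  then show ?thesis
    unfolding joint_law_def by (subst (asm) AE_distr_iff[OF measurable_joint[OF M] p]) simp
qed

theorem theorem2p5:
  fixes mu :: "'a measure" and \<alpha> :: real
  assumes "borel_iso_space mu"
    and "finite_measure mu"
    and "emeasure mu (space mu) \<noteq> 0"
    and "0 < \<alpha>"
  shows "\<exists>c :: nat \<Rightarrow> real \<Rightarrow> real \<Rightarrow> real.
    (\<forall>k\<ge>1. \<forall>\<gamma> r. 0 < \<gamma> \<and> \<gamma> < \<alpha> \<and> \<alpha> < r \<longrightarrow> 0 < c k r \<gamma>) \<and>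
    (\<forall>(P :: 'w measure) M. frechet_sup_measure P mu \<alpha> M \<longrightarrow>
      (\<forall>k\<ge>1. \<forall>A \<in> offdiag_sets mu k.
         (\<exists>An. approx_seq mu k An A) \<and>
         (\<exists>X.
            (\<forall>\<gamma> An Xn. 0 < \<gamma> \<and> \<gamma> < \<alpha> \<and> approx_seq mu k An A \<and>
               (\<forall>n. union_value mu M k (An n) (Xn n)) \<longrightarrow> L_limit P \<gamma> Xn X) \<and>
            (\<forall>Y. offdiag_version P mu \<alpha> M k A Y \<longrightarrow> (AE \<omega> in P. Y \<omega> = X \<omega>)))) \<and>
      (\<forall>Mk. offdiag_family P mu \<alpha> M Mk \<longrightarrow>
         (\<forall>m \<psi> (Q :: 'v measure) \<Gamma> T. series_setup mu m \<psi> Q \<Gamma> T \<longrightarrow>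
            fdd_equal (SIGMA k:{1..}. offdiag_sets mu k)
              P (\<lambda>(k, A). Mk k A) Q (\<lambda>(k, A). series_rep \<alpha> \<psi> \<Gamma> T k A)) \<and>
         (\<forall>k\<ge>1. \<forall>\<gamma> r. 0 < \<gamma> \<and> \<gamma> < \<alpha> \<and> \<alpha> < r \<longrightarrow>
            (\<forall>A \<in> offdiag_sets mu k.
               Lnorm P \<gamma> (Mk k A) \<le>
                 ennreal (c k r \<gamma> * measure (prod_measure mu k) A powr (1 / r)))) \<and>
         (\<forall>k\<ge>1. \<forall>B :: nat \<Rightarrow> (nat \<Rightarrow> 'a) set. (\<forall>j. B j \<in> offdiag_sets mu k) \<longrightarrow>
            (AE \<omega> in P. Mk k (\<Union>i. B i) \<omega> = (SUP i. Mk k (B i) \<omega>)))))"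
proof -
  note iso = assms(1) and fin = assms(2) and nz = assms(3) and \<alpha> = assms(4)
  \<comment> \<open>The series with constant density on \<open>marked_space\<close>: the constant \<open>c\<close> comes from it, hence does not depend on \<open>P\<close> and \<open>M\<close>.\<close>
  obtain Q0 :: "((nat \<Rightarrow> real) \<times> (nat \<Rightarrow> 'a)) measure" and N0 S0 c where R0: "offdiag_rep Q0 mu \<alpha> N0 S0"
    and c: "\<And>k r \<gamma>. 0 < c k r \<gamma>" and b0: "\<And>k A. A \<in> sets (prod_measure mu k) \<Longrightarrow> moment_bound Q0 mu \<alpha> c S0 k A"
    by (rule ex_canonical_rep[OF fin nz \<alpha>]) blast
  note N0 = offdiag_repD(1)[OF R0]
  note off_sets = offdiag_sets_iff[OF iso]
  have ext_rep: "AE \<omega> in Q. outer_value mu k A (path mu N \<omega>) = S k A \<omega>"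
    if R: "offdiag_rep Q mu \<alpha> N S" and k: "1 \<le> k" and A: "A \<in> offdiag_sets mu k"
    for Q :: "'x measure" and N S k A
    by (rule offdiag_rep_outer_value[OF iso fin \<alpha> R c moment_bound_transfer[OF iso fin R0 c b0 R k] k A])
  note ext_meas = measurable_outer_value[OF iso fin]
  have S0m: "S0 k A \<in> borel_measurable Q0" if "A \<in> offdiag_sets mu k" for k A
    using that by (intro offdiag_repD(2)[OF R0]) (simp add: off_sets)
  have S0bound: "Lnorm Q0 \<gamma> (S0 k A) \<le> ennreal (c k r \<gamma> * measure (prod_measure mu k) A powr (1 / r))"
    if "A \<in> offdiag_sets mu k" "0 < \<gamma>" "\<gamma> < \<alpha>" "\<alpha> < r" for k A \<gamma> r
    using b0[of A k] that unfolding moment_bound_def by (simp add: off_sets)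
  have S0fin: "Lnorm Q0 \<gamma> (S0 k A) < \<infinity>" if "A \<in> offdiag_sets mu k" "0 < \<gamma>" "\<gamma> < \<alpha>" for k A \<gamma>
    using S0bound[OF that, of "2 * \<alpha>"] \<alpha> by (auto intro: le_less_trans)
  have S0ae: "AE \<omega> in Q0. S0 k A \<omega> < \<infinity>" if A: "A \<in> offdiag_sets mu k" for k A
    by (rule AE_finite_of_Lnorm[OF S0m[OF A] S0fin[OF A, of "\<alpha> / 2"]]) (use \<alpha> in auto)

  \<comment> \<open>The functional \<open>outer_value\<close> at \<open>M\<close> is the limit along every approximating sequence.\<close>
  have limit: "L_limit P \<gamma> Xn (\<lambda>\<omega>. outer_value mu k A (path mu M \<omega>))"
    if M: "frechet_sup_measure P mu \<alpha> M" and k: "1 \<le> k" and A: "A \<in> offdiag_sets mu k"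
      and \<gamma>: "0 < \<gamma>" "\<gamma> < \<alpha>" and An: "approx_seq mu k An A" and Xn: "\<forall>n. union_value mu M k (An n) (Xn n)"
    for P :: "'w measure" and M k A \<gamma> An Xn
  proof -
    interpret muk: finite_measure "prod_measure mu k" by (rule finite_measure_prod_measure[OF fin])
    have "\<forall>n. \<exists>l C. (\<forall>i<l. disjoint_sides mu k (C i)) \<and> An n = (\<Union>i<l. Pi\<^sub>E {..<k} (C i)) \<and>
        Xn n = (\<lambda>\<omega>. rect_sup k {..<l} C (path mu M \<omega>))"
      by (intro allI union_value_rect_sup Xn[rule_format])
    from choice[OF this] obtain l where "\<forall>n. \<exists>C. (\<forall>i<l n. disjoint_sides mu k (C i)) \<and> An n = (\<Union>i<l n. Pi\<^sub>E {..<k} (C i)) \<and>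
        Xn n = (\<lambda>\<omega>. rect_sup k {..<l n} C (path mu M \<omega>))" ..
    from choice[OF this] obtain C where *: "\<forall>n. (\<forall>i<l n. disjoint_sides mu k (C n i)) \<and> An n = (\<Union>i<l n. Pi\<^sub>E {..<k} (C n i)) \<and>
        Xn n = (\<lambda>\<omega>. rect_sup k {..<l n} (C n) (path mu M \<omega>))" ..
    then have C: "\<And>n i. i < l n \<Longrightarrow> disjoint_sides mu k (C n i)" by blast
    from * have An_eq: "\<And>n. An n = (\<Union>i<l n. Pi\<^sub>E {..<k} (C n i))"
      and Xn_eq: "\<And>n. Xn n = (\<lambda>\<omega>. rect_sup k {..<l n} (C n) (path mu M \<omega>))" by simp_all
    \<comment> \<open>The approximants as functionals of the values on \<open>\<E>\<close>; on the canonical space they are \<open>S0 k (An n)\<close>.\<close>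
    define W where "W n = rect_sup k {..<l n} (C n)" for n
    have W[measurable]: "W n \<in> borel_measurable (path_space mu)" for n
      unfolding W_def using C by (intro measurable_rect_sup) auto
    have W0: "W n (path mu N0 \<omega>) = S0 k (An n) \<omega>" for n \<omega>
      unfolding W_def An_eq using C by (intro rect_sup_rep[OF R0]) auto
    note [measurable] = ext_meas[OF k A]
    have An_off: "An n \<in> offdiag_sets mu k" for n
      unfolding An_eq using C by (intro offdiag_unions_sets[OF iso]) auto
    have D_off: "sym_diff (An n) A \<in> offdiag_sets mu k" for n
      using An_off[of n] A unfolding off_sets by auto
    have joint[measurable]: "(\<lambda>\<omega>. path mu M \<omega>) \<in> measurable P (path_space mu)"
      by (rule measurable_joint[OF M])
    have "in_L P \<gamma> (Xn n)" for n
    proof -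
      have "Lnorm P \<gamma> (Xn n) = Lnorm Q0 \<gamma> (S0 k (An n))"
        using Lnorm_law_transfer[OF M N0 W, of \<gamma> n] by (simp add: Xn_eq W_def[symmetric] W0)
      moreover have "Xn n \<in> borel_measurable P"
        unfolding Xn_eq W_def[symmetric] by measurable
      ultimately show ?thesis using S0fin[OF An_off \<gamma>] by (simp add: in_L_def)
    qed
    moreover have "in_L P \<gamma> (\<lambda>\<omega>. outer_value mu k A (path mu M \<omega>))"
    proof -
      have "Lnorm P \<gamma> (\<lambda>\<omega>. outer_value mu k A (path mu M \<omega>)) = Lnorm Q0 \<gamma> (\<lambda>\<omega>. outer_value mu k A (path mu N0 \<omega>))"
        by (rule Lnorm_law_transfer[OF M N0]) measurable
      also have "\<dots> = Lnorm Q0 \<gamma> (S0 k A)" by (rule Lnorm_cong_AE[OF ext_rep[OF R0 k A]])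
      finally show ?thesis using S0fin[OF A \<gamma>] by (simp add: in_L_def)
    qed
    moreover have "(\<lambda>n. Lnorm P \<gamma> (\<lambda>\<omega>. edist_abs (Xn n \<omega>) (outer_value mu k A (path mu M \<omega>)))) \<longlonglongrightarrow> 0"
    proof (rule tendsto_sandwich[OF _ _ tendsto_const])
      define r where "r = 2 * \<alpha>"
      have r: "\<alpha> < r" using \<alpha> by (simp add: r_def)
      show "\<forall>\<^sub>F n in sequentially. Lnorm P \<gamma> (\<lambda>\<omega>. edist_abs (Xn n \<omega>) (outer_value mu k A (path mu M \<omega>)))
        \<le> ennreal (c k r \<gamma> * measure (prod_measure mu k) (sym_diff (An n) A) powr (1 / r))"
      proof (intro always_eventually allI)
        fix n
        have "Lnorm P \<gamma> (\<lambda>\<omega>. edist_abs (Xn n \<omega>) (outer_value mu k A (path mu M \<omega>)))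
          = Lnorm Q0 \<gamma> (\<lambda>\<omega>. edist_abs (W n (path mu N0 \<omega>)) (outer_value mu k A (path mu N0 \<omega>)))"
          unfolding Xn_eq W_def[symmetric]
          by (rule Lnorm_law_transfer[OF M N0, of "\<lambda>x. edist_abs (W n x) (outer_value mu k A x)"]) measurable
        also have "\<dots> \<le> Lnorm Q0 \<gamma> (S0 k (sym_diff (An n) A))"
        proof (rule Lnorm_mono_AE[OF \<gamma>(1)])
          show "AE \<omega> in Q0. edist_abs (W n (path mu N0 \<omega>)) (outer_value mu k A (path mu N0 \<omega>))
            \<le> S0 k (sym_diff (An n) A) \<omega>"
            using ext_rep[OF R0 k A] S0ae[OF A] S0ae[OF An_off[of n]]
            by eventually_elim (simp add: W0 edist_offdiag_rep_le[OF R0])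
        qed
        also have "\<dots> \<le> ennreal (c k r \<gamma> * measure (prod_measure mu k) (sym_diff (An n) A) powr (1 / r))"
          by (rule S0bound[OF D_off \<gamma> r])
        finally show "Lnorm P \<gamma> (\<lambda>\<omega>. edist_abs (Xn n \<omega>) (outer_value mu k A (path mu M \<omega>)))
          \<le> ennreal (c k r \<gamma> * measure (prod_measure mu k) (sym_diff (An n) A) powr (1 / r))" .
      qed
      have "(\<lambda>n. measure (prod_measure mu k) (sym_diff (An n) A)) \<longlonglongrightarrow> 0"
      proof -
        have "(\<lambda>n. enn2real (emeasure (prod_measure mu k) (sym_diff (An n) A))) \<longlonglongrightarrow> enn2real 0"
          using An by (intro tendsto_enn2real) (auto simp: approx_seq_def)
        then show ?thesis by (simp add: measure_def)
      qed
      then have "(\<lambda>n. ennreal (c k r \<gamma> * measure (prod_measure mu k) (sym_diff (An n) A) powr (1 / r))) \<longlonglongrightarrow> ennreal (c k r \<gamma> * 0 powr (1 / r))"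
        using \<alpha> r by (intro tendsto_ennrealI tendsto_mult tendsto_const tendsto_powr') auto
      then show "(\<lambda>n. ennreal (c k r \<gamma> * measure (prod_measure mu k) (sym_diff (An n) A) powr (1 / r))) \<longlonglongrightarrow> 0"
        by simp
    qed simp
    ultimately show ?thesis unfolding L_limit_def by blast
  qed

  \<comment> \<open>The sequence and the exponent that define \<open>Y\<close> fall under \<open>limit\<close>, and limits in \<open>L\<^sup>\<gamma>\<close> are unique.\<close>
  have version: "AE \<omega> in P. Y \<omega> = outer_value mu k A (path mu M \<omega>)"
    if M: "frechet_sup_measure P mu \<alpha> M" and k: "1 \<le> k" and A: "A \<in> offdiag_sets mu k"
      and Y: "offdiag_version P mu \<alpha> M k A Y"
    for P :: "'w measure" and M k A Y
  proof -
    from Y obtain \<gamma> An Xn where *: "0 < \<gamma>" "\<gamma> < \<alpha>" "approx_seq mu k An A"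
      "\<forall>n. union_value mu M k (An n) (Xn n)" and lim: "L_limit P \<gamma> Xn Y"
      unfolding offdiag_version_def by blast
    show ?thesis by (rule L_limit_unique[OF *(1) limit[OF M k A *] lim])
  qed

  show ?thesis
  proof (intro exI[of _ c] conjI allI impI ballI)
    show "0 < c k r \<gamma>" for k r \<gamma> by (rule c)
  next
    fix P :: "'w measure" and M k A
    assume k: "1 \<le> k" and A: "A \<in> offdiag_sets mu k"
    show "\<exists>An. approx_seq mu k An A" by (rule ex_approx_seq[OF iso fin k A])
  next
    fix P :: "'w measure" and M k A
    assume M: "frechet_sup_measure P mu \<alpha> M" and k: "1 \<le> k" and A: "A \<in> offdiag_sets mu k"
    show "\<exists>X. (\<forall>\<gamma> An Xn. 0 < \<gamma> \<and> \<gamma> < \<alpha> \<and> approx_seq mu k An A \<and>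
               (\<forall>n. union_value mu M k (An n) (Xn n)) \<longrightarrow> L_limit P \<gamma> Xn X) \<and>
            (\<forall>Y. offdiag_version P mu \<alpha> M k A Y \<longrightarrow> (AE \<omega> in P. Y \<omega> = X \<omega>))"
      using limit[OF M k A] version[OF M k A] by blast
  next
    fix P :: "'w measure" and M Mk and m :: "'a measure" and \<psi> and Q :: "'v measure" and \<Gamma> T
    assume M: "frechet_sup_measure P mu \<alpha> M" and fam: "offdiag_family P mu \<alpha> M Mk"
      and ser: "series_setup mu m \<psi> Q \<Gamma> T"
    have R: "offdiag_rep Q mu \<alpha> (series_measure \<alpha> \<psi> \<Gamma> T) (series_rep \<alpha> \<psi> \<Gamma> T)"
      using ser unfolding series_setup_def
      by (intro offdiag_rep_void_law[OF void_law_series_setup[OF ser] _ fin _ _ \<alpha>]) auto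
    note N = offdiag_repD(1)[OF R]
    let ?I = "SIGMA k:{1..}. offdiag_sets mu k"
    let ?X = "\<lambda>(k, A). Mk k A" and ?Y = "\<lambda>(k, A). series_rep \<alpha> \<psi> \<Gamma> T k A"
    let ?E = "\<lambda>i x. outer_value mu (fst i) (snd i) x"
    have Xm: "?X i \<in> borel_measurable P" if "i \<in> ?I" for i
      using that fam unfolding offdiag_family_def offdiag_version_def L_limit_def in_L_def by fastforce
    have Ym: "?Y i \<in> borel_measurable Q" if "i \<in> ?I" for i
      using that by (auto simp: off_sets intro!: offdiag_repD(2)[OF R])
    have XE: "AE \<omega> in P. ?X i \<omega> = ?E i (path mu M \<omega>)" if "i \<in> ?I" for i
      using that fam version[OF M] by (auto simp: offdiag_family_def split: prod.splits)
    have YE: "AE \<omega> in Q. ?Y i \<omega> = ?E i (path mu (series_measure \<alpha> \<psi> \<Gamma> T) \<omega>)" if "i \<in> ?I" for i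
    proof -
      obtain k A where i: "i = (k, A)" "1 \<le> k" "A \<in> offdiag_sets mu k" using \<open>i \<in> ?I\<close> by auto
      from ext_rep[OF R i(2,3)] show ?thesis unfolding i(1) by eventually_elim simp
    qed
    have Em: "?E i \<in> borel_measurable (path_space mu)" if "i \<in> ?I" for i
      using that by (auto intro!: ext_meas)
    show "fdd_equal ?I P ?X Q ?Y"
      unfolding fdd_equal_def
    proof (intro conjI ballI allI impI)
      fix J assume "finite J \<and> J \<subseteq> ?I"
      then have J: "finite J" "J \<subseteq> ?I" by auto
      have \<Phi>: "(\<lambda>x. \<lambda>i\<in>J. ?E i x) \<in> measurable (path_space mu) (PiM J (\<lambda>_. borel))"
        using J Em by (intro measurable_restrict) blast
      have "distr P (PiM J (\<lambda>_. borel)) (\<lambda>\<omega>. \<lambda>i\<in>J. ?X i \<omega>)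
        = distr P (PiM J (\<lambda>_. borel)) (\<lambda>\<omega>. \<lambda>i\<in>J. ?E i (path mu M \<omega>))"
      proof (rule distr_cong_AE[OF refl refl])
        have "AE \<omega> in P. \<forall>i\<in>J. ?X i \<omega> = ?E i (path mu M \<omega>)"
          using J by (intro AE_finite_allI XE) auto
        then show "AE \<omega> in P. (\<lambda>i\<in>J. ?X i \<omega>) = (\<lambda>i\<in>J. ?E i (path mu M \<omega>))"
          by eventually_elim (intro restrict_ext, blast)
        show "(\<lambda>\<omega>. \<lambda>i\<in>J. ?X i \<omega>) \<in> measurable P (PiM J (\<lambda>_. borel))"
          using J Xm by (intro measurable_restrict) blast
        show "(\<lambda>\<omega>. \<lambda>i\<in>J. ?E i (path mu M \<omega>)) \<in> measurable P (PiM J (\<lambda>_. borel))"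
          by (rule measurable_compose[OF measurable_joint[OF M] \<Phi>])
      qed
      also have "\<dots> = distr Q (PiM J (\<lambda>_. borel)) (\<lambda>\<omega>. \<lambda>i\<in>J. ?E i (path mu (series_measure \<alpha> \<psi> \<Gamma> T) \<omega>))"
        by (rule frechet_law_transfer[OF M N \<Phi>])
      also have "\<dots> = distr Q (PiM J (\<lambda>_. borel)) (\<lambda>\<omega>. \<lambda>i\<in>J. ?Y i \<omega>)"
      proof (rule distr_cong_AE[OF refl refl])
        have "AE \<omega> in Q. \<forall>i\<in>J. ?Y i \<omega> = ?E i (path mu (series_measure \<alpha> \<psi> \<Gamma> T) \<omega>)"
          using J by (intro AE_finite_allI YE) auto
        then show "AE \<omega> in Q. (\<lambda>i\<in>J. ?E i (path mu (series_measure \<alpha> \<psi> \<Gamma> T) \<omega>)) = (\<lambda>i\<in>J. ?Y i \<omega>)"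
          by eventually_elim (intro restrict_ext, simp)
        show "(\<lambda>\<omega>. \<lambda>i\<in>J. ?Y i \<omega>) \<in> measurable Q (PiM J (\<lambda>_. borel))"
          using J Ym by (intro measurable_restrict) blast
        show "(\<lambda>\<omega>. \<lambda>i\<in>J. ?E i (path mu (series_measure \<alpha> \<psi> \<Gamma> T) \<omega>)) \<in> measurable Q (PiM J (\<lambda>_. borel))"
          by (rule measurable_compose[OF measurable_joint[OF N] \<Phi>])
      qed
      finally show "distr P (PiM J (\<lambda>_. borel)) (\<lambda>\<omega>. \<lambda>i\<in>J. ?X i \<omega>) = distr Q (PiM J (\<lambda>_. borel)) (\<lambda>\<omega>. \<lambda>i\<in>J. ?Y i \<omega>)" .
    qed (use Xm Ym in auto)
  next
    fix P :: "'w measure" and M Mk k \<gamma> r A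
    assume M: "frechet_sup_measure P mu \<alpha> M" and fam: "offdiag_family P mu \<alpha> M Mk"
      and k: "1 \<le> k" and \<gamma>r: "0 < \<gamma> \<and> \<gamma> < \<alpha> \<and> \<alpha> < r" and A: "A \<in> offdiag_sets mu k"
    have "Lnorm P \<gamma> (Mk k A) = Lnorm P \<gamma> (\<lambda>\<omega>. outer_value mu k A (path mu M \<omega>))"
      using fam k A by (intro Lnorm_cong_AE version[OF M k A]) (auto simp: offdiag_family_def)
    also have "\<dots> = Lnorm Q0 \<gamma> (\<lambda>\<omega>. outer_value mu k A (path mu N0 \<omega>))"
      by (rule Lnorm_law_transfer[OF M N0 ext_meas[OF k A]])
    also have "\<dots> = Lnorm Q0 \<gamma> (S0 k A)" by (rule Lnorm_cong_AE[OF ext_rep[OF R0 k A]])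
    also have "\<dots> \<le> ennreal (c k r \<gamma> * measure (prod_measure mu k) A powr (1 / r))"
      using \<gamma>r by (intro S0bound A) auto
    finally show "Lnorm P \<gamma> (Mk k A) \<le> ennreal (c k r \<gamma> * measure (prod_measure mu k) A powr (1 / r))" .
  next
    fix P :: "'w measure" and M Mk k and B :: "nat \<Rightarrow> (nat \<Rightarrow> 'a) set"
    assume M: "frechet_sup_measure P mu \<alpha> M" and fam: "offdiag_family P mu \<alpha> M Mk"
      and k: "1 \<le> k" and B: "\<forall>j. B j \<in> offdiag_sets mu k"
    have U: "(\<Union>i. B i) \<in> offdiag_sets mu k" using B unfolding off_sets by blast
    note [measurable] = ext_meas[OF k U] ext_meas[OF k B[rule_format]]
    have "AE \<omega> in Q0. outer_value mu k (\<Union>i. B i) (path mu N0 \<omega>) = (SUP i. outer_value mu k (B i) (path mu N0 \<omega>))"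
    proof -
      have "AE \<omega> in Q0. \<forall>i. outer_value mu k (B i) (path mu N0 \<omega>) = S0 k (B i) \<omega>"
        unfolding AE_all_countable using ext_rep[OF R0 k] B by blast
      with ext_rep[OF R0 k U] show ?thesis
        by eventually_elim (simp add: offdiag_repD(3)[OF R0])
    qed
    then have "AE \<omega> in P. outer_value mu k (\<Union>i. B i) (path mu M \<omega>) = (SUP i. outer_value mu k (B i) (path mu M \<omega>))"
    proof (rule AE_law_transfer[OF M N0, of "\<lambda>x. outer_value mu k (\<Union>i. B i) x = (SUP i. outer_value mu k (B i) x)", rotated])
      have "(\<lambda>x. SUP i. outer_value mu k (B i) x) \<in> borel_measurable (path_space mu)"
        by measurable
      then show "Measurable.pred (path_space mu) (\<lambda>x. outer_value mu k (\<Union>i. B i) x = (SUP i. outer_value mu k (B i) x))"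
        unfolding pred_def by (intro borel_measurable_eq ext_meas[OF k U])
    qed
    moreover have "AE \<omega> in P. \<forall>i. Mk k (B i) \<omega> = outer_value mu k (B i) (path mu M \<omega>)"
      unfolding AE_all_countable using version[OF M k] fam k B unfolding offdiag_family_def by blast
    moreover have "AE \<omega> in P. Mk k (\<Union>i. B i) \<omega> = outer_value mu k (\<Union>i. B i) (path mu M \<omega>)"
      using fam k U by (intro version[OF M k U]) (auto simp: offdiag_family_def)
    ultimately show "AE \<omega> in P. Mk k (\<Union>i. B i) \<omega> = (SUP i. Mk k (B i) \<omega>)"
      by eventually_elim simp
  qed
qed

end
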